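(* Let $\mathcal{U}:=\mathcal{H}[g_1,g_2,g_4,g_6,\ldots]$ be the algebra generated over $\mathcal{H}:=\mathbb{C}[h_1,h_2,h_3,\ldots]$ by $g_1$ and the $g_k$ with $k$ even. For $k\in\mathbb{N}$ we have $u_k\in\mathcal{U}$. In fact, $$u_k(\tau)=-\frac{k!}2\sum_{\substack{\lambda\vdash k\\ \lambda\ne(k^1)}}\phi(\lambda)\,u_\lambda(\tau)+\frac{k!}2\,\mathrm{Tr}_k(\phi,\gamma;\tau)+k!\,g_1(\tau)\,\mathrm{Tr}_{k-1}(\psi,h;\tau),$$ where $u:=\{u_k\}_{k\in\mathbb{N}}$, $\gamma:=\{G_k-2^{k-1}g_k\}_{k\in\mathbb{N}}$, $h:=\{h_k\}_{k\in\mathbb{N}}$, and for $\lambda\vdash k$ $$\phi(\lambda):=\prod_{j=1}^k\frac{2^{m_j}}{j!^{m_j}m_j!},\qquad \psi(\lambda):=\prod_{j=1}^k\frac{(-1)^{m_j}}{j!^{m_j}m_j!}.$$ Moreover, $\mathcal{U}$ is closed under the action of $D:=q\frac{\partial}{\partial q}$.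
   Context: $\mathbb{N}=\{1,2,\dots\}$, $\tau\in\mathbb{H}$ (complex upper half-plane), $q:=e^{2\pi i\tau}$, $\zeta:=e^{2\pi i z}$, with $q^{r}:=e^{2\pi i r\tau}$ and $\zeta^{r}:=e^{2\pi i r z}$ for $r\in\mathbb{Q}$; $D=\frac1{2\pi i}\frac{d}{d\tau}$ on functions of $\tau$. $\eta(\tau):=q^{\frac1{24}}\prod_{n\ge1}(1-q^n)$. Eisenstein series: $G_k(\tau):=-\frac{B_k}{2k}+\sum_{n\ge1}\sigma_{k-1}(n)q^n$ for $k$ even, $G_k:=0$ for $k$ odd, with $B_k$ the Bernoulli numbers and $\sigma_{k-1}(n):=\sum_{d\mid n}d^{k-1}$. Let $T(z;\tau):=2i\sum_{n\ge0}(-1)^n\zeta^{n+\frac12}q^{\frac12(n+\frac12)^2}$, $T_0(\tau):=T(0;\tau)$, and $h(\zeta;q):=(1-\zeta)\sum_{n\ge0}(-1)^n\zeta^{3n}q^{\frac{n(3n+1)}2}(1-\zeta^2q^{2n+1})$. The functions $g_k$ and $h_k$, $k\in\mathbb{N}$, are defined by the expansions around $z=0$ $$T(z;\tau)=T_0(\tau)\exp\left(-\sum_{k\ge1}g_k(\tau)\frac{(2\pi iz)^k}{k!}\right),$$ $$h(\zeta;q)=-2i\sin(\pi z)q^{-\frac1{24}}\eta(\tau)\exp\left(-\sum_{k\ge1}h_k(\tau)\frac{(2\pi iz)^k}{k!}\right).$$ Unimodal ranks: with $(a)_n:=\prod_{j=0}^{n-1}(1-aq^j)$ and $(a,b)_n:=(a)_n(b)_n$,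 let $$U(\zeta;q):=\sum_{n\ge0}\frac{q^n}{(\zeta q,\zeta^{-1}q)_n}.$$ (This is $\sum_{n\geq 0,m\in\mathbb{Z}}u(n,m)\zeta^mq^n$, where $u(n,m)$ counts unimodal sequences $1\le a_1\le\cdots\le a_r\le\underline{c}\ge b_1\ge\cdots\ge b_s\ge1$ with marked peak $c$, size $n=c+\sum_j a_j+\sum_j b_j$ and rank $m=s-r$; the empty sequence is the only one of size $0$ and has rank $0$.) The functions $u_k$, $k\in\mathbb{N}$, are defined by the expansion around $z=0$ $$U(\zeta;q)=\frac{\sin(\pi z)}{\pi z}\,U(1;q)\exp\left(2\sum_{k\ge1}u_k(\tau)\frac{(2\pi iz)^k}{k!}\right).$$ The functions $g_k,u_k$ are regarded as meromorphic functions of $\tau\in\mathbb{H}$ (equivalently, by their $q$-expansions at $q=0$). Partitions are written $\lambda=(1^{m_1},2^{m_2},\ldots,n^{m_n})\vdash n$ with $m_j$ the multiplicity of $j$. For a sequence of functions $f=\{f_k\}_{k\in\mathbb{N}}$, a function $\varphi$ on partitions and $n\in\mathbb{N}_0$, put $f_\lambda(\tau):=\prod_{j=1}^nf_j^{m_j}(\tau)$ and $\mathrm{Tr}_n(\varphi,f;\tau):=\sum_{\lambda\vdash n}\varphi(\lambda)f_\lambda(\tau)$ (empty products are $1$, so $\mathrm{Tr}_0(\psi,h;\tau)=1$). *)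

theory Defs
  imports "HOL-Complex_Analysis.Complex_Analysis" "HOL-Library.Multiset"
begin

section \<open>Functions on the upper half-plane\<close>

definition upper_half_plane :: "complex set" ("\<H>") where
  "\<H> = {\<tau>. Im \<tau> > 0}"

text \<open>\<open>ee \<tau> = q\<close> and \<open>ee z = \<zeta>\<close>; rational powers are read as \<open>q\<^sup>r = ee (r * \<tau>)\<close>,
  \<open>\<zeta>\<^sup>r = ee (r * z)\<close>.\<close>

definition ee :: "complex \<Rightarrow> complex" where
  "ee w = exp (2 * of_real pi * \<i> * w)"

text \<open>
  Meromorphic functions on \<open>\<H>\<close> are represented by total functions on \<open>complex\<close>. Their values at
  poles and outside \<open>\<H>\<close> are irrelevant: two functions represent the same meromorphic function iff
  they agree on \<open>\<H>\<close> off a set without limit points in \<open>\<H>\<close>.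
\<close>

definition mero_eq :: "(complex \<Rightarrow> complex) \<Rightarrow> (complex \<Rightarrow> complex) \<Rightarrow> bool" (infix "\<simeq>" 50) where
  "f \<simeq> g \<longleftrightarrow> (\<forall>\<^sub>\<approx>\<tau>\<in>\<H>. f \<tau> = g \<tau>)"

definition q_deriv :: "(complex \<Rightarrow> complex) \<Rightarrow> complex \<Rightarrow> complex" where
  "q_deriv f \<tau> = deriv f \<tau> / (2 * of_real pi * \<i>)"

text \<open>The complex algebra generated by a set of functions; it is closed under \<open>\<simeq>\<close>, i.e. it
  contains all representatives of its elements.\<close>

inductive_set mero_algebra :: "(complex \<Rightarrow> complex) set \<Rightarrow> (complex \<Rightarrow> complex) set"
  for S :: "(complex \<Rightarrow> complex) set" where
  const: "(\<lambda>_. c) \<in> mero_algebra S"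
| gen: "f \<in> S \<Longrightarrow> f \<in> mero_algebra S"
| add: "f \<in> mero_algebra S \<Longrightarrow> g \<in> mero_algebra S \<Longrightarrow> (\<lambda>\<tau>. f \<tau> + g \<tau>) \<in> mero_algebra S"
| mult: "f \<in> mero_algebra S \<Longrightarrow> g \<in> mero_algebra S \<Longrightarrow> (\<lambda>\<tau>. f \<tau> * g \<tau>) \<in> mero_algebra S"
| cong: "f \<in> mero_algebra S \<Longrightarrow> f \<simeq> g \<Longrightarrow> g \<in> mero_algebra S"


section \<open>Coefficients of exponential expansions\<close>

text \<open>
  \<open>is_expansion F A c a\<close>: around \<open>z = 0\<close>,
  \<open>F z = A z * exp (c * (\<Sum>k\<ge>1. a k * (2 * pi * \<i> * z) ^ k / k!))\<close>. The coefficient \<open>a 0\<close>, which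
  does not occur, is normalised to \<open>0\<close>. The point \<open>z = 0\<close> itself is left out because some
  prefactors \<open>A\<close>, such as \<open>sin (pi * z) / (pi * z)\<close>, have a removable singularity there.
\<close>

definition is_expansion ::
  "(complex \<Rightarrow> complex) \<Rightarrow> (complex \<Rightarrow> complex) \<Rightarrow> complex \<Rightarrow> (nat \<Rightarrow> complex) \<Rightarrow> bool" where
  "is_expansion F A c a \<longleftrightarrow> a 0 = 0 \<and>
     (\<forall>\<^sub>F z in at 0. \<exists>s. (\<lambda>k. a k * (2 * of_real pi * \<i> * z) ^ k / fact k) sums s \<and>
                       F z = A z * exp (c * s))"

definition expansion_coeffs ::
  "(complex \<Rightarrow> complex) \<Rightarrow> (complex \<Rightarrow> complex) \<Rightarrow> complex \<Rightarrow> nat \<Rightarrow> complex" where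
  "expansion_coeffs F A c = (THE a. is_expansion F A c a)"

lemma is_expansion_fps:
  assumes "is_expansion F A c a"
  defines "P \<equiv> Abs_fps (\<lambda>k. a k * (2 * of_real pi * \<i>) ^ k / fact k)"
  shows "fps_conv_radius P > 0" "eval_fps P 0 = 0"
    "\<forall>\<^sub>F z in at 0. F z = A z * exp (c * eval_fps P z)"
proof -
  have eq: "(\<lambda>k. fps_nth P k * z ^ k) = (\<lambda>k. a k * (2 * of_real pi * \<i> * z) ^ k / fact k)" for z
    by (simp add: P_def power_mult_distrib fun_eq_iff)
  have ev: "\<forall>\<^sub>F z in at 0. \<exists>s. (\<lambda>k. fps_nth P k * z ^ k) sums s \<and> F z = A z * exp (c * s)"
    using assms(1) unfolding is_expansion_def eq by blast
  then obtain d where d: "d > 0"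
    "\<And>z. z \<noteq> 0 \<Longrightarrow> dist z 0 < d \<Longrightarrow> \<exists>s. (\<lambda>k. fps_nth P k * z ^ k) sums s \<and> F z = A z * exp (c * s)"
    unfolding eventually_at by auto
  have "summable (\<lambda>k. fps_nth P k * (of_real (d / 2)) ^ k)"
    using d(2)[of "of_real (d / 2)"] \<open>d > 0\<close> by (auto simp: sums_iff)
  then have "conv_radius (fps_nth P) \<ge> norm (of_real (d / 2) :: complex)"
    by (rule conv_radius_geI)
  then show "fps_conv_radius P > 0"
    using \<open>d > 0\<close> unfolding fps_conv_radius_def
    by (smt (verit) ereal_less(2) less_le_trans norm_of_real half_gt_zero)
  show "eval_fps P 0 = 0"
    using assms(1) by (simp add: eval_fps_at_0 P_def is_expansion_def)
  show "\<forall>\<^sub>F z in at 0. F z = A z * exp (c * eval_fps P z)"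
    using ev by eventually_elim (auto simp: eval_fps_def sums_iff)
qed

lemma is_expansion_unique:
  assumes "is_expansion F A c a" "is_expansion F A c b"
    and "c \<noteq> 0" and "\<forall>\<^sub>F z in at 0. A z \<noteq> 0"
  shows "a = b"
proof -
  define P where "P = Abs_fps (\<lambda>k. a k * (2 * of_real pi * \<i>) ^ k / fact k)"
  define Q where "Q = Abs_fps (\<lambda>k. b k * (2 * of_real pi * \<i>) ^ k / fact k)"
  note p = is_expansion_fps[OF assms(1), folded P_def]
  note r = is_expansion_fps[OF assms(2), folded Q_def]
  have PQ: "eval_fps P has_fps_expansion P" "eval_fps Q has_fps_expansion Q"
    using p(1) r(1) by (auto simp: has_fps_expansion_def)
  define f where "f = (\<lambda>z. c * (eval_fps P z - eval_fps Q z))"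
  have "continuous (at 0) f"
    unfolding f_def using PQ by (intro continuous_intros has_fps_expansion_imp_continuous)
  then have "f \<midarrow>0\<rightarrow> 0"
    using p(2) r(2) by (simp add: continuous_at f_def)
  then have "\<forall>\<^sub>F z in at 0. dist (f z) 0 < 2 * pi"
    by (rule tendstoD) simp
  moreover have "\<forall>\<^sub>F z in at 0. exp (f z) = 1"
    using p(3) r(3) assms(4)
    by eventually_elim (auto simp: f_def exp_diff algebra_simps)
  ultimately have "\<forall>\<^sub>F z in at 0. eval_fps P z = eval_fps Q z"
  proof eventually_elim
    case (elim z)
    then obtain n :: int where n: "Re (f z) = 0" "Im (f z) = of_int (2 * n) * pi"
      unfolding exp_eq_1 by blast
    have "\<bar>Im (f z)\<bar> < 2 * pi"
      using elim(1) abs_Im_le_cmod[of "f z"] by simp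
    then have "\<bar>real_of_int n\<bar> * (2 * pi) < 1 * (2 * pi)"
      using n(2) by (simp add: abs_mult)
    then have "\<bar>real_of_int n\<bar> < 1"
      by (rule mult_right_less_imp_less) simp
    then have "n = 0" by linarith
    then have "f z = 0" using n by (simp add: complex_eq_iff)
    then show ?case using \<open>c \<noteq> 0\<close> by (simp add: f_def)
  qed
  then have "\<forall>\<^sub>F z in nhds 0. eval_fps P z = eval_fps Q z"
    using p(2) r(2) by (simp add: eventually_nhds_conv_at)
  then have "eval_fps P has_fps_expansion Q"
    using PQ(2) by (subst has_fps_expansion_cong[OF _ refl]) auto
  with PQ(1) have "P = Q"
    by (rule fps_expansion_unique_complex)
  then have "fps_nth P k = fps_nth Q k" for k by simp
  then show ?thesis
    by (auto simp: P_def Q_def)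
qed

lemma expansion_coeffs_eqI:
  assumes "is_expansion F A c a" "c \<noteq> 0" "\<forall>\<^sub>F z in at 0. A z \<noteq> 0"
  shows "expansion_coeffs F A c = a"
  unfolding expansion_coeffs_def
  using assms by (blast intro: the_equality is_expansion_unique)

lemma is_expansion_expansion_coeffs:
  assumes "G analytic_on {0}" "G 0 = 1" "\<forall>\<^sub>F z in at 0. F z = A z * G z"
    and "c \<noteq> 0" "\<forall>\<^sub>F z in at 0. A z \<noteq> 0"
  shows "is_expansion F A c (expansion_coeffs F A c)"
proof -
  define L where "L = (\<lambda>z. Ln (G z) / c)"
  have "L analytic_on {0}"
    unfolding L_def using assms by (auto intro!: analytic_intros)
  then obtain P where P: "L has_fps_expansion P"
    using analytic_at_imp_has_fps_expansion_0 by blast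
  define a where "a = (\<lambda>k. fps_nth P k * fact k / (2 * of_real pi * \<i>) ^ k)"
  have eq: "a k * (2 * of_real pi * \<i> * z) ^ k / fact k = fps_nth P k * z ^ k" for k z
    by (simp add: a_def power_mult_distrib)
  have "fps_nth P 0 = L 0"
    using has_fps_expansion_imp_0_eq_fps_nth_0[OF P] by simp
  then have "a 0 = 0"
    using assms(2) by (simp add: a_def L_def)
  have "isCont G 0"
    using assms(1) by (simp add: analytic_at_imp_isCont)
  then have "\<forall>\<^sub>F z in at 0. G z \<noteq> 0"
    using assms(2) by (intro tendsto_imp_eventually_ne[where c = 1]) (auto simp: isCont_def)
  moreover have "\<forall>\<^sub>F z in at 0. ereal (norm z) < fps_conv_radius P"
  proof -
    have "fps_conv_radius P > 0" using P by (simp add: has_fps_expansion_def)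
    then have "\<forall>\<^sub>F z in nhds 0. z \<in> eball 0 (fps_conv_radius P)"
      by (intro eventually_nhds_in_open) (auto simp: zero_ereal_def)
    then show ?thesis
      by (auto simp: eventually_at_filter in_eball_iff elim!: eventually_mono)
  qed
  moreover have "\<forall>\<^sub>F z in at 0. eval_fps P z = L z"
    using P by (auto simp: has_fps_expansion_def eventually_at_filter elim!: eventually_mono)
  ultimately have "\<forall>\<^sub>F z in at 0. \<exists>s. (\<lambda>k. a k * (2 * of_real pi * \<i> * z) ^ k / fact k) sums s \<and>
                       F z = A z * exp (c * s)"
    using assms(3)
  proof eventually_elim
    case (elim z)
    have "(\<lambda>k. fps_nth P k * z ^ k) sums L z"
      using sums_eval_fps[of z P] elim by simp
    moreover have "exp (c * L z) = G z"
      using elim \<open>c \<noteq> 0\<close> by (simp add: L_def)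
    ultimately show ?case
      using elim unfolding eq by auto
  qed
  with \<open>a 0 = 0\<close> have "is_expansion F A c a"
    by (simp add: is_expansion_def)
  with expansion_coeffs_eqI[OF this assms(4,5)] show ?thesis by simp
qed


section \<open>The functions \<open>G\<^sub>k\<close>, \<open>g\<^sub>k\<close>, \<open>h\<^sub>k\<close> and \<open>u\<^sub>k\<close>\<close>

definition eta :: "complex \<Rightarrow> complex" where
  "eta \<tau> = ee (\<tau> / 24) * prodinf (\<lambda>n. 1 - ee \<tau> ^ Suc n)"

text \<open>Generating function \<open>x / (exp x - 1) = (\<Sum>k. B\<^sub>k * x ^ k / k!)\<close>.\<close>

definition bernoulli_number :: "nat \<Rightarrow> complex" where
  "bernoulli_number k = fact k * fps_nth (fps_X / (fps_exp 1 - 1)) k"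

lemma bernoulli_number_gf:
  "Abs_fps (\<lambda>k. bernoulli_number k / fact k) * (fps_exp 1 - 1) = fps_X"
proof -
  have "subdegree (fps_exp 1 - 1 :: complex fps) = 1"
    by (intro subdegreeI) auto
  then have "(fps_exp 1 - 1 :: complex fps) dvd fps_X"
    by (subst fps_dvd_iff) auto
  moreover have "Abs_fps (\<lambda>k. bernoulli_number k / fact k) = fps_X / (fps_exp 1 - 1)"
    by (simp add: bernoulli_number_def fps_eq_iff)
  ultimately show ?thesis by simp
qed

definition divisor_sigma :: "nat \<Rightarrow> nat \<Rightarrow> nat" where
  "divisor_sigma k n = (\<Sum>d | d dvd n. d ^ k)"

definition eisenstein :: "nat \<Rightarrow> complex \<Rightarrow> complex" where
  "eisenstein k \<tau> =
     (if even k
      then - bernoulli_number k / (2 * of_nat k) +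
           (\<Sum>n. of_nat (divisor_sigma (k - 1) (Suc n)) * ee \<tau> ^ Suc n)
      else 0)"

definition T_fun :: "complex \<Rightarrow> complex \<Rightarrow> complex" where
  "T_fun z \<tau> = 2 * \<i> *
     (\<Sum>n. (-1) ^ n * ee ((of_nat n + 1/2) * z) * ee (1/2 * (of_nat n + 1/2)\<^sup>2 * \<tau>))"

definition h_fun :: "complex \<Rightarrow> complex \<Rightarrow> complex" where
  "h_fun \<zeta> q = (1 - \<zeta>) *
     (\<Sum>n. (-1) ^ n * \<zeta> ^ (3 * n) * q ^ (n * (3 * n + 1) div 2) * (1 - \<zeta>\<^sup>2 * q ^ (2 * n + 1)))"

definition q_pochhammer :: "complex \<Rightarrow> complex \<Rightarrow> nat \<Rightarrow> complex" where
  "q_pochhammer q a n = (\<Prod>j<n. 1 - a * q ^ j)"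

definition U_fun :: "complex \<Rightarrow> complex \<Rightarrow> complex" where
  "U_fun \<zeta> q = (\<Sum>n. q ^ n / (q_pochhammer q (\<zeta> * q) n * q_pochhammer q (inverse \<zeta> * q) n))"

text \<open>
  As \<open>expansion_coeffs\<close> is applied for each \<open>\<tau>\<close> separately, \<open>g_coeff k \<tau>\<close> and \<open>u_coeff k \<tau>\<close> are
  unspecified at the zeros of \<open>T_fun 0\<close> and \<open>U_fun 1 (ee \<tau>)\<close>, respectively, which are the possible
  poles of these meromorphic functions.
\<close>

definition g_coeff :: "nat \<Rightarrow> complex \<Rightarrow> complex" where
  "g_coeff k \<tau> = expansion_coeffs (\<lambda>z. T_fun z \<tau>) (\<lambda>z. T_fun 0 \<tau>) (-1) k"

definition h_coeff :: "nat \<Rightarrow> complex \<Rightarrow> complex" where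
  "h_coeff k \<tau> = expansion_coeffs (\<lambda>z. h_fun (ee z) (ee \<tau>))
     (\<lambda>z. - 2 * \<i> * sin (of_real pi * z) * ee (- \<tau> / 24) * eta \<tau>) (-1) k"

definition u_coeff :: "nat \<Rightarrow> complex \<Rightarrow> complex" where
  "u_coeff k \<tau> = expansion_coeffs (\<lambda>z. U_fun (ee z) (ee \<tau>))
     (\<lambda>z. sin (of_real pi * z) / (of_real pi * z) * U_fun 1 (ee \<tau>)) 2 k"

definition H_algebra :: "(complex \<Rightarrow> complex) set" where
  "H_algebra = mero_algebra {h_coeff k | k. k \<ge> 1}"

definition U_algebra :: "(complex \<Rightarrow> complex) set" where
  "U_algebra = mero_algebra (H_algebra \<union> {g_coeff 1} \<union> {g_coeff k | k. k \<ge> 1 \<and> even k})"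


section \<open>Traces over partitions\<close>

text \<open>The partition \<open>(1\<^bsup>m\<^sub>1\<^esup>, \<dots>, n\<^bsup>m\<^sub>n\<^esup>)\<close> of \<open>n\<close> is the multiset of its parts, so that \<open>m\<^sub>j\<close> is
  \<open>count lam j\<close>, the size \<open>n\<close> is \<open>sum_mset lam\<close>, and \<open>(k\<^sup>1)\<close> is \<open>{#k#}\<close>.\<close>

definition partitions :: "nat \<Rightarrow> nat multiset set" where
  "partitions n = {lam. 0 \<notin># lam \<and> sum_mset lam = n}"

lemma finite_partitions: "finite (partitions n)"
proof (rule finite_subset)
  show "partitions n \<subseteq> mset ` {xs. set xs \<subseteq> {0..n} \<and> length xs \<le> n}"
  proof
    fix lam assume lam: "lam \<in> partitions n"
    obtain xs where xs: "lam = mset xs" using ex_mset by metis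
    have 0: "0 \<notin> set xs" "sum_list xs = n"
      using lam by (auto simp: partitions_def xs sum_mset_sum_list)
    have "length xs \<le> sum_list xs"
      using 0(1) by (induction xs) auto
    with 0(2) show "lam \<in> mset ` {xs. set xs \<subseteq> {0..n} \<and> length xs \<le> n}"
      by (auto simp: xs intro!: imageI member_le_sum_list)
  qed
qed (simp add: finite_lists_length_le)

definition partition_prod ::
  "(nat \<Rightarrow> complex \<Rightarrow> complex) \<Rightarrow> nat multiset \<Rightarrow> complex \<Rightarrow> complex" where
  "partition_prod f lam \<tau> = (\<Prod>j = 1..sum_mset lam. f j \<tau> ^ count lam j)"

definition partition_trace ::
  "nat \<Rightarrow> (nat multiset \<Rightarrow> complex) \<Rightarrow> (nat \<Rightarrow> complex \<Rightarrow> complex) \<Rightarrow> complex \<Rightarrow> complex" where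
  "partition_trace n \<phi> f \<tau> = (\<Sum>lam\<in>partitions n. \<phi> lam * partition_prod f lam \<tau>)"

definition phi :: "nat multiset \<Rightarrow> complex" where
  "phi lam = (\<Prod>j = 1..sum_mset lam. 2 ^ count lam j / (fact j ^ count lam j * fact (count lam j)))"

definition psi :: "nat multiset \<Rightarrow> complex" where
  "psi lam =
     (\<Prod>j = 1..sum_mset lam. (-1) ^ count lam j / (fact j ^ count lam j * fact (count lam j)))"

definition gamma_coeff :: "nat \<Rightarrow> complex \<Rightarrow> complex" where
  "gamma_coeff k \<tau> = eisenstein k \<tau> - 2 ^ (k - 1) * g_coeff k \<tau>"

end

theory Submission
  imports Defs
begin

text \<open>
  Write \<open>x = 2 * pi * \<i> * z\<close>. Everything follows from Ramanujan's partial theta identity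
  \<open>U (\<zeta>; q) = h (\<zeta>; q) + \<zeta> * (\<Sum>n. (-1)^n \<zeta>^(2 n) q^(n (n + 1) / 2)) / ((\<zeta> q)\<^sub>\<infinity> (q / \<zeta>)\<^sub>\<infinity>)\<close>,
  in which the partial theta function is \<open>T (2 z)\<close> up to a factor and, by the product expansion of the
  Jacobi theta function, \<open>1 / ((\<zeta> q)\<^sub>\<infinity> (q / \<zeta>)\<^sub>\<infinity>)\<close> is \<open>sin (pi z) / (pi z) * exp (2 * \<Sum>G\<^sub>k x^k / k!)\<close>
  up to a constant. It becomes
  \<open>exp (2 u(x)) = exp (2 \<gamma>(x)) - K * x * exp (- h(x))\<close> for the exponential generating functions,
  and \<open>K = - 2 * g\<^sub>1\<close> because \<open>U\<close> is invariant under \<open>\<zeta> \<mapsto> 1 / \<zeta>\<close>, so that \<open>u\<^sub>1 = 0\<close>. Comparing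
  coefficients gives the formula for \<open>u\<^sub>k\<close>. The odd parts of \<open>U\<close> and \<open>T\<close> in \<open>z\<close> yield
  \<open>exp (- h(x)) + exp (- h(- x)) = 2 * exp (2 G(x) - 2 G(2 x))\<close> and
  \<open>exp (- g(x)) - exp (- g(- x)) = - 2 * g\<^sub>1 * x * exp (- 2 G(x))\<close>, which express the \<open>G\<^sub>k\<close> by the
  \<open>h\<^sub>k\<close>, and the \<open>g\<^sub>k\<close> with \<open>k\<close> odd by \<open>g\<^sub>1\<close>, the \<open>G\<^sub>k\<close> and the \<open>g\<^sub>k\<close> with \<open>k\<close> even. Closure under \<open>D\<close>
  holds because \<open>T\<close> and \<open>\<eta> * exp (- h)\<close> are sums of terms \<open>\<zeta>^\<alpha> q^(\<kappa> \<alpha>^2)\<close> with \<open>\<kappa>\<close> fixed, so they solve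
  heat equations.
\<close>

section \<open>Exponential generating functions and partitions\<close>

text \<open>The relations are proved at one fixed \<open>\<tau>\<close>, as identities of power
  series in \<open>z\<close>. The only restriction they ever carry is that
  \<open>T_fun 0 \<tau>\<close> is nonzero. As \<open>U_fun 1 (ee \<tau>)\<close> is
  \<open>T_fun 0 \<tau>\<close> times a nonvanishing factor, this excludes the unspecified values of
  \<open>g_coeff\<close> and \<open>u_coeff\<close> alike, and the excluded points are sparse, so
  the identities pass to \<open>\<simeq>\<close>. Coefficients of exponentials are compared, and the
  n-th one is linear in the n-th unknown plus a polynomial in the earlier unknowns. Each membership
  claim is an induction that solves for this top unknown; for the Eisenstein series it divides by 2
  - 2^(n+1). The obstacle to closure under D is that a heat equation raises the order in
  \<open>z\<close> by two. For even k, D g_k contains the product g_1 g_(k+1), whose second factor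
  has odd index and is no generator when k >= 2. The odd g_k must therefore lie in
  \<open>U_algebra\<close> before any derivative is taken. The partial theta identity is obtained
  after clearing the denominators of U, from a comparison of the arguments \<open>a\<close> and
  \<open>a * q\<close>.\<close>

definition pweight :: "(nat \<Rightarrow> complex) \<Rightarrow> nat multiset \<Rightarrow> complex" where
  "pweight b lam = (\<Prod>j = 1..sum_mset lam. b j ^ count lam j / fact (count lam j))"

text \<open>The n-th Taylor coefficient of exp (c * (sum of a_j X^j / j!)), grouped by partitions;
  \<open>fps_exp_compose_ser\<close> justifies this reading. The weights \<open>phi\<close> and
  \<open>psi\<close> are the cases c = 2 and c = -1.\<close>

definition pexp :: "complex \<Rightarrow> (nat \<Rightarrow> complex) \<Rightarrow> nat \<Rightarrow> complex" where
  "pexp c a n = (\<Sum>lam\<in>partitions n. pweight (\<lambda>j. c * a j / fact j) lam)"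

lemma partitions_le: "lam \<in> partitions n \<Longrightarrow> j \<in># lam \<Longrightarrow> j \<in> {1..n}"
  by (auto simp: partitions_def Suc_le_eq dest!: multi_member_split intro!: Nat.gr0I)

text \<open>Indices of multiplicity 0 contribute the factor 1. The freedom in \<open>S\<close>
  allows partitions of different sizes to be compared over one index set.\<close>

lemma pweight_eq:
  assumes "0 \<notin># lam" "finite S" "set_mset lam \<subseteq> S"
  shows "pweight b lam = (\<Prod>j\<in>S. b j ^ count lam j / fact (count lam j))"
proof -
  have "pweight b lam = (\<Prod>j\<in>set_mset lam. b j ^ count lam j / fact (count lam j))"
    unfolding pweight_def using assms(1) partitions_le[of lam "sum_mset lam"]
    by (intro prod.mono_neutral_right) (auto simp: partitions_def not_in_iff)
  also have "\<dots> = (\<Prod>j\<in>S. b j ^ count lam j / fact (count lam j))"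
    using assms by (intro prod.mono_neutral_left) (auto simp: not_in_iff)
  finally show ?thesis .
qed

lemma pweight_add_mset:
  assumes "0 \<notin># mu" "j \<ge> 1"
  shows "of_nat (Suc (count mu j)) * pweight b (add_mset j mu) = b j * pweight b mu"
proof -
  define S where "S = insert j (set_mset mu)"
  define R where "R = (\<Prod>i\<in>S - {j}. b i ^ count mu i / fact (count mu i))"
  have "pweight b (add_mset j mu) = (\<Prod>i\<in>S. b i ^ count (add_mset j mu) i / fact (count (add_mset j mu) i))"
    using assms by (intro pweight_eq) (auto simp: S_def)
  also have "\<dots> = b j ^ Suc (count mu j) / fact (Suc (count mu j)) * R"
    unfolding R_def by (subst prod.remove[of _ j]) (auto simp: S_def)
  finally have 1: "pweight b (add_mset j mu) = b j ^ Suc (count mu j) / fact (Suc (count mu j)) * R" .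
  have "pweight b mu = (\<Prod>i\<in>S. b i ^ count mu i / fact (count mu i))"
    using assms by (intro pweight_eq) (auto simp: S_def)
  also have "\<dots> = b j ^ count mu j / fact (count mu j) * R"
    unfolding R_def by (subst prod.remove[of _ j]) (auto simp: S_def)
  finally have 2: "pweight b mu = b j ^ count mu j / fact (count mu j) * R" .
  have "of_nat (Suc k) \<noteq> (0::complex)" for k by (rule of_nat_neq_0)
  then show ?thesis unfolding 1 2 fact_Suc by (simp add: field_simps del: of_nat_Suc)
qed

lemma sum_mset_eq_sum_count:
  fixes lam :: "nat multiset"
  assumes "finite S" "set_mset lam \<subseteq> S"
  shows "sum_mset lam = (\<Sum>j\<in>S. j * count lam j)"
  using assms(2)
proof (induction lam)
  case (add x lam)
  have "(\<Sum>j\<in>S. j * count (add_mset x lam) j) = (\<Sum>j\<in>S. j * count lam j + (if j = x then x else 0))"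
    by (intro sum.cong) auto
  then show ?case using add assms(1) by (simp add: sum.distrib)
qed simp

text \<open>The coefficient form of Y' = c A' Y for Y = exp (c A). Combinatorially, the size n of a
  partition is the sum of j times the multiplicity of j, and each summand is evaluated by deleting
  one part j.\<close>

lemma pexp_rec: "of_nat n * pexp c a n = (\<Sum>j=1..n. of_nat j * (c * a j / fact j) * pexp c a (n - j))"
proof -
  define b where "b = (\<lambda>j. c * a j / fact j)"
  \<comment> \<open>Deleting one copy of j is a bijection from the partitions of n that contain j
    onto those of n - j; the multiplicity cancels against the factorial in the weight.\<close>
  have e: "(\<Sum>lam\<in>partitions n. of_nat (count lam j) * pweight b lam) = b j * pexp c a (n - j)"
    if j: "j \<in> {1..n}" for j
  proof -
    have "(\<Sum>lam\<in>partitions n. of_nat (count lam j) * pweight b lam)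
      = (\<Sum>lam\<in>{lam \<in> partitions n. j \<in># lam}. of_nat (count lam j) * pweight b lam)"
      by (intro sum.mono_neutral_right finite_partitions) (auto simp: not_in_iff)
    also have "\<dots> = (\<Sum>mu\<in>partitions (n - j). b j * pweight b mu)"
    proof (rule sum.reindex_bij_witness[of _ "add_mset j" "\<lambda>lam. lam - {#j#}"])
      fix mu assume mu: "mu \<in> partitions (n - j)"
      then show "add_mset j mu \<in> {lam \<in> partitions n. j \<in># lam}"
        using j by (auto simp: partitions_def)
    next
      fix lam assume "lam \<in> {lam \<in> partitions n. j \<in># lam}"
      then obtain mu where mu: "lam = add_mset j mu" "lam \<in> partitions n" by (auto dest: multi_member_split)
      then show "lam - {#j#} \<in> partitions (n - j)" by (auto simp: partitions_def)
      show "b j * pweight b (lam - {#j#}) = of_nat (count lam j) * pweight b lam"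
        using mu j pweight_add_mset[of mu j b] by (auto simp: partitions_def)
    qed auto
    finally show ?thesis by (simp add: pexp_def b_def sum_distrib_left)
  qed
  have "of_nat n * pexp c a n = (\<Sum>lam\<in>partitions n. of_nat (\<Sum>j=1..n. j * count lam j) * pweight b lam)"
    unfolding pexp_def sum_distrib_left b_def
  proof (intro sum.cong refl)
    fix lam assume "lam \<in> partitions n"
    then have "n = (\<Sum>j=1..n. j * count lam j)"
      using sum_mset_eq_sum_count[of "{1..n}" lam] partitions_le[of lam n]
      by (simp add: partitions_def subset_iff)
    then show "of_nat n * pweight (\<lambda>j. c * a j / fact j) lam
        = of_nat (\<Sum>j=1..n. j * count lam j) * pweight (\<lambda>j. c * a j / fact j) lam" by simp
  qed
  also have "\<dots> = (\<Sum>lam\<in>partitions n. \<Sum>j=1..n. of_nat j * (of_nat (count lam j) * pweight b lam))"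
    by (simp add: sum_distrib_right mult.assoc)
  also have "\<dots> = (\<Sum>j=1..n. \<Sum>lam\<in>partitions n. of_nat j * (of_nat (count lam j) * pweight b lam))"
    by (rule sum.swap)
  also have "\<dots> = (\<Sum>j=1..n. of_nat j * (b j * pexp c a (n - j)))"
    by (intro sum.cong refl) (simp only: sum_distrib_left[symmetric] e)
  finally show ?thesis by (simp add: b_def mult_ac)
qed

lemma partitions_0: "partitions 0 = {{#}}"
proof -
  have "mu = {#}" if "sum_mset mu = 0" "0 \<notin># mu" for mu :: "nat multiset"
    using that by (cases mu) auto
  then show ?thesis by (auto simp: partitions_def)
qed

lemma pexp_0: "pexp c a 0 = 1"
  by (simp add: pexp_def partitions_0 pweight_def)

text \<open>Only the one-part partition involves \<open>a n\<close>, and it does so linearly. Hence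
  \<open>a n\<close> can be recovered from \<open>pexp c a n\<close> and the earlier
  entries.\<close>

lemma pexp_split:
  assumes "n \<ge> 1"
  shows "pexp c a n = c * a n / fact n + (\<Sum>lam\<in>partitions n - {{#n#}}. pweight (\<lambda>j. c * a j / fact j) lam)"
proof -
  have "{#n#} \<in> partitions n" using assms by (auto simp: partitions_def)
  moreover have "pweight (\<lambda>j. c * a j / fact j) {#n#} = c * a n / fact n"
    by (subst pweight_eq[of _ "{n}"]) (use assms in auto)
  ultimately show ?thesis
    unfolding pexp_def by (subst sum.remove[of _ "{#n#}"]) (auto simp: finite_partitions)
qed

lemma partitions_less: "lam \<in> partitions n - {{#n#}} \<Longrightarrow> j \<in># lam \<Longrightarrow> j \<in> {1..<n}"
proof -
  assume lam: "lam \<in> partitions n - {{#n#}}" and j: "j \<in># lam"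
  have jn: "j \<in> {1..n}" using lam j partitions_le by blast
  moreover have "j \<noteq> n"
  proof
    assume "j = n"
    then obtain mu where mu: "lam = add_mset n mu" using j by (auto dest: multi_member_split)
    then have "sum_mset mu = 0" "0 \<notin># mu" using lam by (auto simp: partitions_def)
    then have "mu = {#}" by (cases mu) auto
    then show False using lam mu by simp
  qed
  ultimately show ?thesis by simp
qed

text \<open>An exponential generating function in x = 2 pi i z, written as a power series in
  \<open>z\<close>; this is the series occurring in \<open>is_expansion\<close>.\<close>

definition ser :: "(nat \<Rightarrow> complex) \<Rightarrow> complex fps" where
  "ser a = Abs_fps (\<lambda>k. a k * (2 * of_real pi * \<i>) ^ k / fact k)"

definition pser :: "complex \<Rightarrow> (nat \<Rightarrow> complex) \<Rightarrow> complex fps" where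
  "pser c a = Abs_fps (\<lambda>n. (2 * of_real pi * \<i>) ^ n * pexp c a n)"

text \<open>Both sides have constant term 1, and differentiating the left side yields the recursion
  \<open>pexp_rec\<close>, which determines all further coefficients.\<close>

lemma fps_exp_compose_ser:
  assumes "a 0 = 0"
  shows "fps_exp c oo ser a = pser c a"
proof -
  define w where "w = 2 * of_real pi * \<i>"
  define X where "X = fps_exp c oo ser a"
  have "fps_deriv X = fps_const c * X * fps_deriv (ser a)"
    unfolding X_def using assms by (subst fps_compose_deriv) (simp_all add: ser_def fps_compose_mult_distrib)
  then have rec: "of_nat (Suc n) * fps_nth X (Suc n) = (\<Sum>i=0..n. c * fps_nth X i * (of_nat (Suc (n - i)) * fps_nth (ser a) (Suc (n - i))))" for n
    using arg_cong[of _ _ "\<lambda>F. fps_nth F n"] by (metis (no_types, lifting) fps_deriv_nth fps_mult_nth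
      fps_mult_left_const_nth Suc_eq_plus1 sum.cong)
  have "fps_nth X n = w ^ n * pexp c a n" for n
  proof (induction n rule: less_induct)
    case (less n)
    show ?case
    proof (cases n)
      case 0
      then show ?thesis by (simp add: X_def pexp_0)
    next
      case (Suc m)
      have "of_nat n * fps_nth X n = (\<Sum>i=0..m. c * fps_nth X i * (of_nat (Suc (m - i)) * fps_nth (ser a) (Suc (m - i))))"
        unfolding Suc by (rule rec)
      also have "\<dots> = (\<Sum>j=1..n. c * fps_nth X (n - j) * (of_nat j * fps_nth (ser a) j))"
        by (rule sum.reindex_bij_witness[of _ "\<lambda>j. n - j" "\<lambda>i. n - i"]) (auto simp: Suc Suc_diff_le)
      also have "\<dots> = (\<Sum>j=1..n. w ^ n * (of_nat j * (c * a j / fact j) * pexp c a (n - j)))"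
      proof (intro sum.cong refl)
        fix j assume j: "j \<in> {1..n}"
        then have "w ^ n = w ^ (n - j) * w ^ j" by (simp add: power_add[symmetric])
        then show "c * fps_nth X (n - j) * (of_nat j * fps_nth (ser a) j) = w ^ n * (of_nat j * (c * a j / fact j) * pexp c a (n - j))"
          using less[of "n - j"] j by (simp add: ser_def w_def)
      qed
      also have "\<dots> = of_nat n * (w ^ n * pexp c a n)"
        unfolding sum_distrib_left[symmetric] pexp_rec[symmetric] by simp
      finally show ?thesis using Suc by (simp del: of_nat_Suc)
    qed
  qed
  then show ?thesis unfolding X_def[symmetric] by (simp add: fps_eq_iff pser_def w_def)
qed

lemma has_fps_expansion_exp_ser:
  assumes "f has_fps_expansion ser a" "a 0 = 0"
  shows "(\<lambda>z. exp (c * f z)) has_fps_expansion pser c a"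
proof -
  have "((\<lambda>z. exp (c * z)) \<circ> f) has_fps_expansion (fps_exp c oo ser a)"
    using assms by (intro has_fps_expansion_compose has_fps_expansion_exp) (auto simp: ser_def)
  then show ?thesis using assms(2) by (simp add: fps_exp_compose_ser o_def)
qed

lemma is_expansionD:
  assumes "is_expansion F A c a"
  obtains f where "f has_fps_expansion ser a" "a 0 = 0" "\<forall>\<^sub>F z in at 0. F z = A z * exp (c * f z)"
proof
  show "eval_fps (ser a) has_fps_expansion ser a"
    using is_expansion_fps(1)[OF assms] by (auto simp: has_fps_expansion_def ser_def)
  show "a 0 = 0" using assms by (simp add: is_expansion_def)
  show "\<forall>\<^sub>F z in at 0. F z = A z * exp (c * eval_fps (ser a) z)"
    using is_expansion_fps(3)[OF assms] by (simp add: ser_def)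
qed

lemma phi_partition_prod: "phi lam * partition_prod f lam \<tau> = pweight (\<lambda>j. 2 * f j \<tau> / fact j) lam"
  by (simp add: phi_def partition_prod_def pweight_def prod.distrib[symmetric] power_mult_distrib power_divide)

lemma partition_trace_phi: "partition_trace n phi f \<tau> = pexp 2 (\<lambda>j. f j \<tau>) n"
  unfolding partition_trace_def pexp_def phi_partition_prod ..

lemma partition_trace_psi: "partition_trace n psi f \<tau> = pexp (-1) (\<lambda>j. f j \<tau>) n"
  unfolding partition_trace_def pexp_def
proof (intro sum.cong refl)
  fix lam
  show "psi lam * partition_prod f lam \<tau> = pweight (\<lambda>j. - 1 * f j \<tau> / fact j) lam"
    unfolding psi_def partition_prod_def pweight_def prod.distrib[symmetric] power_divide power_mult_distrib
    by (intro prod.cong refl) (simp only: times_divide_eq_left times_divide_eq_right divide_divide_eq_left mult_ac)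
qed

section \<open>The partial theta identity\<close>

definition qinf :: "complex \<Rightarrow> complex \<Rightarrow> complex" where
  "qinf q x = (\<Prod>n. 1 - x * q ^ n)"

context
  fixes q :: complex
  assumes q: "norm q < 1"
begin

lemma convergent_qinf: "convergent_prod (\<lambda>n. 1 - x * q ^ n)"
proof (intro abs_convergent_prod_imp_convergent_prod summable_imp_abs_convergent_prod)
  have "summable (\<lambda>n. norm x * norm q ^ n)"
    using q by (intro summable_mult summable_geometric) auto
  then show "summable (\<lambda>n. norm (1 - x * q ^ n - 1))"
    by (simp add: norm_mult norm_power)
qed

lemma qinf_LIMSEQ: "(\<lambda>N. \<Prod>n<N. 1 - x * q ^ n) \<longlonglongrightarrow> qinf q x"
  using convergent_prod_LIMSEQ[OF convergent_qinf, of x]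
  unfolding qinf_def by (simp add: LIMSEQ_lessThan_iff_atMost)

lemma qinf_rec: "qinf q x = (1 - x) * qinf q (x * q)"
proof -
  have "(\<lambda>N. \<Prod>n<Suc N. 1 - x * q ^ n) \<longlonglongrightarrow> qinf q x"
    using qinf_LIMSEQ by (rule LIMSEQ_Suc)
  moreover have "(\<lambda>N. \<Prod>n<Suc N. 1 - x * q ^ n) = (\<lambda>N. (1 - x) * (\<Prod>n<N. 1 - x * q * q ^ n))"
    by (simp add: prod.lessThan_Suc_shift mult.assoc del: prod.lessThan_Suc)
  moreover have "(\<lambda>N. (1 - x) * (\<Prod>n<N. 1 - x * q * q ^ n)) \<longlonglongrightarrow> (1 - x) * qinf q (x * q)"
    by (intro tendsto_intros qinf_LIMSEQ)
  ultimately show ?thesis using LIMSEQ_unique by metis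
qed

lemma qinf_split: "qinf q x = (\<Prod>n<N. 1 - x * q ^ n) * qinf q (x * q ^ N)"
proof (induction N)
  case (Suc N)
  then show ?case
    using qinf_rec[of "x * q ^ N"] by (simp add: mult_ac)
qed simp

lemma qinf_nonzero:
  assumes "\<And>n. x * q ^ n \<noteq> 1" shows "qinf q x \<noteq> 0"
  unfolding qinf_def using assms
  by (intro prodinf_nonzero convergent_qinf) (metis right_minus_eq)

text \<open>The finite products satisfy |prod (1 + y_n) - 1| <= prod (1 + |y_n|) - 1 <= exp (sum
  |y_n|) - 1, and here the |y_n| form a geometric series.\<close>

lemma norm_qinf_minus_1_le: "norm (qinf q x - 1) \<le> exp (norm x / (1 - norm q)) - 1"
proof (rule Lim_norm_ubound)
  show "(\<lambda>N. (\<Prod>n<N. 1 - x * q ^ n) - 1) \<longlonglongrightarrow> qinf q x - 1"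
    by (intro tendsto_intros qinf_LIMSEQ)
  show "\<forall>\<^sub>F N in sequentially. norm ((\<Prod>n<N. 1 - x * q ^ n) - 1) \<le> exp (norm x / (1 - norm q)) - 1"
  proof (rule always_eventually, intro allI)
    fix N
    have "norm ((\<Prod>n<N. 1 + (- x * q ^ n)) - 1) \<le> (\<Prod>n<N. 1 + norm (- x * q ^ n)) - 1"
      by (rule norm_prod_minus1_le_prod_minus1)
    also have "(\<Prod>n<N. 1 + norm (- x * q ^ n)) \<le> exp (\<Sum>n<N. norm (- x * q ^ n))"
      by (intro prod_le_exp_sum) auto
    also have "(\<Sum>n<N. norm (- x * q ^ n)) = (\<Sum>n<N. norm x * norm q ^ n)"
      by (simp add: norm_mult norm_power)
    also have "\<dots> \<le> (\<Sum>n. norm x * norm q ^ n)"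
      using q by (intro sum_le_suminf summable_mult summable_geometric) auto
    also have "\<dots> = norm x / (1 - norm q)"
      using q by (simp add: suminf_mult summable_geometric suminf_geometric)
    finally show "norm ((\<Prod>n<N. 1 - x * q ^ n) - 1) \<le> exp (norm x / (1 - norm q)) - 1"
      by simp
  qed
qed simp

lemma norm_qinf_le: "norm (qinf q x) \<le> exp (norm x / (1 - norm q))"
  using norm_qinf_minus_1_le[of x] norm_triangle_sub[of "qinf q x" 1] by simp

lemma power_norm_tendsto_0: "(\<lambda>n. norm q ^ n) \<longlonglongrightarrow> 0"
  using q by (intro LIMSEQ_power_zero) simp

lemma qinf_tendsto_1: "(\<lambda>n. qinf q (x * q ^ n)) \<longlonglongrightarrow> 1"
proof (rule LIM_zero_cancel, rule Lim_null_comparison)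
  show "\<forall>\<^sub>F n in sequentially. norm (qinf q (x * q ^ n) - 1)
      \<le> exp (norm x * norm q ^ n / (1 - norm q)) - 1"
    using norm_qinf_minus_1_le[of "x * q ^ n" for n] by (simp add: norm_mult norm_power)
  have "(\<lambda>n. exp (norm x * norm q ^ n / (1 - norm q)) - 1) \<longlonglongrightarrow> exp (norm x * 0 / (1 - norm q)) - 1"
    using q by (intro tendsto_intros power_norm_tendsto_0) auto
  then show "(\<lambda>n. exp (norm x * norm q ^ n / (1 - norm q)) - 1) \<longlonglongrightarrow> 0" by simp
qed

lemma norm_qinf_power_le: "norm (qinf q (x * q ^ n)) \<le> exp (norm x / (1 - norm q))"
proof -
  have "norm (x * q ^ n) \<le> norm x * 1"
    using q unfolding norm_mult norm_power by (intro mult_left_mono power_le_one) auto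
  then have "exp (norm (x * q ^ n) / (1 - norm q)) \<le> exp (norm x / (1 - norm q))"
    using q by (simp add: divide_right_mono)
  then show ?thesis using norm_qinf_le[of "x * q ^ n"] by linarith
qed

section \<open>The theta product and the q-difference equation for U with cleared
  denominators\<close>

definition qtheta :: "complex \<Rightarrow> complex" where "qtheta a = qinf q a * qinf q (q / a)"

text \<open>The shift removes the factor 1 - a and creates 1 - 1 / a, and the quotient of the new
  factor by the old one is - 1 / a.\<close>

lemma qtheta_shift:
  assumes "a \<noteq> 0" "q \<noteq> 0"
  shows "qtheta (a * q) = - qtheta a / a"
proof -
  have "q / (a * q) = 1 / a" using assms by simp
  then have "qtheta (a * q) = qinf q (a * q) * ((1 - 1 / a) * qinf q (q / a))"
    using qinf_rec[of "1 / a"] by (simp add: qtheta_def)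
  also have "\<dots> = - ((1 - a) * qinf q (a * q)) * qinf q (q / a) / a"
    using assms by (simp add: field_simps)
  finally show ?thesis using qinf_rec[of a] by (simp add: qtheta_def)
qed

text \<open>This is U(a; q) multiplied by (a q)_infinity (q / a)_infinity, which turns each finite
  denominator into a tail of the product. The series thus makes sense at every nonzero argument, in
  particular at all \<open>a * q ^ N\<close>.\<close>

definition qV :: "complex \<Rightarrow> complex" where
  "qV a = (\<Sum>n. q ^ n * (qinf q (a * q ^ (n+1)) * qinf q (1 / a * q ^ (n+1))))"

lemma summable_bounded_power:
  assumes "\<And>n. norm (f n) \<le> K"
  shows "summable (\<lambda>n. norm (q ^ (Suc k * n) * f n))"
proof (rule summable_comparison_test')
  show "summable (\<lambda>n. norm q ^ n * K)"
    using q by (intro summable_mult2 summable_geometric) auto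
  fix n :: nat
  have "norm q ^ (Suc k * n) \<le> norm q ^ n"
    using q by (intro power_decreasing) auto
  then show "norm (norm (q ^ (Suc k * n) * f n)) \<le> norm q ^ n * K"
    using assms[of n] by (simp add: norm_mult norm_power mult_mono')
qed

text \<open>The auxiliary sums \<open>M k = (\<Sum>n. q ^ (k * n) * s n)\<close> satisfy a linear relation because
  \<open>s\<close> satisfies a first-order recurrence, whose sum telescopes.\<close>

lemma qV_shift:
  assumes a: "a \<noteq> 0" and q0: "q \<noteq> 0"
  shows "a ^ 4 * q\<^sup>2 * qV (a * q) = qV a - (1 - a\<^sup>2 * q) * (qtheta a + a)"
proof -
  \<comment> \<open>The common factor of the n-th terms at \<open>a\<close> and at
    \<open>a * q\<close>. Each of these terms has one linear factor more, so both sums are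
    combinations of \<open>M 1\<close> and \<open>M 2\<close>; a third combination then allows the
    elimination of both.\<close>
  define s where "s = (\<lambda>n. qinf q (a * q * q * q ^ n) * qinf q (1 / a * q * q ^ n))"
  define K where "K = exp (norm (a * q * q) / (1 - norm q)) * exp (norm (1 / a * q) / (1 - norm q))"
  have s_le: "norm (s n) \<le> K" for n
    unfolding s_def K_def norm_mult[of "qinf _ _"] by (intro mult_mono norm_qinf_power_le) auto
  define M where "M = (\<lambda>k. \<Sum>n. q ^ (k * n) * s n)"
  have sM: "(\<lambda>n. q ^ (Suc k * n) * s n) sums M (Suc k)" for k
    unfolding M_def
    by (rule summable_sums, rule summable_norm_cancel, rule summable_bounded_power[OF s_le])
  have M1: "(\<lambda>n. q ^ n * s n) sums M 1" using sM[of 0] by simp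
  have M2: "(\<lambda>n. q ^ (2 * n) * s n) sums M 2" using sM[of 1] by (simp add: numeral_2_eq_2)
  have e1: "qinf q (a * q ^ (n + 1)) = (1 - a * q ^ (n+1)) * qinf q (a * q * q * q ^ n)" for n
    using qinf_rec[of "a * q ^ (n + 1)"] by (simp add: mult_ac)
  have e2: "qinf q (1 / a * q ^ n) = (1 - q ^ n / a) * qinf q (1 / a * q * q ^ n)" for n
    using qinf_rec[of "1 / a * q ^ n"] by (simp add: mult_ac)
  have "(\<lambda>n. q ^ n * s n - a * q * (q ^ (2 * n) * s n)) sums (M 1 - a * q * M 2)"
    by (intro sums_diff sums_mult M1 M2)
  also have "(\<lambda>n. q ^ n * s n - a * q * (q ^ (2 * n) * s n)) =
      (\<lambda>n. q ^ n * (qinf q (a * q ^ (n+1)) * qinf q (1 / a * q ^ (n+1))))"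
    unfolding e1 by (simp add: s_def algebra_simps power_add mult_2 mult_2_right)
  finally have Va: "qV a = M 1 - a * q * M 2" unfolding qV_def by (rule sums_unique[symmetric])
  have "(\<lambda>n. q ^ n * s n - 1 / a * (q ^ (2 * n) * s n)) sums (M 1 - 1 / a * M 2)"
    by (intro sums_diff sums_mult M1 M2)
  also have "(\<lambda>n. q ^ n * s n - 1 / a * (q ^ (2 * n) * s n)) =
      (\<lambda>n. q ^ n * (qinf q (a * q * q ^ (n+1)) * qinf q (1 / (a * q) * q ^ (n+1))))"
  proof
    fix n
    have "1 / (a * q) * q ^ (n+1) = 1 / a * q ^ n" using q0 by simp
    then show "q ^ n * s n - 1 / a * (q ^ (2 * n) * s n) =
      q ^ n * (qinf q (a * q * q ^ (n+1)) * qinf q (1 / (a * q) * q ^ (n+1)))"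
      by (simp only: e2) (simp add: s_def algebra_simps power_add mult_2 mult_2_right)
  qed
  finally have Vaq: "qV (a * q) = M 1 - 1 / a * M 2" unfolding qV_def by (rule sums_unique[symmetric])
  define r where "r = (\<lambda>n. qinf q (a * q * q ^ n) * qinf q (1 / a * q ^ n))"
  have rs: "r n = (1 - a * q * q ^ n) * (1 - q ^ n / a) * s n" for n
    using e1[of n] e2[of n] by (simp add: r_def s_def mult_ac)
  have rSuc: "r (Suc n) = s n" for n
    by (simp add: r_def s_def mult_ac)
  \<comment> \<open>The telescoping sum has two boundary terms. The limit 1 becomes the summand
    \<open>a\<close> of the inhomogeneity, which later builds the partial theta series
    \<open>qC\<close>; \<open>r 0\<close> is \<open>qtheta (a * q)\<close> and later builds
    \<open>qH\<close>.\<close>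
  have "r \<longlonglongrightarrow> 1 * 1"
    unfolding r_def by (intro tendsto_mult qinf_tendsto_1)
  then have "(\<lambda>n. r (Suc n) - r n) sums (1 - r 0)" by (intro telescope_sums) simp
  moreover have "r (Suc n) - r n = (a * q + 1 / a) * (q ^ n * s n) - q * (q ^ (2 * n) * s n)" for n
    using a unfolding rSuc rs[of n] by (simp add: field_simps mult_2 mult_2_right power_add)
  ultimately have "(\<lambda>n. (a * q + 1 / a) * (q ^ n * s n) - q * (q ^ (2 * n) * s n)) sums (1 - r 0)"
    by simp
  moreover have "(\<lambda>n. (a * q + 1 / a) * (q ^ n * s n) - q * (q ^ (2 * n) * s n)) sums
      ((a * q + 1 / a) * M 1 - q * M 2)"
    by (intro sums_diff sums_mult M1 M2)
  ultimately have "1 - r 0 = (a * q + 1 / a) * M 1 - q * M 2" by (rule sums_unique2)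
  moreover have "r 0 = - qtheta a / a"
    using qtheta_shift[OF a q0] q0 by (simp add: r_def qtheta_def)
  ultimately have "qtheta a / a + 1 = (a * q + 1 / a) * M 1 - q * M 2" by (simp add: add.commute)
  then have *: "qtheta a + a = (a\<^sup>2 * q + 1) * M 1 - a * q * M 2"
    using a by (simp add: field_simps power2_eq_square)
  show ?thesis unfolding Va Vaq * using a
    by (simp add: field_simps power2_eq_square power4_eq_xxxx)
qed

text \<open>Of the two products in a term only the one with argument q^(n+1-N) / a grows with N. It
  gains N leading factors, and the j-th power of \<open>norm q\<close>, for j < N, brings one of
  them below 1 + 1 / |a|; altogether this uses the exponent N (N - 1) / 2.\<close>

lemma norm_qV_shift_le:
  assumes a: "a \<noteq> 0" and q0: "q \<noteq> 0"
  obtains K where "\<And>N. norm (qV (a * q ^ N)) * norm q ^ (N * (N - 1) div 2) \<le> K * (1 + 1 / norm a) ^ N"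
proof -
  define E where "E = exp (norm (a * q) / (1 - norm q)) * exp (norm (q / a) / (1 - norm q))"
  have step: "norm (qinf q (a * q ^ N * q ^ (n+1)) * qinf q (1 / (a * q ^ N) * q ^ (n+1)))
     * norm q ^ (N * (N - 1) div 2) \<le> E * (1 + 1 / norm a) ^ N" for n N
  proof -
    have 1: "norm (qinf q (a * q ^ N * q ^ (n+1))) \<le> exp (norm (a * q) / (1 - norm q))"
      using norm_qinf_power_le[of "a * q" "N + n"] by (simp add: mult_ac power_add)
    \<comment> \<open>Stated for every \<open>x\<close> with \<open>x * q ^ N = 1 / a\<close>, so
      that the induction can split off the outermost factor and continue with
      \<open>x * q\<close>.\<close>
    have gen: "norm (qinf q (x * q ^ (n + 1))) * norm q ^ (N * (N - 1) div 2)
        \<le> exp (norm (q / a) / (1 - norm q)) * (1 + 1 / norm a) ^ N"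
      if "x * q ^ N = 1 / a" for x n N using that
    proof (induction N arbitrary: x n)
      case 0
      have "norm (qinf q (q / a * q ^ n)) \<le> exp (norm (q / a) / (1 - norm q))"
        by (rule norm_qinf_power_le)
      then show ?case using 0 by (simp add: mult_ac)
    next
      case (Suc N)
      have xq: "x * q * q ^ N = 1 / a" using Suc.prems by (simp add: mult.assoc)
      note IH = Suc.IH[OF xq, of n]
      have "qinf q (x * q ^ (n+1)) = (1 - x * q ^ (n + 1)) * qinf q (x * q * q ^ (n+1))"
        using qinf_rec[of "x * q ^ (n+1)"] by (simp add: mult_ac)
      moreover have "norm (1 - x * q ^ (n+1)) * norm q ^ N \<le> 1 + 1 / norm a"
      proof -
        have "norm (1 - x * q ^ (n+1)) * norm q ^ N \<le> (1 + norm (x * q ^ (n+1))) * norm q ^ N"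
          using norm_triangle_ineq4[of 1 "x * q ^ (n+1)"] by (intro mult_right_mono) auto
        also have "\<dots> = norm q ^ N + norm (x * q * q ^ N) * norm q ^ n"
          by (simp add: norm_mult norm_power algebra_simps)
        also have "\<dots> \<le> 1 + norm (x * q * q ^ N) * 1"
          using q by (intro add_mono mult_left_mono power_le_one) auto
        finally show ?thesis using xq by (simp add: norm_divide)
      qed
      moreover have "Suc N * (Suc N - 1) div 2 = N + N * (N - 1) div 2"
        by (cases N) auto
      ultimately have "norm (qinf q (x * q ^ (n + 1))) * norm q ^ (Suc N * (Suc N - 1) div 2)
         = (norm (1 - x * q ^ (n+1)) * norm q ^ N) * (norm (qinf q (x * q * q ^ (n+1))) * norm q ^ (N * (N - 1) div 2))"
        by (simp only: norm_mult power_add mult_ac)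
      also have "\<dots> \<le> (1 + 1 / norm a) * (exp (norm (q / a) / (1 - norm q)) * (1 + 1 / norm a) ^ N)"
        by (intro mult_mono IH) (use \<open>norm (1 - x * q ^ (n+1)) * norm q ^ N \<le> 1 + 1 / norm a\<close> in auto)
      finally show ?case by (simp add: mult_ac)
    qed
    have 2: "norm (qinf q (1 / (a * q ^ N) * q ^ (n+1))) * norm q ^ (N * (N - 1) div 2)
        \<le> exp (norm (q / a) / (1 - norm q)) * (1 + 1 / norm a) ^ N"
      using q0 a by (intro gen) auto
    have "norm (qinf q (a * q ^ N * q ^ (n+1))) *
        (norm (qinf q (1 / (a * q ^ N) * q ^ (n+1))) * norm q ^ (N * (N - 1) div 2))
       \<le> exp (norm (a * q) / (1 - norm q)) * (exp (norm (q / a) / (1 - norm q)) * (1 + 1 / norm a) ^ N)"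
      by (intro mult_mono 1 2) auto
    then show ?thesis by (simp add: E_def norm_mult mult_ac)
  qed
  have "norm (qV (a * q ^ N)) * norm q ^ (N * (N - 1) div 2) \<le> E / (1 - norm q) * (1 + 1 / norm a) ^ N" for N
  proof -
    define f where "f = (\<lambda>n. qinf q (a * q ^ N * q ^ (n+1)) * qinf q (1 / (a * q ^ N) * q ^ (n+1)))"
    define B where "B = E * (1 + 1 / norm a) ^ N / norm q ^ (N * (N - 1) div 2)"
    have fB: "norm (f n) \<le> B" for n
      using step[where n = n and N = N] q0 unfolding f_def B_def by (simp add: pos_le_divide_eq)
    have sm: "summable (\<lambda>n. norm (q ^ n * f n))"
      using summable_bounded_power[OF fB, of 0] by simp
    have "norm (qV (a * q ^ N)) \<le> (\<Sum>n. norm (q ^ n * f n))"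
      unfolding qV_def f_def[symmetric] using sm summable_norm f_def by metis
    also have "\<dots> \<le> (\<Sum>n. norm q ^ n * B)"
      using fB q by (intro suminf_le sm summable_mult2 summable_geometric)
        (auto simp: norm_mult norm_power intro!: mult_left_mono)
    also have "\<dots> = B / (1 - norm q)"
      using q by (simp add: suminf_mult2[symmetric] summable_geometric suminf_geometric)
    finally have "norm (qV (a * q ^ N)) * norm q ^ (N * (N - 1) div 2) \<le> B / (1 - norm q) * norm q ^ (N * (N - 1) div 2)"
      by (intro mult_right_mono) auto
    also have "\<dots> = E / (1 - norm q) * (1 + 1 / norm a) ^ N"
      using q0 by (simp add: B_def)
    finally show ?thesis .
  qed
  then show ?thesis using that by blast
qed


section \<open>Iterated shifts and theta-like series\<close>

lemma qtheta_shift_power: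
  assumes "a \<noteq> 0" "q \<noteq> 0"
  shows "qtheta (a * q ^ k) * a ^ k * q ^ (k * (k - 1) div 2) = (-1) ^ k * qtheta a"
proof (induction k)
  case (Suc k)
  have e: "Suc k * (Suc k - 1) div 2 = k * (k - 1) div 2 + k" by (cases k) auto
  have "qtheta (a * q ^ k * q) * (a * q ^ k) = - qtheta (a * q ^ k)"
    using qtheta_shift[of "a * q ^ k"] assms by simp
  moreover have "qtheta (a * q ^ Suc k) * a ^ Suc k * q ^ (Suc k * (Suc k - 1) div 2) =
      (qtheta (a * q ^ k * q) * (a * q ^ k)) * a ^ k * q ^ (k * (k - 1) div 2)"
    unfolding e power_add power_Suc by (simp only: mult_ac)
  ultimately show ?case using Suc by simp
qed simp

text \<open>The prefactor collects (a q^k)^4 q^2 over k < N, which is a^(4 N) q^(2 N^2).\<close>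

lemma qV_iterate:
  assumes a: "a \<noteq> 0" and q0: "q \<noteq> 0"
  shows "qV a = (\<Sum>k<N. a ^ (4 * k) * q ^ (2 * k\<^sup>2) * (1 - a\<^sup>2 * q ^ (2 * k + 1)) * (qtheta (a * q ^ k) + a * q ^ k))
     + a ^ (4 * N) * q ^ (2 * N\<^sup>2) * qV (a * q ^ N)"
proof (induction N)
  case (Suc N)
  define b where "b = a * q ^ N"
  have "b \<noteq> 0" using a q0 by (simp add: b_def)
  have V: "qV b = (1 - b\<^sup>2 * q) * (qtheta b + b) + b ^ 4 * q\<^sup>2 * qV (b * q)"
    using qV_shift[OF \<open>b \<noteq> 0\<close> q0] by simp
  have b2: "b\<^sup>2 * q = a\<^sup>2 * q ^ (2 * N + 1)"
    by (simp add: b_def power_mult_distrib power_mult[symmetric] mult.commute)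
  have "(4::nat) * Suc N = 4 * N + 4" "2 * (Suc N)\<^sup>2 = 2 * N\<^sup>2 + (N * 4 + 2)"
    by (simp_all add: power2_eq_square)
  then have 4: "a ^ (4 * Suc N) * q ^ (2 * (Suc N)\<^sup>2) = a ^ (4 * N) * q ^ (2 * N\<^sup>2) * (b ^ 4 * q\<^sup>2)"
    by (simp add: b_def power_mult_distrib power_mult[symmetric] power_add power2_eq_square mult_ac)
  have bq: "b * q = a * q ^ Suc N" by (simp add: b_def)
  show ?case
    unfolding sum.lessThan_Suc 4 bq[symmetric] b_def[symmetric] b2[symmetric]
    by (subst Suc.IH[folded b_def], subst V) (simp add: algebra_simps)
qed simp

text \<open>Consecutive terms have the ratio c q^n, which tends to 0 whatever the size of
  \<open>c\<close>.\<close>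

lemma summable_theta:
  fixes c :: complex
  shows "summable (\<lambda>n. norm (c ^ n * q ^ (n * (n - 1) div 2)))"
proof (cases "c = 0")
  case True
  show ?thesis
    by (rule summable_comparison_test_ev[OF _ summable_zero])
      (use True in \<open>auto intro!: eventually_mono[OF eventually_gt_at_top[of 0]]\<close>)
next
  case c: False
  have "(\<lambda>n. norm c * norm q ^ n) \<longlonglongrightarrow> norm c * 0"
    by (intro tendsto_intros power_norm_tendsto_0)
  then have "\<forall>\<^sub>F n in sequentially. norm c * norm q ^ n < 1 / 2"
    by (intro order_tendstoD) auto
  then obtain N where N: "\<And>n. n \<ge> N \<Longrightarrow> norm c * norm q ^ n < 1 / 2"
    by (auto simp: eventually_sequentially)
  show ?thesis
  proof (rule summable_ratio_test[of "1/2" N])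
    fix n assume "n \<ge> N"
    have e: "Suc n * (Suc n - 1) div 2 = n * (n - 1) div 2 + n" by (cases n) auto
    have "norm (norm (c ^ Suc n * q ^ (Suc n * (Suc n - 1) div 2)))
        = (norm c * norm q ^ n) * norm (norm (c ^ n * q ^ (n * (n - 1) div 2)))"
      unfolding e by (simp add: norm_mult norm_power power_add)
    also have "\<dots> \<le> 1 / 2 * norm (norm (c ^ n * q ^ (n * (n - 1) div 2)))"
      using N[OF \<open>n \<ge> N\<close>] by (intro mult_right_mono) auto
    finally show "norm (norm (c ^ Suc n * q ^ (Suc n * (Suc n - 1) div 2)))
        \<le> 1 / 2 * norm (norm (c ^ n * q ^ (n * (n - 1) div 2)))" .
  qed simp
qed

lemma summable_theta':
  fixes c :: complex
  assumes "\<And>n. e n \<ge> n * (n - 1) div 2" "\<And>n. norm (f n) \<le> norm c ^ n"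
  shows "summable (\<lambda>n. norm (f n * q ^ e n))"
proof (rule summable_comparison_test'[OF summable_theta[of c]])
  fix n :: nat
  have "norm q ^ e n \<le> norm q ^ (n * (n - 1) div 2)"
    using q assms(1)[of n] by (intro power_decreasing) auto
  then show "norm (norm (f n * q ^ e n)) \<le> norm (c ^ n * q ^ (n * (n - 1) div 2))"
    using assms(2)[of n] by (simp add: norm_mult norm_power mult_mono')
qed

text \<open>Here h(a; q) is \<open>(1 - a) * qH a\<close>. The factor 1 - a is left out because in
  the identity it is supplied by the theta product.\<close>

definition qH :: "complex \<Rightarrow> complex" where
  "qH a = (\<Sum>n. (-1) ^ n * a ^ (3 * n) * q ^ (n * (3 * n + 1) div 2) * (1 - a\<^sup>2 * q ^ (2 * n + 1)))"

definition qC :: "complex \<Rightarrow> complex" where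
  "qC a = (\<Sum>n. (-1) ^ n * a ^ (2 * n + 1) * q ^ (n * (n + 1) div 2))"

lemma qC_sums: "(\<lambda>n. (-1) ^ n * a ^ (2 * n + 1) * q ^ (n * (n + 1) div 2)) sums qC a"
proof -
  have "summable (\<lambda>n. norm ((-1) ^ n * a ^ (2 * n) * q ^ (n * (n + 1) div 2)))"
    by (intro summable_theta'[of _ _ "a\<^sup>2"] div_le_mono mult_le_mono)
      (auto simp: norm_mult norm_power power_mult)
  then have "summable (\<lambda>n. a * ((-1) ^ n * a ^ (2 * n) * q ^ (n * (n + 1) div 2)))"
    by (rule summable_mult[OF summable_norm_cancel])
  then show ?thesis unfolding qC_def by (intro summable_sums) (simp add: mult_ac)
qed

lemma qH_sums:
  "(\<lambda>n. (-1) ^ n * a ^ (3 * n) * q ^ (n * (3 * n + 1) div 2) * (1 - a\<^sup>2 * q ^ (2 * n + 1))) sums qH a"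
proof -
  define f where "f = (\<lambda>n. (-1) ^ n * a ^ (3 * n) * q ^ (n * (3 * n + 1) div 2))"
  have "summable (\<lambda>n. norm (f n))"
    unfolding f_def by (intro summable_theta'[of _ _ "a ^ 3"] div_le_mono mult_le_mono)
      (auto simp: norm_mult norm_power power_mult)
  then have "summable (\<lambda>n. norm (f n) * (1 + norm a ^ 2))"
    by (rule summable_mult2)
  then have "summable (\<lambda>n. f n * (1 - a\<^sup>2 * q ^ (2 * n + 1)))"
  proof (rule summable_comparison_test')
    fix n :: nat
    have "norm q ^ (2 * n + 1) \<le> 1"
      using q by (intro power_le_one) auto
    then have "norm (a\<^sup>2 * q ^ (2 * n + 1)) \<le> norm a ^ 2 * 1"
      unfolding norm_mult norm_power by (intro mult_left_mono) auto
    then have "norm (1 - a\<^sup>2 * q ^ (2 * n + 1)) \<le> 1 + norm a ^ 2"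
      using norm_triangle_ineq4[of 1 "a\<^sup>2 * q ^ (2 * n + 1)"] by simp
    then show "norm (f n * (1 - a\<^sup>2 * q ^ (2 * n + 1))) \<le> norm (f n) * (1 + norm a ^ 2)"
      unfolding norm_mult[of "f n"] by (intro mult_left_mono) auto
  qed
  then show ?thesis unfolding qH_def f_def by (rule summable_sums)
qed

text \<open>Iterating \<open>qV_shift\<close> moves the argument to \<open>a * q ^ N\<close>; the remainder vanishes in the limit because
  \<open>norm_qV_shift_le\<close> costs only \<open>q ^ (- N * (N - 1) / 2)\<close> against the factor \<open>q ^ (2 * N\<^sup>2)\<close>.\<close>

theorem partial_theta_identity:
  assumes a: "a \<noteq> 0" and q0: "q \<noteq> 0"
  shows "qV a = qtheta a * qH a + qC a"
proof -
  define f where "f = (\<lambda>n. (-1) ^ n * a ^ (3 * n) * q ^ (n * (3 * n + 1) div 2) * (1 - a\<^sup>2 * q ^ (2 * n + 1)))"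
  define g where "g = (\<lambda>n. (-1) ^ n * a ^ (2 * n + 1) * q ^ (n * (n + 1) div 2))"
  \<comment> \<open>The exponent 2 k^2 is k (3 k + 1) / 2 + k (k - 1) / 2. The second part is
    absorbed by the k-fold theta shift and leaves the k-th term of \<open>qH\<close>; the summand a
    q^k, multiplied out, gives the terms 2 k and 2 k + 1 of \<open>qC\<close>.\<close>
  have tm: "a ^ (4 * k) * q ^ (2 * k\<^sup>2) * (1 - a\<^sup>2 * q ^ (2 * k + 1)) * (qtheta (a * q ^ k) + a * q ^ k)
      = qtheta a * f k + (g (2 * k) + g (2 * k + 1))" for k
  proof -
    have "2 * k\<^sup>2 = k * (3 * k + 1) div 2 + k * (k - 1) div 2"
    proof -
      have "even (k * (3 * k + 1))" "even (k * (k - 1))" by (cases "even k"; simp)+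
      moreover have "k * (3 * k + 1) + k * (k - 1) = 4 * k\<^sup>2"
        using le_square[of k] by (simp add: power2_eq_square diff_mult_distrib2 distrib_left)
      ultimately show ?thesis
        by (simp add: div_plus_div_distrib_dvd_left[symmetric])
    qed
    then have qp: "q ^ (2 * k\<^sup>2) = q ^ (k * (3 * k + 1) div 2) * q ^ (k * (k - 1) div 2)"
      by (simp only: power_add)
    have ap: "a ^ (4 * k) = a ^ (3 * k) * a ^ k"
      by (simp add: power_add[symmetric])
    have "a ^ (4 * k) * q ^ (2 * k\<^sup>2) * qtheta (a * q ^ k) =
       a ^ (3 * k) * q ^ (k * (3 * k + 1) div 2) * (qtheta (a * q ^ k) * a ^ k * q ^ (k * (k - 1) div 2))"
      unfolding qp ap by (simp only: mult_ac)
    also have "\<dots> = (-1) ^ k * a ^ (3 * k) * q ^ (k * (3 * k + 1) div 2) * qtheta a"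
      unfolding qtheta_shift_power[OF a q0] by (simp add: mult_ac)
    finally have 1: "a ^ (4 * k) * q ^ (2 * k\<^sup>2) * (1 - a\<^sup>2 * q ^ (2 * k + 1)) * qtheta (a * q ^ k) = qtheta a * f k"
      by (simp add: f_def mult_ac)
    have e: "2 * k * (2 * k + 1) div 2 = 2 * k\<^sup>2 + k"
      "(2 * k + 1) * (2 * k + 1 + 1) div 2 = 2 * k\<^sup>2 + k + (2 * k + 1)"
      by (simp_all add: power2_eq_square algebra_simps)
    have p: "a ^ (2 * (2 * k) + 1) = a ^ (4 * k) * a" "a ^ (2 * (2 * k + 1) + 1) = a ^ (4 * k) * a * a\<^sup>2"
      by (simp_all add: power2_eq_square mult_ac)
    have "g (2 * k) = a ^ (4 * k) * a * (q ^ (2 * k\<^sup>2) * q ^ k)"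
      unfolding g_def p e by (simp add: power_add)
    moreover have "g (2 * k + 1) = - (a ^ (4 * k) * a * a\<^sup>2 * (q ^ (2 * k\<^sup>2) * q ^ k * q ^ (2 * k + 1)))"
      unfolding g_def p e by (simp add: power_add) (simp add: power_add[symmetric])
    ultimately have 2: "a ^ (4 * k) * q ^ (2 * k\<^sup>2) * (1 - a\<^sup>2 * q ^ (2 * k + 1)) * (a * q ^ k) = g (2 * k) + g (2 * k + 1)"
      by (simp add: algebra_simps)
    show ?thesis using 1 2 by (simp only: distrib_left)
  qed
  have gsum: "(\<Sum>k<N. g (2 * k) + g (2 * k + 1)) = (\<Sum>n<2 * N. g n)" for N
    by (induction N) auto
  have "(\<lambda>N. qtheta a * (\<Sum>n<N. f n) + (\<Sum>n<2 * N. g n)) \<longlonglongrightarrow> qtheta a * qH a + qC a"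
  proof (intro tendsto_intros)
    show "(\<lambda>N. \<Sum>n<N. f n) \<longlonglongrightarrow> qH a" using qH_sums unfolding sums_def f_def .
    have "(\<lambda>N. \<Sum>n<N. g n) \<longlonglongrightarrow> qC a" using qC_sums unfolding sums_def g_def .
    then show "(\<lambda>N. \<Sum>n<2 * N. g n) \<longlonglongrightarrow> qC a"
      by (rule filterlim_compose[OF _ mult_nat_left_at_top]) simp
  qed
  moreover have "(\<lambda>N. a ^ (4 * N) * q ^ (2 * N\<^sup>2) * qV (a * q ^ N)) \<longlonglongrightarrow> 0"
  proof -
    obtain K where K: "\<And>N. norm (qV (a * q ^ N)) * norm q ^ (N * (N - 1) div 2) \<le> K * (1 + 1 / norm a) ^ N"
      using norm_qV_shift_le[OF a q0] by blast
    \<comment> \<open>As 2 N^2 >= 2 (N (N - 1) / 2), one copy of the power pays for the growth of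
      \<open>qV\<close>. The other one turns the remainder into a term of
      \<open>summable_theta\<close> whose base \<open>r\<close> collects all N-th powers.\<close>
    define r where "r = norm a ^ 4 * (1 + 1 / norm a)"
    define c where "c = (of_real r :: complex)"
    have "r \<ge> 0" by (simp add: r_def)
    then have nc: "norm c = r" by (simp add: c_def)
    have "(\<lambda>N. norm (c ^ N * q ^ (N * (N - 1) div 2))) \<longlonglongrightarrow> 0"
      by (rule summable_LIMSEQ_zero[OF summable_theta])
    then have lim: "(\<lambda>N. norm K * norm (c ^ N * q ^ (N * (N - 1) div 2))) \<longlonglongrightarrow> 0"
      by (rule tendsto_mult_right_zero)
    show ?thesis
    proof (rule Lim_null_comparison[OF always_eventually lim], intro allI)
      fix N :: nat
      have "2 * N\<^sup>2 \<ge> N * (N - 1) div 2 + N * (N - 1) div 2"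
        by (simp add: power2_eq_square diff_mult_distrib2)
      then have "norm q ^ (2 * N\<^sup>2) \<le> norm q ^ (N * (N - 1) div 2) * norm q ^ (N * (N - 1) div 2)"
        using q unfolding power_add[symmetric] by (intro power_decreasing) auto
      then have "norm (a ^ (4 * N) * q ^ (2 * N\<^sup>2) * qV (a * q ^ N)) \<le>
          norm a ^ (4 * N) * (norm q ^ (N * (N - 1) div 2) * norm q ^ (N * (N - 1) div 2)) * norm (qV (a * q ^ N))"
        unfolding norm_mult norm_power by (intro mult_mono) auto
      also have "\<dots> = norm a ^ (4 * N) * norm q ^ (N * (N - 1) div 2) * (norm (qV (a * q ^ N)) * norm q ^ (N * (N - 1) div 2))"
        by simp
      also have "\<dots> \<le> norm a ^ (4 * N) * norm q ^ (N * (N - 1) div 2) * (norm K * (1 + 1 / norm a) ^ N)"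
        by (intro mult_left_mono order_trans[OF K[of N]] mult_right_mono) auto
      also have "\<dots> = norm K * norm (c ^ N * q ^ (N * (N - 1) div 2))"
        unfolding norm_mult norm_power nc r_def power_mult_distrib power_mult by (simp only: mult_ac)
      finally show "norm (a ^ (4 * N) * q ^ (2 * N\<^sup>2) * qV (a * q ^ N))
          \<le> norm K * norm (c ^ N * q ^ (N * (N - 1) div 2))" .
    qed
  qed
  ultimately have "(\<lambda>N. qtheta a * (\<Sum>n<N. f n) + (\<Sum>n<2 * N. g n) + a ^ (4 * N) * q ^ (2 * N\<^sup>2) * qV (a * q ^ N))
      \<longlonglongrightarrow> qtheta a * qH a + qC a + 0"
    by (rule tendsto_add)
  moreover have "qV a = qtheta a * (\<Sum>n<N. f n) + (\<Sum>n<2 * N. g n) + a ^ (4 * N) * q ^ (2 * N\<^sup>2) * qV (a * q ^ N)" for N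
  proof -
    have "(\<Sum>k<N. qtheta a * f k + (g (2 * k) + g (2 * k + 1))) = qtheta a * (\<Sum>n<N. f n) + (\<Sum>n<2 * N. g n)"
      unfolding gsum[symmetric] sum_distrib_left by (rule sum.distrib)
    then show ?thesis
      using qV_iterate[OF a q0, of N] unfolding tm by simp
  qed
  ultimately show ?thesis
    by (simp add: LIMSEQ_const_iff)
qed

end

section \<open>U in terms of the theta product; Gaussian binomials\<close>

context
  fixes q :: complex
  assumes q: "norm q < 1"
begin

text \<open>The theta product without its factor 1 - a: it is invariant under inversion of
  \<open>a\<close> and does not vanish at a = 1, the point around which everything is
  expanded.\<close>

definition qP :: "complex \<Rightarrow> complex" where "qP a = qinf q (a * q) * qinf q (q / a)"

lemma qtheta_eq_qP: "qtheta q a = (1 - a) * qP a"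
  using qinf_rec[OF q, of a] by (simp add: qtheta_def[OF q] qP_def)

lemma qP_inverse: "qP (inverse a) = qP a"
  by (simp add: qP_def field_simps)

lemma q_pochhammer_qinf: "qinf q a = q_pochhammer q a n * qinf q (a * q ^ n)"
  unfolding q_pochhammer_def by (rule qinf_split[OF q])

text \<open>If \<open>qP a\<close> is nonzero then so is each finite denominator of U, since it
  divides \<open>qP a\<close>. The terms of U are then those of \<open>qV\<close> divided by
  \<open>qP a\<close>, and the partial theta identity can be divided by it as well.\<close>

lemma U_fun_eq:
  assumes a: "a \<noteq> 0" and q0: "q \<noteq> 0" and P: "qP a \<noteq> 0"
  shows "U_fun a q = (1 - a) * qH q a + qC q a / qP a"
proof -
  have "q ^ n / (q_pochhammer q (a * q) n * q_pochhammer q (inverse a * q) n)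
      = 1 / qP a * (q ^ n * (qinf q (a * q ^ (n + 1)) * qinf q (1 / a * q ^ (n + 1))))" for n
    using P q_pochhammer_qinf[of "a * q" n] q_pochhammer_qinf[of "inverse a * q" n]
    by (auto simp: qP_def field_simps)
  moreover have "summable (\<lambda>n. q ^ n * (qinf q (a * q ^ (n + 1)) * qinf q (1 / a * q ^ (n + 1))))"
  proof -
    define K where "K = exp (norm (a * q) / (1 - norm q)) * exp (norm (1 / a * q) / (1 - norm q))"
    have "norm (qinf q (a * q ^ (n + 1)) * qinf q (1 / a * q ^ (n + 1))) \<le> K" for n
      unfolding K_def norm_mult[of "qinf _ _"]
      using norm_qinf_power_le[OF q, of "a * q" n] norm_qinf_power_le[OF q, of "1 / a * q" n]
      by (intro mult_mono) (auto simp: mult_ac)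
    from summable_norm_cancel[OF summable_bounded_power[OF q this, of 0]] show ?thesis by simp
  qed
  ultimately have "U_fun a q = 1 / qP a * qV q a"
    unfolding U_fun_def qV_def[OF q] by (simp only: suminf_mult)
  then show ?thesis
    using P partial_theta_identity[OF q a q0] by (simp add: qtheta_eq_qP field_simps)
qed

text \<open>The triple product is obtained as the limit of the \<open>q\<close>-binomial theorem for \<open>2 N + 1\<close> factors,
  centred at the middle.\<close>

definition qfac :: "nat \<Rightarrow> complex" where "qfac M = (\<Prod>j<M. 1 - q ^ Suc j)"

lemma qfac_nonzero: "qfac M \<noteq> 0"
proof -
  have "q ^ Suc j \<noteq> 1" for j
  proof
    assume "q ^ Suc j = 1"
    then have "norm q ^ Suc j = 1" by (metis norm_power norm_one)
    moreover have "norm q ^ Suc j \<le> norm q ^ 1" using q by (intro power_decreasing) auto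
    ultimately show False using q by simp
  qed
  then show ?thesis by (auto simp: qfac_def)
qed

lemma qfac_Suc: "qfac (Suc M) = (1 - q ^ Suc M) * qfac M"
  by (simp add: qfac_def)

lemma qfac_LIMSEQ: "qfac \<longlonglongrightarrow> qinf q q"
  using qinf_LIMSEQ[OF q, of q] by (simp add: qfac_def[abs_def])

lemma qinf_q_nonzero: "qinf q q \<noteq> 0"
  using qfac_nonzero[of "Suc _"] qinf_nonzero[OF q, of q]
  by (metis eq_iff_diff_eq_0 mult_eq_0_iff power_Suc qfac_Suc)

text \<open>The Gaussian binomial coefficient. The value 0 for k > M makes the Pascal rule valid for
  all k and lets sums be extended past M.\<close>

definition qbin :: "nat \<Rightarrow> nat \<Rightarrow> complex" where
  "qbin M k = (if k \<le> M then qfac M / (qfac k * qfac (M - k)) else 0)"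

lemma qbin_0: "qbin M 0 = 1"
  using qfac_nonzero by (simp add: qbin_def qfac_def)

text \<open>For M = k + d + 1, cancelling the q-factorials leaves 1 - q^(M+1) = (1 - q^(d+1)) +
  q^(d+1) (1 - q^(k+1)).\<close>

lemma qbin_Suc_Suc: "qbin (Suc M) (Suc k) = qbin M (Suc k) + q ^ (M - k) * qbin M k"
proof (cases "k < M")
  case True
  then obtain d where M: "M = Suc (k + d)" using less_iff_Suc_add by auto
  define A B where "A = 1 - q ^ Suc d" and "B = 1 - q ^ Suc k"
  have nz: "qfac k \<noteq> 0" "qfac d \<noteq> 0" "A \<noteq> 0" "B \<noteq> 0"
    using qfac_nonzero qfac_Suc unfolding A_def B_def by (metis mult_zero_left)+
  have Q: "1 - q ^ Suc M = A + q ^ Suc d * B"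
    by (simp add: A_def B_def M algebra_simps power_add)
  have e1: "qbin (Suc M) (Suc k) = (A + q ^ Suc d * B) * qfac M / (B * qfac k * (A * qfac d))"
    unfolding Q[symmetric] unfolding A_def B_def
    by (simp add: M qbin_def qfac_Suc del: power_Suc)
  have e2: "qbin M (Suc k) = qfac M / (B * qfac k * qfac d)"
    by (simp add: M qbin_def B_def qfac_Suc[of k] del: power_Suc)
  have e3: "qbin M k = qfac M / (qfac k * (A * qfac d))"
    by (simp add: M qbin_def A_def qfac_Suc[of d] Suc_diff_le del: power_Suc)
  have e4: "M - k = Suc d" by (simp add: M)
  show ?thesis unfolding e1 e2 e3 e4 using nz by (simp add: field_simps del: power_Suc)
next
  case False
  then show ?thesis
    using qfac_nonzero by (cases "k = M") (auto simp: qbin_def qfac_def[of 0])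
qed

theorem q_binomial:
  "(\<Prod>j<M. 1 - x * q ^ j) = (\<Sum>k\<le>M. (-1) ^ k * q ^ (k * (k - 1) div 2) * qbin M k * x ^ k)"
proof (induction M)
  case 0
  show ?case by (simp add: qbin_0)
next
  case (Suc M)
  define f where "f = (\<lambda>M k. (-1) ^ k * q ^ (k * (k - 1) div 2) * qbin M k * x ^ k)"
  \<comment> \<open>Passing from k to k + 1 raises the triangular exponent by k, which complements
    the q^(M-k) of the Pascal rule to the q^M of the new linear factor.\<close>
  have fS: "f (Suc M) (Suc k) = f M (Suc k) - x * q ^ M * f M k" if "k \<le> M" for k
  proof -
    have "q ^ M = q ^ k * q ^ (M - k)" using that by (simp add: power_add[symmetric])
    moreover have "Suc k * (Suc k - 1) div 2 = k * (k - 1) div 2 + k" by (cases k) auto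
    ultimately show ?thesis
      unfolding f_def qbin_Suc_Suc by (simp add: algebra_simps power_add)
  qed
  have "(\<Prod>j<Suc M. 1 - x * q ^ j) = (\<Sum>k\<le>M. f M k) - x * q ^ M * (\<Sum>k\<le>M. f M k)"
    using Suc by (simp add: f_def algebra_simps)
  also have "(\<Sum>k\<le>M. f M k) = (\<Sum>k\<le>Suc M. f M k)"
    by (simp add: f_def qbin_def)
  also have "\<dots> = f M 0 + (\<Sum>k\<le>M. f M (Suc k))"
    by (rule sum.atMost_Suc_shift)
  also have "x * q ^ M * (f M 0 + (\<Sum>k\<le>M. f M (Suc k))) = x * q ^ M * (\<Sum>k\<le>M. f M k)"
    using sum.atMost_Suc_shift[of "f M" M] by (simp add: f_def qbin_def)
  also have "f M 0 + (\<Sum>k\<le>M. f M (Suc k)) - x * q ^ M * (\<Sum>k\<le>M. f M k)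
      = f M 0 + (\<Sum>k\<le>M. f M (Suc k) - x * q ^ M * f M k)"
    by (simp add: sum_subtractf sum_distrib_left)
  also have "\<dots> = f (Suc M) 0 + (\<Sum>k\<le>M. f (Suc M) (Suc k))"
    using fS by (auto simp: f_def qbin_0 intro!: sum.cong)
  also have "\<dots> = (\<Sum>k\<le>Suc M. f (Suc M) k)"
    by (rule sum.atMost_Suc_shift[symmetric])
  finally show ?case by (simp add: f_def)
qed

end

section \<open>The triple product and the pentagonal number theorem\<close>

text \<open>Triangular numbers get a name so that exponent identities can be checked by polynomial
  arithmetic through \<open>tri_double\<close> and \<open>tri_add\<close> instead of integer
  division.\<close>

definition tri :: "nat \<Rightarrow> nat" where "tri n = n * (n + 1) div 2"

lemma tri_double: "2 * tri n = n * n + n"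
  by (simp add: tri_def)

lemma tri_add: "tri (a + b) = tri a + tri b + a * b"
proof -
  have "2 * tri (a + b) = 2 * (tri a + tri b + a * b)"
    unfolding distrib_left tri_double by (simp add: algebra_simps)
  then show ?thesis by simp
qed

lemma tri_pred: "k * (k - 1) div 2 + k = tri k"
  by (cases k) (auto simp: tri_def)

context
  fixes q :: complex
  assumes q: "norm q < 1" and q0: "q \<noteq> 0"
begin

text \<open>The q-binomial theorem with 2 N + 1 factors at x = a / q^N. The first N factors are 1 -
  a / q^j and are reflected to 1 - q^j / a; on the other side the terms k = N - m and k = N + 1 + m
  are combined.\<close>

lemma finite_triple_product:
  assumes a: "a \<noteq> 0"
  shows "(\<Prod>j<N. 1 - q / a * q ^ j) * (\<Prod>j<Suc N. 1 - a * q ^ j)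
    = (\<Sum>m\<le>N. (-1) ^ m * q ^ (m * (m + 1) div 2) * (inverse a ^ m - a ^ Suc m) * qbin q (Suc (2 * N)) (N - m))"
proof -
  define x where "x = a / q ^ N"
  \<comment> \<open>Each reflection uses 1 - a / q^j = - (a / q^j) (1 - q^j / a); \<open>c\<close>
    is the inverse of the product of the extracted monomials over j = 1, ..., N.\<close>
  define c where "c = (-1) ^ N * q ^ (N * (N + 1) div 2) / a ^ N"
  define f where "f = (\<lambda>k. (-1) ^ k * q ^ (k * (k - 1) div 2) * qbin q (Suc (2 * N)) k * x ^ k)"
  have "(\<Prod>j<Suc (2 * N). 1 - x * q ^ j) = (\<Prod>j<N. 1 - x * q ^ j) * (\<Prod>j<Suc N. 1 - x * q ^ (N + j))"
  proof -
    have "(\<Prod>j<N + M. 1 - x * q ^ j) = (\<Prod>j<N. 1 - x * q ^ j) * (\<Prod>j<M. 1 - x * q ^ (N + j))" for M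
      by (induction M) (auto simp: mult_ac)
    from this[of "Suc N"] show ?thesis by (simp add: mult_2)
  qed
  also have "(\<Prod>j<Suc N. 1 - x * q ^ (N + j)) = (\<Prod>j<Suc N. 1 - a * q ^ j)"
    using q0 by (simp add: x_def power_add)
  also have "(\<Prod>j<N. 1 - x * q ^ j) = (\<Prod>j<N. 1 - a / q ^ Suc j)"
    unfolding x_def
  proof (rule prod.reindex_bij_witness[of _ "\<lambda>j. N - Suc j" "\<lambda>j. N - Suc j"])
    fix j assume "j \<in> {..<N}"
    then have "q ^ N = q ^ Suc (N - Suc j) * q ^ j" by (simp add: power_add[symmetric] del: power_Suc)
    then show "1 - a / q ^ Suc (N - Suc j) = 1 - a / q ^ N * q ^ j"
      using q0 by (simp del: power_Suc)
  qed auto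
  also have "\<dots> = (\<Prod>j<N. 1 - q / a * q ^ j) / c"
  proof -
    have "(\<Prod>j<N. 1 - a / q ^ Suc j) * ((-1) ^ N * q ^ (N * (N + 1) div 2)) = (\<Prod>j<N. 1 - q / a * q ^ j) * a ^ N"
    proof (induction N)
      case (Suc N)
      have e: "Suc N * (Suc N + 1) div 2 = N * (N + 1) div 2 + Suc N" by simp
      have "(\<Prod>j<Suc N. 1 - a / q ^ Suc j) * ((-1) ^ Suc N * q ^ (Suc N * (Suc N + 1) div 2))
        = ((\<Prod>j<N. 1 - a / q ^ Suc j) * ((-1) ^ N * q ^ (N * (N + 1) div 2))) * (- (1 - a / q ^ Suc N) * q ^ Suc N)"
        unfolding e power_add prod.lessThan_Suc
        by (simp only: power_Suc mult_ac mult_minus_left mult_minus_right mult_1_left)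
      also have "- (1 - a / q ^ Suc N) * q ^ Suc N = (1 - q / a * q ^ N) * a"
        using a q0 by (simp add: field_simps)
      finally show ?case using Suc by simp
    qed simp
    then show ?thesis using a q0 by (simp add: c_def field_simps)
  qed
  finally have "(\<Prod>j<N. 1 - q / a * q ^ j) * (\<Prod>j<Suc N. 1 - a * q ^ j) = c * (\<Prod>j<Suc (2 * N). 1 - x * q ^ j)"
    using a q0 by (simp add: c_def field_simps)
  also have "(\<Prod>j<Suc (2 * N). 1 - x * q ^ j) = (\<Sum>k\<le>Suc (2 * N). f k)"
    unfolding f_def by (rule q_binomial[OF q])
  also have "\<dots> = (\<Sum>m\<le>N. f (N - m) + f (Suc (N + m)))"
  proof -
    have "(\<Sum>k\<le>N + Suc M. f k) = (\<Sum>k\<le>N. f k) + (\<Sum>m\<le>M. f (Suc (N + m)))" for M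
      by (induction M) auto
    from this[of N] have "(\<Sum>k\<le>Suc (2 * N). f k) = (\<Sum>k\<le>N. f k) + (\<Sum>m\<le>N. f (Suc (N + m)))"
      by (simp add: mult_2)
    also have "(\<Sum>k\<le>N. f k) = (\<Sum>m\<le>N. f (N - m))"
      by (rule sum.reindex_bij_witness[of _ "\<lambda>j. N - j" "\<lambda>j. N - j"]) auto
    finally show ?thesis by (simp add: sum.distrib)
  qed
  also have "c * \<dots> = (\<Sum>m\<le>N. (-1) ^ m * q ^ (m * (m + 1) div 2) * (inverse a ^ m - a ^ Suc m) * qbin q (Suc (2 * N)) (N - m))"
    unfolding sum_distrib_left
  proof (intro sum.cong refl)
    fix m assume "m \<in> {..N}"
    then obtain k where N: "N = k + m" by (metis atMost_iff le_add_diff_inverse2)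
    \<comment> \<open>The indices N - m and N + 1 + m add up to 2 N + 1, so both terms carry the
      same Gaussian binomial.\<close>
    have sym: "qbin q (Suc (2 * N)) (Suc (N + m)) = qbin q (Suc (2 * N)) (N - m)"
    proof -
      have "Suc (2 * N) - Suc (N + m) = N - m" "Suc (2 * N) - (N - m) = Suc (N + m)"
        "Suc (N + m) \<le> Suc (2 * N)" "N - m \<le> Suc (2 * N)"
        by (auto simp: N)
      then show ?thesis by (simp only: qbin_def[OF q] if_True mult.commute)
    qed
    have "c * f k = (-1) ^ m * q ^ (m * (m + 1) div 2) * inverse a ^ m * qbin q (Suc (2 * N)) k"
    proof -
      have "k * (k - 1) div 2 + N * (N + 1) div 2 = N * k + m * (m + 1) div 2"
        using tri_add[of k m] tri_pred[of k] tri_double[of k] unfolding N tri_def[symmetric]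
        by (simp add: algebra_simps)
      then have "q ^ (k * (k - 1) div 2) * q ^ (N * (N + 1) div 2) = q ^ (N * k) * q ^ (m * (m + 1) div 2)"
        by (simp only: power_add[symmetric])
      then have e: "q ^ (k * (k - 1) div 2) * q ^ (N * (N + 1) div 2) * x ^ k = q ^ (m * (m + 1) div 2) * a ^ k"
        using q0 unfolding x_def power_divide power_mult by simp
      have "c * f k = (-1) ^ (N + k) * (q ^ (k * (k - 1) div 2) * q ^ (N * (N + 1) div 2) * x ^ k) / a ^ N * qbin q (Suc (2 * N)) k"
        by (simp add: c_def f_def power_add)
      also have "\<dots> = (-1) ^ m * q ^ (m * (m + 1) div 2) * inverse a ^ m * qbin q (Suc (2 * N)) k"
        unfolding e using a by (simp add: N power_add field_simps)
      finally show ?thesis .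
    qed
    moreover have "c * f (Suc (N + m)) = - ((-1) ^ m * q ^ (m * (m + 1) div 2) * a ^ Suc m * qbin q (Suc (2 * N)) (Suc (N + m)))"
    proof -
      have "Suc (N + m) * (Suc (N + m) - 1) div 2 = (N + m) * (N + m + 1) div 2"
        by (simp add: mult.commute)
      moreover have "(N + m) * (N + m + 1) div 2 + N * (N + 1) div 2 = N * Suc (N + m) + m * (m + 1) div 2"
        using tri_add[of N m] tri_double[of N] unfolding tri_def[symmetric] by (simp add: algebra_simps)
      ultimately have "q ^ (Suc (N + m) * (Suc (N + m) - 1) div 2) * q ^ (N * (N + 1) div 2)
          = q ^ (N * Suc (N + m)) * q ^ (m * (m + 1) div 2)"
        by (simp only: power_add[symmetric])
      then have e: "q ^ (Suc (N + m) * (Suc (N + m) - 1) div 2) * q ^ (N * (N + 1) div 2) * x ^ Suc (N + m)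
          = q ^ (m * (m + 1) div 2) * a ^ Suc (N + m)"
        using q0 unfolding x_def power_divide power_mult by simp
      have "c * f (Suc (N + m)) = (-1) ^ (N + Suc (N + m)) *
         (q ^ (Suc (N + m) * (Suc (N + m) - 1) div 2) * q ^ (N * (N + 1) div 2) * x ^ Suc (N + m)) / a ^ N * qbin q (Suc (2 * N)) (Suc (N + m))"
        by (simp only: c_def f_def power_add mult_ac times_divide_eq_right times_divide_eq_left)
      also have "\<dots> = - ((-1) ^ m * q ^ (m * (m + 1) div 2) * a ^ Suc m * qbin q (Suc (2 * N)) (Suc (N + m)))"
        unfolding e using a by (simp add: power_add field_simps)
      finally show ?thesis .
    qed
    ultimately show "c * (f (N - m) + f (Suc (N + m))) =
        (-1) ^ m * q ^ (m * (m + 1) div 2) * (inverse a ^ m - a ^ Suc m) * qbin q (Suc (2 * N)) (N - m)"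
      unfolding sym by (simp add: N algebra_simps)
  qed
  finally show ?thesis .
qed

text \<open>The q-factorials converge to a nonzero limit, so they and their inverses are
  bounded.\<close>

lemma qbin_bound: obtains K where "\<And>M k. norm (qbin q M k) \<le> K"
proof -
  have "Bseq (qfac q)"
    using qfac_LIMSEQ[OF q] convergentI by (intro convergent_imp_Bseq) blast
  then obtain K1 where K1: "K1 > 0" "\<And>n. norm (qfac q n) \<le> K1" by (auto elim: BseqE)
  have "(\<lambda>n. inverse (qfac q n)) \<longlonglongrightarrow> inverse (qinf q q)"
    by (intro tendsto_inverse qfac_LIMSEQ[OF q] qinf_q_nonzero[OF q])
  then have "Bseq (\<lambda>n. inverse (qfac q n))"
    using convergentI by (intro convergent_imp_Bseq) blast
  then obtain K2 where K2: "K2 > 0" "\<And>n. norm (inverse (qfac q n)) \<le> K2" by (auto elim: BseqE)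
  have "norm (qbin q M k) \<le> K1 * (K2 * K2)" for M k
  proof (cases "k \<le> M")
    case True
    have "norm (qbin q M k) = norm (qfac q M) * (norm (inverse (qfac q k)) * norm (inverse (qfac q (M - k))))"
      using True by (simp add: qbin_def[OF q] norm_divide norm_mult norm_inverse field_simps)
    also have "\<dots> \<le> K1 * (K2 * K2)"
      using K1 K2 by (intro mult_mono) auto
    finally show ?thesis .
  next
    case False
    then show ?thesis using K1 K2 by (simp add: qbin_def[OF q])
  qed
  then show ?thesis using that by blast
qed

text \<open>The finite version in the limit N to infinity: every Gaussian binomial tends to 1 / (q;
  q)_infinity, and \<open>qbin_bound\<close> provides the majorant for Tannery's theorem. The
  exponents - m and m + 1 of the bilateral series share their power of q and are paired, which makes
  the series one-sided.\<close>

theorem jacobi_triple_product: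
  assumes a: "a \<noteq> 0"
  shows "(\<lambda>m. (-1) ^ m * q ^ (m * (m + 1) div 2) * (inverse a ^ m - a ^ Suc m)) sums (qinf q q * qtheta q a)"
proof -
  define g where "g = (\<lambda>m. (-1) ^ m * q ^ (m * (m + 1) div 2) * (inverse a ^ m - a ^ Suc m))"
  \<comment> \<open>Padding with zeros beyond N turns the finite sums into series over one fixed
    index set.\<close>
  define b where "b = (\<lambda>m N. if m \<le> N then g m * qbin q (Suc (2 * N)) (N - m) else 0)"
  obtain K where K: "\<And>M k. norm (qbin q M k) \<le> K" using qbin_bound by blast
  have sm: "summable (\<lambda>m. norm (g m))"
  proof -
    have "summable (\<lambda>m. norm ((-1) ^ m * inverse a ^ m * q ^ (m * (m + 1) div 2)) +
        norm a * norm ((-1) ^ m * a ^ m * q ^ (m * (m + 1) div 2)))"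
      by (intro summable_add summable_mult summable_theta'[OF q, of _ _ "inverse a"] summable_theta'[OF q, of _ _ a]
          div_le_mono mult_le_mono) (auto simp: norm_mult norm_power norm_inverse)
    then show ?thesis
    proof (rule summable_comparison_test')
      fix m :: nat
      have "g m = (-1) ^ m * inverse a ^ m * q ^ (m * (m + 1) div 2) - a * ((-1) ^ m * a ^ m * q ^ (m * (m + 1) div 2))"
        by (simp add: g_def algebra_simps)
      then have "norm (g m) \<le> norm ((-1) ^ m * inverse a ^ m * q ^ (m * (m + 1) div 2)) +
        norm (a * ((-1) ^ m * a ^ m * q ^ (m * (m + 1) div 2)))"
        using norm_triangle_ineq4 by metis
      then show "norm (norm (g m)) \<le> norm ((-1) ^ m * inverse a ^ m * q ^ (m * (m + 1) div 2)) +
        norm a * norm ((-1) ^ m * a ^ m * q ^ (m * (m + 1) div 2))"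
        unfolding norm_mult[of a] by simp
    qed
  qed
  have "(\<lambda>N. \<Sum>m. b m N) \<longlonglongrightarrow> (\<Sum>m. g m * (1 / qinf q q))"
  proof (rule tannerys_theorem[THEN conjunct2, THEN conjunct2])
    show "summable (\<lambda>m. norm (g m) * K)" using sm by (rule summable_mult2)
    have "norm (b m N) \<le> norm (g m) * K" for m N
      using K[of "Suc (2 * N)" "N - m"] order_trans[OF norm_ge_zero K]
      by (auto simp: b_def norm_mult intro!: mult_left_mono)
    then show "\<forall>\<^sub>F (m, N) in sequentially \<times>\<^sub>F sequentially. norm (b m N) \<le> norm (g m) * K"
      by (auto intro: always_eventually)
    show "(\<lambda>N. b m N) \<longlonglongrightarrow> g m * (1 / qinf q q)" for m
    proof (rule Lim_transform_eventually)
      have 1: "(\<lambda>N. qfac q (Suc (2 * N))) \<longlonglongrightarrow> qinf q q"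
        by (rule filterlim_compose[OF qfac_LIMSEQ[OF q]])
          (auto intro!: filterlim_subseq simp: strict_mono_def)
      have 2: "(\<lambda>N. qfac q (N - m)) \<longlonglongrightarrow> qinf q q"
        by (rule filterlim_compose[OF qfac_LIMSEQ[OF q] filterlim_minus_const_nat_at_top])
      have 3: "(\<lambda>N. qfac q (Suc N + m)) \<longlonglongrightarrow> qinf q q"
        using LIMSEQ_ignore_initial_segment[OF qfac_LIMSEQ[OF q], of "Suc m"] by simp
      have "(\<lambda>N. g m * (qfac q (Suc (2 * N)) / (qfac q (N - m) * qfac q (Suc N + m)))) \<longlonglongrightarrow>
          g m * (qinf q q / (qinf q q * qinf q q))"
        using qinf_q_nonzero[OF q] by (intro tendsto_intros 1 2 3) auto
      then show "(\<lambda>N. g m * (qfac q (Suc (2 * N)) / (qfac q (N - m) * qfac q (Suc N + m)))) \<longlonglongrightarrow> g m * (1 / qinf q q)"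
        using qinf_q_nonzero[OF q] by simp
      show "\<forall>\<^sub>F N in sequentially. g m * (qfac q (Suc (2 * N)) / (qfac q (N - m) * qfac q (Suc N + m))) = b m N"
        using eventually_ge_at_top[of m]
        by eventually_elim (auto simp: b_def qbin_def[OF q] Suc_diff_le mult_2)
    qed
  qed simp
  moreover have "(\<Sum>m. b m N) = (\<Prod>j<N. 1 - q / a * q ^ j) * (\<Prod>j<Suc N. 1 - a * q ^ j)" for N
  proof -
    have "(\<Sum>m. b m N) = (\<Sum>m\<le>N. b m N)"
      by (rule suminf_finite) (auto simp: b_def)
    then show ?thesis
      unfolding finite_triple_product[OF a] by (simp add: b_def g_def)
  qed
  moreover have "(\<lambda>N. (\<Prod>j<N. 1 - q / a * q ^ j) * (\<Prod>j<Suc N. 1 - a * q ^ j)) \<longlonglongrightarrow> qinf q (q / a) * qinf q a"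
    by (intro tendsto_mult qinf_LIMSEQ[OF q] LIMSEQ_Suc[OF qinf_LIMSEQ[OF q]])
  ultimately have "qtheta q a = (\<Sum>m. g m * (1 / qinf q q))"
    using LIMSEQ_unique by (fastforce simp: qtheta_def[OF q] mult.commute)
  moreover have sg: "summable g" using sm by (rule summable_norm_cancel)
  ultimately have "qtheta q a = (\<Sum>m. g m) * (1 / qinf q q)"
    by (simp only: suminf_mult2)
  then have "(\<Sum>m. g m) = qinf q q * qtheta q a"
    using qinf_q_nonzero[OF q] by simp
  then show ?thesis using sg unfolding g_def by (simp add: sums_iff)
qed

end

text \<open>The triple product with base q^3 at a = q: its three products run over the residue
  classes modulo 3 and together form (q; q)_infinity, while the series becomes
  \<open>qH q 1\<close>.\<close>

theorem pentagonal:
  assumes q: "norm q < 1" and q0: "q \<noteq> 0"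
  shows "qH q 1 = qinf q q"
proof -
  have q3: "norm (q ^ 3) < 1" "q ^ 3 \<noteq> 0"
    using q q0 by (auto simp: norm_power power_less_one_iff)
  have L: "(\<lambda>N. (\<Prod>n<N. 1 - q ^ 3 * (q ^ 3) ^ n) * ((\<Prod>n<N. 1 - q * (q ^ 3) ^ n) * (\<Prod>n<N. 1 - q ^ 3 / q * (q ^ 3) ^ n)))
    \<longlonglongrightarrow> qinf (q ^ 3) (q ^ 3) * qtheta (q ^ 3) q"
    unfolding qtheta_def[OF q3(1)] by (intro tendsto_mult qinf_LIMSEQ q3)
  have "(\<Prod>n<N. 1 - q ^ 3 * (q ^ 3) ^ n) * ((\<Prod>n<N. 1 - q * (q ^ 3) ^ n) * (\<Prod>n<N. 1 - q ^ 3 / q * (q ^ 3) ^ n))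
     = (\<Prod>n<3 * N. 1 - q * q ^ n)" for N
  proof (induction N)
    case (Suc N)
    have e: "3 * Suc N = Suc (Suc (Suc (3 * N)))" by simp
    have p: "q * (q ^ 3) ^ N = q * q ^ (3 * N)" "q ^ 3 / q * (q ^ 3) ^ N = q * q ^ Suc (3 * N)"
       "q ^ 3 * (q ^ 3) ^ N = q * q ^ Suc (Suc (3 * N))"
      using q0 by (simp_all add: power_mult power3_eq_cube)
    show ?case
      unfolding e prod.lessThan_Suc p Suc.IH[symmetric] by (simp only: mult_ac)
  qed simp
  moreover have "(\<lambda>N. \<Prod>n<3 * N. 1 - q * q ^ n) \<longlonglongrightarrow> qinf q q"
    by (rule filterlim_compose[OF qinf_LIMSEQ[OF q]]) (auto intro!: filterlim_subseq simp: strict_mono_def)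
  ultimately have *: "qinf (q ^ 3) (q ^ 3) * qtheta (q ^ 3) q = qinf q q"
    using LIMSEQ_unique[OF L] by simp
  have "(\<lambda>m. (-1) ^ m * (q ^ 3) ^ (m * (m + 1) div 2) * (inverse q ^ m - q ^ Suc m)) sums qinf q q"
    using jacobi_triple_product[OF q3 q0] unfolding * .
  moreover have "(-1) ^ m * (q ^ 3) ^ (m * (m + 1) div 2) * (inverse q ^ m - q ^ Suc m)
    = (-1) ^ m * 1 ^ (3 * m) * q ^ (m * (3 * m + 1) div 2) * (1 - 1\<^sup>2 * q ^ (2 * m + 1))" for m
  proof -
    have "even (m * (m + 1))" by auto
    then have "3 * (m * (m + 1) div 2) = 3 * (m * (m + 1)) div 2" by (simp add: div_mult_swap)
    also have "3 * (m * (m + 1)) = m * (3 * m + 1) + m * 2" by (simp add: algebra_simps)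
    finally have "3 * (m * (m + 1) div 2) = m * (3 * m + 1) div 2 + m" by simp
    then have "(q ^ 3) ^ (m * (m + 1) div 2) = q ^ (m * (3 * m + 1) div 2) * q ^ m"
      by (simp only: power_mult[symmetric] power_add)
    then show ?thesis using q0 by (simp add: field_simps power_add mult_2 mult_2_right)
  qed
  ultimately have "(\<lambda>m. (-1) ^ m * 1 ^ (3 * m) * q ^ (m * (3 * m + 1) div 2) * (1 - 1\<^sup>2 * q ^ (2 * m + 1))) sums qinf q q"
    by (simp only:)
  then show ?thesis
    by (rule sums_unique2[OF qH_sums[OF q, of 1]])
qed

section \<open>Termwise differentiation and Lambert series\<close>

text \<open>The index \<open>k\<close> is the order of differentiation. Carrying the whole tower of
  derivatives in one family allows local majorants to be required uniformly in form and the
  statement to be iterated.\<close>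

lemma termwise_deriv:
  fixes f :: "nat \<Rightarrow> nat \<Rightarrow> complex \<Rightarrow> complex"
  assumes S: "open S"
    and der: "\<And>k n z. z \<in> S \<Longrightarrow> (f k n has_field_derivative f (Suc k) n z) (at z)"
    and bd: "\<And>k z. z \<in> S \<Longrightarrow> \<exists>d h. 0 < d \<and> summable h \<and> (\<forall>n. \<forall>y\<in>ball z d \<inter> S. norm (f k n y) \<le> h n)"
    and z: "z \<in> S"
  shows "(\<lambda>n. f k n z) sums (\<Sum>n. f k n z)"
    "((\<lambda>z. \<Sum>n. f k n z) has_field_derivative (\<Sum>n. f (Suc k) n z)) (at z)"
proof -
  obtain g g' where g: "\<And>z. z \<in> S \<Longrightarrow> (\<lambda>n. f k n z) sums g z \<and> (\<lambda>n. f (Suc k) n z) sums g' z \<and> (g has_field_derivative g' z) (at z)"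
  proof -
    have "\<exists>g g'. \<forall>x\<in>S. ((\<lambda>n. f k n x) sums g x) \<and> ((\<lambda>n. f (Suc k) n x) sums g' x) \<and> (g has_field_derivative g' x) (at x)"
    proof (rule series_and_derivative_comparison_local[OF S])
      fix x assume "x \<in> S"
      show "(f k n has_field_derivative f (Suc k) n x) (at x)" for n using \<open>x \<in> S\<close> by (rule der)
      show "\<exists>d h. 0 < d \<and> summable h \<and> (\<forall>\<^sub>F n in sequentially. \<forall>y\<in>ball x d \<inter> S. norm (f k n y) \<le> h n)"
        using bd[OF \<open>x \<in> S\<close>, of k] always_eventually by blast
    qed
    then show ?thesis using that by blast
  qed
  then show "(\<lambda>n. f k n z) sums (\<Sum>n. f k n z)" using z by (simp add: sums_iff)
  have "((\<lambda>z. \<Sum>n. f k n z) has_field_derivative g' z) (at z)"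
    by (rule has_field_derivative_transform_within_open[OF _ S z]) (use g z in \<open>auto simp: sums_iff\<close>)
  then show "((\<lambda>z. \<Sum>n. f k n z) has_field_derivative (\<Sum>n. f (Suc k) n z)) (at z)"
    using g[OF z] by (simp add: sums_iff)
qed

lemma termwise_fps_expansion:
  fixes f :: "nat \<Rightarrow> nat \<Rightarrow> complex \<Rightarrow> complex"
  assumes S: "open S"
    and der: "\<And>k n z. z \<in> S \<Longrightarrow> (f k n has_field_derivative f (Suc k) n z) (at z)"
    and bd: "\<And>k z. z \<in> S \<Longrightarrow> \<exists>d h. 0 < d \<and> summable h \<and> (\<forall>n. \<forall>y\<in>ball z d \<inter> S. norm (f k n y) \<le> h n)"
    and z: "0 \<in> S"
  shows "(\<lambda>z. \<Sum>n. f 0 n z) has_fps_expansion Abs_fps (\<lambda>k. (\<Sum>n. f k n 0) / fact k)"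
proof -
  define F where "F = (\<lambda>k z. \<Sum>n. f k n z)"
  have F: "(F k has_field_derivative F (Suc k) z) (at z)" if "z \<in> S" for k z
    unfolding F_def by (rule termwise_deriv(2)[where f = f, OF S der bd that])
  have "(deriv ^^ k) (F 0) z = F k z" if "z \<in> S" for k z using that
  proof (induction k arbitrary: z)
    case (Suc k)
    have "\<forall>\<^sub>F x in nhds z. (deriv ^^ k) (F 0) x = F k x"
      using eventually_nhds_in_open[OF S Suc.prems] by eventually_elim (rule Suc.IH)
    then have "deriv ((deriv ^^ k) (F 0)) z = deriv (F k) z" by (rule deriv_cong_ev) simp
    then show ?case using DERIV_imp_deriv[OF F[OF Suc.prems]] by simp
  qed simp
  moreover have "F 0 holomorphic_on S"
    using F by (auto simp: holomorphic_on_open[OF S])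
  then have "F 0 has_fps_expansion fps_expansion (F 0) 0"
    using S z by (intro has_fps_expansion_fps_expansion)
  ultimately show ?thesis using z by (simp add: fps_expansion_def F_def)
qed

lemma power_le_exp:
  fixes x :: real
  assumes "x \<ge> 0" "c > 0"
  shows "x ^ k \<le> fact k * (2 / c) ^ k * exp (c * x / 2)"
proof -
  have "(c * x / 2) ^ k / fact k \<le> exp (c * x / 2)"
  proof -
    have "(c * x / 2) ^ k / fact k = (\<Sum>n\<in>{k}. (c * x / 2) ^ n /\<^sub>R fact n)" by (simp add: field_simps)
    also have "\<dots> \<le> (\<Sum>n. (c * x / 2) ^ n /\<^sub>R fact n)"
      using assms by (intro sum_le_suminf summable_exp_generic) auto
    finally show ?thesis by (simp add: exp_def)
  qed
  then have "(c * x / 2) ^ k \<le> fact k * exp (c * x / 2)" by (simp add: field_simps)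
  then have "(2 / c) ^ k * (c * x / 2) ^ k \<le> (2 / c) ^ k * (fact k * exp (c * x / 2))"
    using assms by (intro mult_left_mono) auto
  moreover have "(2 / c) ^ k * (c * x / 2) ^ k = x ^ k"
    using assms by (simp add: power_mult_distrib[symmetric])
  ultimately show ?thesis by (simp add: mult_ac)
qed

text \<open>Half of the exponential decay absorbs the power through \<open>power_le_exp\<close>; the
  other half is dominated by a geometric sequence of ratio exp (- c a / 2).\<close>

lemma summable_power_exp:
  fixes a b c :: real
  assumes "a > 0" "b \<ge> 0" "c > 0"
  shows "summable (\<lambda>n. (a * real n + b) ^ k * exp (- c * (a * real n + b)))"
proof (rule summable_comparison_test')
  define r where "r = exp (- c * a / 2)"
  have "r < 1" "r > 0" using assms by (auto simp: r_def)
  then show "summable (\<lambda>n. fact k * (2 / c) ^ k * r ^ n)"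
    by (intro summable_mult summable_geometric) auto
  fix n :: nat
  define x where "x = a * real n + b"
  have "x \<ge> 0" using assms by (simp add: x_def)
  have "x ^ k * exp (- c * x) \<le> (fact k * (2 / c) ^ k * exp (c * x / 2)) * exp (- c * x)"
    using power_le_exp[OF \<open>x \<ge> 0\<close> \<open>c > 0\<close>] by (intro mult_right_mono) auto
  also have "\<dots> = fact k * (2 / c) ^ k * exp (- c * x / 2)"
    by (simp add: mult_exp_exp)
  also have "\<dots> \<le> fact k * (2 / c) ^ k * exp (- c * a / 2 * real n)"
    using assms by (intro mult_left_mono) (auto simp: x_def field_simps)
  also have "exp (- c * a / 2 * real n) = r ^ n"
    unfolding r_def by (rule exp_of_nat2_mult)
  finally show "norm ((a * real n + b) ^ k * exp (- c * (a * real n + b))) \<le> fact k * (2 / c) ^ k * r ^ n"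
    using \<open>x \<ge> 0\<close> by (simp add: x_def)
qed

text \<open>One double series is summed in two ways, by rows and along (n + 1) (m + 1) = N + 1. It
  converges absolutely because (n + 1) (m + 1) >= n + (m + 1) bounds its terms by a product of two
  summable sequences.\<close>

lemma lambert_regroup:
  fixes b :: "nat \<Rightarrow> complex"
  assumes q: "norm q < 1" and sb: "summable (\<lambda>m. norm q ^ Suc m * norm (b (Suc m)))"
    and c: "\<And>n. (\<lambda>m. q ^ (Suc n * Suc m) * b (Suc m)) sums c n"
  obtains S where "c sums S" "(\<lambda>N. q ^ Suc N * (\<Sum>d | d dvd Suc N. b d)) sums S"
proof -
  define f where "f = (\<lambda>(n, m). q ^ (Suc n * Suc m) * b (Suc m))"
  define y where "y = (\<lambda>m. norm q ^ Suc m * norm (b (Suc m)))"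
  have le: "norm q ^ (Suc n * Suc m) * norm (b (Suc m)) \<le> norm q ^ n * y m" for n m
  proof -
    have "norm q ^ (Suc n * Suc m) \<le> norm q ^ (n + Suc m)"
      using q by (intro power_decreasing) auto
    then have "norm q ^ (Suc n * Suc m) * norm (b (Suc m)) \<le> norm q ^ (n + Suc m) * norm (b (Suc m))"
      by (intro mult_right_mono) auto
    then show ?thesis
      unfolding y_def power_add by (simp only: mult.assoc)
  qed
  have sumy: "y summable_on UNIV"
    using sb by (intro norm_summable_imp_summable_on) (simp add: y_def abs_mult)
  have sumq: "(\<lambda>n. norm q ^ n) summable_on UNIV"
    using q by (intro norm_summable_imp_summable_on) (auto intro: summable_geometric)
  have y0: "y m \<ge> 0" for m by (simp add: y_def)
  have "(\<lambda>p. norm ((\<lambda>(n, m). norm q ^ n * y m) p)) summable_on UNIV \<times> UNIV"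
    unfolding Infinite_Sum.abs_summable_on_Sigma_iff using y0
    by (auto simp: abs_mult infsum_cmult_right' intro!: summable_on_cmult_right summable_on_cmult_left sumy sumq
       infsum_nonneg)
  then have "(\<lambda>p. norm (f p)) summable_on UNIV \<times> UNIV"
    by (rule Infinite_Sum.abs_summable_on_comparison_test)
      (use le y0 in \<open>auto simp: f_def norm_mult norm_power abs_mult\<close>)
  then obtain S where S: "(f has_sum S) (UNIV \<times> UNIV)"
    using Infinite_Sum.abs_summable_summable summable_on_def by blast
  have "((\<lambda>m. f (n, m)) has_sum c n) UNIV" for n
  proof (rule norm_summable_imp_has_sum)
    show "(\<lambda>m. f (n, m)) sums c n" using c by (simp add: f_def)
    show "summable (\<lambda>m. norm (f (n, m)))"
    proof (rule summable_comparison_test')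
      show "summable (\<lambda>m. norm q ^ n * y m)" unfolding y_def by (intro summable_mult sb)
      show "norm (norm (f (n, m))) \<le> norm q ^ n * y m" for m
        using le[of n m] by (simp add: f_def norm_mult norm_power)
    qed
  qed
  then have "(c has_sum S) UNIV" using has_sum_SigmaD[OF S] by blast
  then have 1: "c sums S" by (rule has_sum_imp_sums)
  define g where "g = (\<lambda>(N, d). q ^ Suc N * b d)"
  \<comment> \<open>The pair (n, m) corresponds to N + 1 = (n + 1) (m + 1) with the divisor d = m +
    1; the subtractions of 1 are due to indices starting at 0.\<close>
  have "(f has_sum S) (UNIV \<times> UNIV) = (g has_sum S) (SIGMA N:UNIV. {d. d dvd Suc N})"
  proof (rule has_sum_reindex_bij_witness[where j = "\<lambda>(n, m). (Suc n * Suc m - 1, Suc m)" and i = "\<lambda>(N, d). (Suc N div d - 1, d - 1)"])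
    fix x :: "nat \<times> nat"
    obtain n m where x: "x = (n, m)" by force
    have e: "Suc (Suc n * Suc m - 1) = Suc n * Suc m" by simp
    show "(case case x of (n, m) \<Rightarrow> (Suc n * Suc m - 1, Suc m) of (N, d) \<Rightarrow> (Suc N div d - 1, d - 1)) = x"
      unfolding x prod.case e by (simp del: mult_Suc mult_Suc_right)
    show "(case x of (n, m) \<Rightarrow> (Suc n * Suc m - 1, Suc m)) \<in> (SIGMA N:UNIV. {d. d dvd Suc N})"
      unfolding x prod.case by (simp only: mem_Sigma_iff mem_Collect_eq e) (simp del: mult_Suc mult_Suc_right)
    show "g (case x of (n, m) \<Rightarrow> (Suc n * Suc m - 1, Suc m)) = f x"
      unfolding x prod.case f_def g_def e ..
  next
    fix x :: "nat \<times> nat" assume "x \<in> (SIGMA N:UNIV. {d. d dvd Suc N})"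
    then obtain N d where x: "x = (N, d)" "d dvd Suc N" by auto
    then obtain e where e: "Suc N = d * e" by (elim dvdE)
    have "d > 0" "e > 0" using e by (auto intro!: Nat.gr0I)
    then obtain d' e' where de: "d = Suc d'" "e = Suc e'" using gr0_implies_Suc by metis
    have N: "N = Suc e' * Suc d' - 1" using e by (simp add: de)
    have dv: "Suc e' * Suc d' div Suc d' = Suc e'" by (simp del: mult_Suc mult_Suc_right)
    have e': "Suc (Suc e' * Suc d' - 1) = Suc e' * Suc d'" by simp
    show "(case case x of (N, d) \<Rightarrow> (Suc N div d - 1, d - 1) of (n, m) \<Rightarrow> (Suc n * Suc m - 1, Suc m)) = x"
      unfolding x prod.case unfolding N de unfolding e' unfolding dv by simp
  qed auto
  then have "(g has_sum S) (SIGMA N:UNIV. {d. d dvd Suc N})" using S by simp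
  moreover have "((\<lambda>d. g (N, d)) has_sum (q ^ Suc N * (\<Sum>d | d dvd Suc N. b d))) {d. d dvd Suc N}" for N
    by (rule has_sum_finiteI) (auto simp: g_def sum_distrib_left)
  ultimately have "((\<lambda>N. q ^ Suc N * (\<Sum>d | d dvd Suc N. b d)) has_sum S) UNIV"
    by (rule has_sum_SigmaD)
  then have "(\<lambda>N. q ^ Suc N * (\<Sum>d | d dvd Suc N. b d)) sums S" by (rule has_sum_imp_sums)
  with 1 show ?thesis using that by blast
qed

section \<open>The Taylor expansion of the theta product\<close>

lemma norm_ee: "norm (ee z) = exp (- 2 * pi * Im z)"
  by (simp add: ee_def norm_exp_eq_Re)

lemma norm_ee_less_1: "\<tau> \<in> \<H> \<Longrightarrow> norm (ee \<tau>) < 1"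
  by (simp add: norm_ee upper_half_plane_def)

lemma ee_nonzero [simp]: "ee z \<noteq> 0"
  by (simp add: ee_def)

lemma ee_minus: "ee (- z) = inverse (ee z)"
  by (simp add: ee_def exp_minus)

lemma ee_add: "ee (x + y) = ee x * ee y"
  by (simp add: ee_def exp_add distrib_left)

lemma ee_power: "ee (of_nat n * z) = ee z ^ n"
  unfolding ee_def by (metis exp_of_nat_mult mult.left_commute)

lemma fps_uminus_odd_zero:
  fixes P :: "complex fps"
  assumes "L has_fps_expansion P" "\<And>z. L (- z) = L z" "odd k"
  shows "fps_nth P k = 0"
proof -
  have "(L \<circ> uminus) has_fps_expansion (P oo (- fps_X))"
    using assms(1) by (intro has_fps_expansion_compose has_fps_expansion_minus has_fps_expansion_fps_X) auto
  also have "L \<circ> uminus = L" using assms(2) by auto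
  finally have "P oo (- fps_X) = P" using assms(1) by (rule fps_expansion_unique_complex)
  then have "(-1) ^ k * fps_nth P k = fps_nth P k"
    by (metis fps_compose_uminus' fps_nth_Abs_fps)
  then show ?thesis using assms(3) by simp
qed

text \<open>The prefactor in the expansion of U with its singularity removed, so that identities on
  a punctured neighbourhood extend to z = 0.\<close>

definition sinc_pi :: "complex \<Rightarrow> complex" where
  "sinc_pi z = (if z = 0 then 1 else sin (of_real pi * z) / (of_real pi * z))"

lemma sinc_pi_0 [simp]: "sinc_pi 0 = 1"
  by (simp add: sinc_pi_def)

lemma sinc_pi_eq: "sinc_pi z * (2 * of_real pi * \<i>) * z = exp (of_real pi * \<i> * z) - exp (- of_real pi * \<i> * z)"
  by (auto simp: sinc_pi_def sin_exp_eq field_simps)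

lemma sinc_pi_minus: "sinc_pi (- z) = sinc_pi z"
  by (simp add: sinc_pi_def)

lemma sinc_pi_holomorphic: "sinc_pi holomorphic_on UNIV"
proof -
  have d: "deriv (\<lambda>z. sin (of_real pi * z)) 0 = (of_real pi :: complex)"
    by (rule DERIV_imp_deriv) (auto intro!: derivative_eq_intros)
  have hol: "(\<lambda>z. sin (of_real pi * z)) holomorphic_on UNIV"
    by (intro holomorphic_intros)
  have "(\<lambda>z. of_real pi * sinc_pi z) holomorphic_on UNIV"
    by (rule pole_theorem_open_0[OF hol open_UNIV, where a = 0]) (auto simp: sinc_pi_def d)
  then have "(\<lambda>z. 1 / of_real pi * (of_real pi * sinc_pi z)) holomorphic_on UNIV"
    by (rule holomorphic_on_mult[OF holomorphic_on_const])
  then show ?thesis by (rule holomorphic_transform) auto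
qed

lemma eventually_sinc_pi_nonzero: "\<forall>\<^sub>F z in nhds 0. sinc_pi z \<noteq> 0"
proof -
  have "sinc_pi analytic_on {0}"
    using sinc_pi_holomorphic by (simp add: analytic_on_holomorphic) blast
  then have "isCont sinc_pi 0" by (rule analytic_at_imp_isCont)
  then have "\<forall>\<^sub>F z in at 0. sinc_pi z \<noteq> 0"
    by (intro tendsto_imp_eventually_ne[where c = "sinc_pi 0"]) (auto simp: isCont_def)
  then show ?thesis by (simp add: eventually_nhds_conv_at)
qed

lemma bernoulli_scaled:
  "Abs_fps (\<lambda>k. bernoulli_number k * w ^ k / fact k) * (fps_exp w - 1) = fps_const w * fps_X"
proof -
  have "Abs_fps (\<lambda>k. bernoulli_number k / fact k) oo (fps_const w * fps_X) = Abs_fps (\<lambda>k. bernoulli_number k * w ^ k / fact k)"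
    by (simp add: fps_eq_iff)
  moreover have "(fps_exp 1 - 1) oo (fps_const w * fps_X) = fps_exp w - 1"
    by (auto simp: fps_eq_iff)
  moreover have "(Abs_fps (\<lambda>k. bernoulli_number k / fact k) * (fps_exp 1 - 1)) oo (fps_const w * fps_X) = fps_const w * fps_X"
    by (subst bernoulli_number_gf) simp
  ultimately show ?thesis
    by (simp add: fps_compose_mult_distrib)
qed

text \<open>With w = 2 pi i and L the logarithm, \<open>sinc_pi z * w * z\<close> is exp (w z / 2) -
  exp (- w z / 2). Its logarithmic derivative gives z L' + 1 = w z / 2 + w z / (exp (w z) - 1),
  where the last quotient generates the Bernoulli numbers. Odd coefficients vanish because L is
  even.\<close>

lemma sinc_pi_expansion:
  obtains f where "f has_fps_expansion ser (\<lambda>k. if even k \<and> k \<ge> 1 then - bernoulli_number k / (2 * of_nat k) else 0)"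
    "\<forall>\<^sub>F z in nhds 0. sinc_pi z = exp (- 2 * f z)"
proof -
  define w where "w = 2 * of_real pi * \<i>"
  define L where "L = (\<lambda>z. Ln (sinc_pi z))"
  have an: "sinc_pi analytic_on {0}"
    using sinc_pi_holomorphic by (simp add: analytic_on_holomorphic) blast
  have "L analytic_on {0}"
    unfolding L_def by (intro analytic_intros an) simp
  then obtain P where P: "L has_fps_expansion P" using analytic_at_imp_has_fps_expansion_0 by blast
  have L0: "L 0 = 0" by (simp add: L_def)
  have P0: "fps_nth P 0 = 0" using has_fps_expansion_imp_0_eq_fps_nth_0[OF P] L0 by simp
  have ev: "\<forall>\<^sub>F z in nhds 0. sinc_pi z = exp (L z)"
    using eventually_sinc_pi_nonzero
    by eventually_elim (simp add: L_def)
  define E where "E = fps_exp 1 oo P"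
  have E: "(\<lambda>z. exp (L z)) has_fps_expansion E"
    unfolding E_def using has_fps_expansion_compose[OF has_fps_expansion_exp[of 1] P P0] by (simp add: o_def)
  have "(\<lambda>z. exp (L z) * w * z) has_fps_expansion (E * fps_const w * fps_X)"
    by (intro fps_expansion_intros E)
  note expL = this
  have "\<forall>\<^sub>F z in nhds 0. exp (L z) * w * z = exp (of_real pi * \<i> * z) - exp (- of_real pi * \<i> * z)"
    using ev by eventually_elim (metis sinc_pi_eq w_def)
  from iffD1[OF has_fps_expansion_cong[OF this refl] expL]
  have "(\<lambda>z. exp (of_real pi * \<i> * z) - exp (- of_real pi * \<i> * z)) has_fps_expansion (E * fps_const w * fps_X)" .
  moreover have "(\<lambda>z. exp (of_real pi * \<i> * z) - exp (- of_real pi * \<i> * z)) has_fps_expansion (fps_exp (of_real pi * \<i>) - fps_exp (- of_real pi * \<i>))"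
    by (intro fps_expansion_intros)
  ultimately have EX: "E * fps_const w * fps_X = fps_exp (of_real pi * \<i>) - fps_exp (- of_real pi * \<i>)"
    by (rule fps_expansion_unique_complex)
  have dE: "fps_deriv E = E * fps_deriv P"
    unfolding E_def using P0 by (subst fps_compose_deriv) simp_all
  define e where "e = fps_exp (of_real pi * \<i>)"
  define e' where "e' = fps_exp (- of_real pi * \<i>)"
  have ee: "e * e' = 1" "e * e = fps_exp w"
    unfolding e_def e'_def fps_exp_add_mult[symmetric] by (simp_all add: w_def)
  have "fps_deriv (E * fps_const w * fps_X) = fps_const (of_real pi * \<i>) * (e + e')"
    unfolding EX e_def e'_def by (simp add: algebra_simps fps_const_neg[symmetric] del: fps_const_neg)
  moreover have "(fps_deriv P * fps_X + 1) * (E * fps_const w * fps_X) = fps_deriv (E * fps_const w * fps_X) * fps_X"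
    by (simp add: dE algebra_simps)
  ultimately have "(fps_deriv P * fps_X + 1) * (E * fps_const w * fps_X) = fps_const (of_real pi * \<i>) * (e + e') * fps_X"
    by (simp only:)
  \<comment> \<open>The factor \<open>e\<close> turns the half-angle exponentials into exp (w z) - 1
    and exp (w z) + 1, the shape in which the Bernoulli series can be inserted.\<close>
  then have "((fps_deriv P * fps_X + 1) * (e - e')) * e = (fps_const (of_real pi * \<i>) * (e + e') * fps_X) * e"
    unfolding EX e_def e'_def by simp
  then have "(fps_deriv P * fps_X + 1) * (e * e - e * e') = fps_const (of_real pi * \<i>) * fps_X * (e * e + e * e')"
    by (simp add: algebra_simps)
  then have 1: "(fps_deriv P * fps_X + 1) * (fps_exp w - 1) = fps_const (of_real pi * \<i>) * fps_X * (fps_exp w + 1)"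
    unfolding ee .
  define B where "B = Abs_fps (\<lambda>k. bernoulli_number k * w ^ k / fact k)"
  have "fps_const (of_real pi * \<i>) * fps_X * (fps_exp w + 1) = (fps_const (of_real pi * \<i>) * fps_X + B) * (fps_exp w - 1)"
  proof -
    define h where "h = fps_const (of_real pi * \<i>)"
    have W: "fps_const w = h + h" by (simp add: w_def h_def)
    have BB: "B * (fps_exp w - 1) = fps_const w * fps_X" unfolding B_def by (rule bernoulli_scaled)
    show ?thesis
      unfolding h_def[symmetric] distrib_right[of _ B] BB W by (simp add: algebra_simps)
  qed
  moreover have "fps_exp w - 1 \<noteq> 0"
  proof
    assume "fps_exp w - 1 = 0"
    then have "fps_nth (fps_exp w - 1) 1 = 0" by simp
    then show False by (simp add: w_def)
  qed
  ultimately have "fps_deriv P * fps_X + 1 = fps_const (of_real pi * \<i>) * fps_X + B"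
    using 1 by simp
  then have nth: "fps_nth (fps_deriv P * fps_X + 1) k = fps_nth (fps_const (of_real pi * \<i>) * fps_X + B) k" for k
    by simp
  have "fps_nth P k = - 2 * fps_nth (ser (\<lambda>k. if even k \<and> k \<ge> 1 then - bernoulli_number k / (2 * of_nat k) else 0)) k" for k
  proof (cases "even k \<and> k \<ge> 1")
    case False
    then have "k = 0 \<or> odd k" by auto
    then show ?thesis
      using P0 fps_uminus_odd_zero[OF P, of k] False by (auto simp: ser_def L_def sinc_pi_minus)
  next
    case True
    then obtain m where m: "k = Suc m" "m \<noteq> 0" by (cases k) auto
    have "of_nat k * fps_nth P k = bernoulli_number k * w ^ k / fact k"
      using nth[of k] m by (simp add: B_def)
    then have "fps_nth P k = bernoulli_number k * w ^ k / fact k / of_nat k"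
      using m by (simp add: field_simps del: of_nat_Suc)
    then show ?thesis using True by (simp add: ser_def w_def)
  qed
  then have Pser: "fps_const (- 1 / 2) * P = ser (\<lambda>k. if even k \<and> k \<ge> 1 then - bernoulli_number k / (2 * of_nat k) else 0)"
    by (simp add: fps_eq_iff)
  show ?thesis
  proof
    show "(\<lambda>z. - 1 / 2 * L z) has_fps_expansion ser (\<lambda>k. if even k \<and> k \<ge> 1 then - bernoulli_number k / (2 * of_nat k) else 0)"
      unfolding Pser[symmetric] by (intro fps_expansion_intros P)
    show "\<forall>\<^sub>F z in nhds 0. sinc_pi z = exp (- 2 * (- 1 / 2 * L z))"
      using ev by simp
  qed
qed

text \<open>Each Ln (1 - x q^n) is expanded into a power series and the resulting Lambert series is
  regrouped by divisors. The - 2 in the coefficients is the division by the square of (q;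
  q)_infinity. Only exponentials of logarithms occur in the conclusion, so the choice of branch has
  no effect.\<close>

lemma qP_log_series:
  assumes q: "norm q < 1" and a: "a \<noteq> 0" "norm (a * q) < 1" "norm (q / a) < 1"
  obtains S where "(\<lambda>N. q ^ Suc N * (\<Sum>d | d dvd Suc N. (a ^ d + inverse a ^ d - 2) / of_nat d)) sums S"
    "qP q a = (qinf q q)\<^sup>2 * exp (- S)"
proof -
  define b where "b = (\<lambda>d::nat. (a ^ d + inverse a ^ d - 2) / of_nat d)"
  have Ln: "(\<lambda>m. x ^ Suc m / of_nat (Suc m)) sums (- Ln (1 - x))" if "norm x < 1" for x :: complex
  proof -
    have "(\<lambda>n. - ((- (- x)) ^ n) / of_nat n) sums Ln (1 + (- x))"
      using that by (intro Ln_series') auto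
    then have "(\<lambda>n. x ^ n / of_nat n) sums (- Ln (1 - x))"
      using sums_minus by fastforce
    then show ?thesis by (subst sums_Suc_iff) simp
  qed
  have lt: "norm (x * q ^ Suc n) < 1" if "norm (x * q) < 1" for x n
  proof -
    have "norm (x * q ^ Suc n) = norm (x * q) * norm q ^ n"
      by (simp add: norm_mult norm_power)
    also have "\<dots> \<le> norm (x * q) * 1"
      using q by (intro mult_left_mono power_le_one) auto
    finally show ?thesis using that by simp
  qed
  define l where "l = (\<lambda>x n. Ln (1 - x * q ^ Suc n))"
  \<comment> \<open>Minus a logarithm of the n-th factor of
    \<open>qP q a / (qinf q q)\<^sup>2\<close>.\<close>
  define c where "c = (\<lambda>n. - l a n - l (inverse a) n + 2 * l 1 n)"
  have c: "(\<lambda>m. q ^ (Suc n * Suc m) * b (Suc m)) sums c n" for n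
  proof -
    have "(\<lambda>m. (a * q ^ Suc n) ^ Suc m / of_nat (Suc m) + (inverse a * q ^ Suc n) ^ Suc m / of_nat (Suc m)
        - 2 * ((1 * q ^ Suc n) ^ Suc m / of_nat (Suc m))) sums (- l a n + - l (inverse a) n - 2 * (- l 1 n))"
      unfolding l_def using a q
      by (intro sums_add sums_diff sums_mult Ln lt) (auto simp: divide_inverse mult.commute)
    also have "(\<lambda>m. (a * q ^ Suc n) ^ Suc m / of_nat (Suc m) + (inverse a * q ^ Suc n) ^ Suc m / of_nat (Suc m)
        - 2 * ((1 * q ^ Suc n) ^ Suc m / of_nat (Suc m))) = (\<lambda>m. q ^ (Suc n * Suc m) * b (Suc m))"
      unfolding b_def power_mult_distrib power_mult[symmetric]
      by (rule ext) (simp add: ring_distribs add_divide_distrib diff_divide_distrib mult_ac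
        del: power_Suc mult_Suc mult_Suc_right of_nat_Suc)
    finally show ?thesis by (simp add: c_def)
  qed
  have "summable (\<lambda>m. norm q ^ Suc m * norm (b (Suc m)))"
  proof (rule summable_comparison_test')
    have "norm a * norm q < 1" "norm q / norm a < 1" using a(2,3) by (auto simp: norm_mult norm_divide)
    then show "summable (\<lambda>m. (norm a * norm q) ^ Suc m + (norm q / norm a) ^ Suc m + 2 * norm q ^ Suc m)"
      using q by (intro summable_add summable_mult summable_Suc_iff[THEN iffD2] summable_geometric) auto
    fix m :: nat
    have "norm (b (Suc m)) = norm (a ^ Suc m + inverse a ^ Suc m - 2) / real (Suc m)"
      unfolding b_def norm_divide norm_of_nat ..
    also have "\<dots> \<le> norm (a ^ Suc m + inverse a ^ Suc m - 2) / 1"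
      by (intro divide_left_mono) auto
    also have "\<dots> \<le> norm (a ^ Suc m) + norm (inverse a ^ Suc m) + norm (2::complex)"
      using norm_triangle_ineq4[of "a ^ Suc m + inverse a ^ Suc m" 2] norm_triangle_ineq[of "a ^ Suc m" "inverse a ^ Suc m"]
      by simp
    finally have "norm q ^ Suc m * norm (b (Suc m)) \<le> norm q ^ Suc m * (norm (a ^ Suc m) + norm (inverse a ^ Suc m) + 2)"
      by (intro mult_left_mono) auto
    also have "\<dots> = (norm a * norm q) ^ Suc m + (norm q / norm a) ^ Suc m + 2 * norm q ^ Suc m"
      unfolding norm_power norm_inverse power_mult_distrib divide_inverse by (simp only: distrib_left mult_ac)
    finally show "norm (norm q ^ Suc m * norm (b (Suc m))) \<le> (norm a * norm q) ^ Suc m + (norm q / norm a) ^ Suc m + 2 * norm q ^ Suc m"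
      by simp
  qed
  from lambert_regroup[OF q this c] obtain S where S: "c sums S" "(\<lambda>N. q ^ Suc N * (\<Sum>d | d dvd Suc N. b d)) sums S"
    by blast
  have nz: "1 - x * q ^ Suc n \<noteq> 0" if "norm (x * q) < 1" for x n
    using lt[OF that, of n] by auto
  note c1 = convergent_qinf[OF q, of "a * q"] and c2 = convergent_qinf[OF q, of "q / a"] and c3 = convergent_qinf[OF q, of q]
  have "exp (- S) = (\<Prod>n. exp (- c n))"
    using S(1) by (metis prodinf_exp sums_iff sums_minus)
  also have "(\<lambda>n. exp (- c n)) = (\<lambda>n. (1 - a * q * q ^ n) * (1 - q / a * q ^ n) / (1 - q * q ^ n) ^ 2)"
  proof
    fix n
    have "- c n = l a n + l (inverse a) n - (l 1 n + l 1 n)" by (simp add: c_def)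
    moreover have "exp (l x n) = 1 - x * q ^ Suc n" if "norm (x * q) < 1" for x
      using nz[OF that] by (simp add: l_def)
    ultimately have "exp (- c n) = (1 - a * q ^ Suc n) * (1 - inverse a * q ^ Suc n) / ((1 - 1 * q ^ Suc n) * (1 - 1 * q ^ Suc n))"
      using a q by (simp only: exp_diff exp_add) (simp add: divide_inverse mult.commute)
    then show "exp (- c n) = (1 - a * q * q ^ n) * (1 - q / a * q ^ n) / (1 - q * q ^ n) ^ 2"
      by (simp add: power2_eq_square divide_inverse mult_ac)
  qed
  also have "(\<Prod>n. (1 - a * q * q ^ n) * (1 - q / a * q ^ n) / (1 - q * q ^ n) ^ 2) = qP q a / (qinf q q)\<^sup>2"
    unfolding qP_def[OF q] qinf_def
    by (simp only: prodinf_mult[OF c1 c2] prodinf_power[OF c3, symmetric]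
        prodinf_divide[OF convergent_prod_mult[OF c1 c2] convergent_prod_power[OF c3]])
  finally have "qP q a = (qinf q q)\<^sup>2 * exp (- S)"
    using qinf_q_nonzero[OF q] by (simp add: field_simps)
  with S(2) show ?thesis using that unfolding b_def by blast
qed

lemma exp_power_ee: "ee z ^ n = exp (2 * of_real pi * \<i> * of_nat n * z)"
  by (simp add: ee_def exp_of_nat_mult[symmetric] mult_ac)

text \<open>The divisor series of \<open>qP_log_series\<close> at a = exp (w z) is differentiated at
  z = 0. The k-th derivative of (a^d + a^(-d) - 2) / d is 2 w^k d^(k-1) for even k >= 2 and 0
  otherwise, so divisor sums appear.\<close>

lemma qP_product_expansion:
  assumes \<tau>: "\<tau> \<in> \<H>"
  obtains f where "f has_fps_expansion ser (\<lambda>k. if even k \<and> k \<ge> 1 then (\<Sum>n. of_nat (divisor_sigma (k - 1) (Suc n)) * ee \<tau> ^ Suc n) else 0)"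
    "\<forall>\<^sub>F z in nhds 0. qP (ee \<tau>) (ee z) = (qinf (ee \<tau>) (ee \<tau>))\<^sup>2 * exp (- 2 * f z)"
proof -
  define q where "q = ee \<tau>"
  define w where "w = 2 * of_real pi * \<i>"
  define y where "y = Im \<tau>"
  have y: "y > 0" using \<tau> by (simp add: y_def upper_half_plane_def)
  have nq: "norm q = exp (- 2 * pi * y)" by (simp add: q_def norm_ee y_def)
  have q1: "norm q < 1" unfolding q_def using \<tau> by (rule norm_ee_less_1)
  \<comment> \<open>The k-th derivative in z of exp (w d z) + exp (- w d z) - 2; the constant is
    present only for k = 0.\<close>
  define t where "t = (\<lambda>k d z. w ^ k * of_nat d ^ k * (exp (w * of_nat d * z) + (-1) ^ k * exp (- (w * of_nat d * z)))
     - (if k = 0 then 2 else 0))"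
  define F where "F = (\<lambda>k N z. q ^ Suc N / 2 * (\<Sum>d | d dvd Suc N. t k d z / of_nat d))"
  have der: "(F k N has_field_derivative F (Suc k) N z) (at z)" for k N z
  proof -
    have "(t k d has_field_derivative t (Suc k) d z) (at z)" for d
      unfolding t_def by (auto intro!: derivative_eq_intros simp: algebra_simps)
    then show ?thesis
      unfolding F_def by (intro DERIV_cmult DERIV_sum DERIV_cdivide)
  qed
  have bd: "\<exists>d h. 0 < d \<and> summable h \<and> (\<forall>n. \<forall>x\<in>ball z d \<inter> ball 0 y. norm (F k n x) \<le> h n)"
    if z: "z \<in> ball 0 y" for k z
  proof -
    \<comment> \<open>Near z the exponentials are at most exp (2 pi R (N + 1)), and R < y lets the
      decay exp (- 2 pi y (N + 1)) of the powers of q win. The number of divisors costs one more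
      factor N + 1, hence the exponent \<open>Suc k\<close> in the majorant.\<close>
    define R where "R = (norm z + y) / 2"
    have R: "norm z < R" "R < y" "R > 0" using z y by (auto simp: R_def intro: add_nonneg_pos)
    define h where "h = (\<lambda>N. 2 * (2 * pi) ^ k * ((1 * real N + 1) ^ Suc k * exp (- (2 * pi * (y - R)) * (1 * real N + 1))))"
    have "summable h"
      unfolding h_def using R by (intro summable_mult summable_power_exp) auto
    moreover have "norm (F k N x) \<le> h N" if x: "x \<in> ball z (R - norm z)" for N x
    proof -
      have nx: "norm x \<le> R"
        using x norm_triangle_sub[of x z] by (simp add: dist_norm norm_minus_commute)
      have tb: "norm (t k d x / of_nat d) \<le> 4 * (2 * pi) ^ k * (real (Suc N) ^ k * exp (2 * pi * R * real (Suc N)))"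
        if d: "d dvd Suc N" for d
      proof -
        have d1: "1 \<le> d" "d \<le> Suc N" using d by (auto simp: dvd_imp_le Suc_le_eq intro!: Nat.gr0I)
        have e: "norm (exp u) \<le> exp (2 * pi * R * real (Suc N))" if "norm u \<le> 2 * pi * real d * norm x" for u :: complex
        proof -
          have "norm (exp u) \<le> exp (norm u)" by (rule norm_exp)
          also have "norm u \<le> 2 * pi * real d * norm x" by fact
          also have "\<dots> \<le> 2 * pi * real (Suc N) * R" using d1 nx by (intro mult_mono) auto
          finally show ?thesis by (simp add: mult_ac)
        qed
        have nw: "norm (w * of_nat d * x) = 2 * pi * real d * norm x" by (simp add: w_def norm_mult)
        have "norm (exp (w * of_nat d * x) + (-1) ^ k * exp (- (w * of_nat d * x))) \<le> exp (2 * pi * R * real (Suc N)) + exp (2 * pi * R * real (Suc N))"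
        proof (rule order_trans[OF norm_triangle_ineq add_mono])
          show "norm (exp (w * of_nat d * x)) \<le> exp (2 * pi * R * real (Suc N))"
            by (rule e) (simp only: nw)
          have "norm ((-1) ^ k * exp (- (w * of_nat d * x))) = norm (exp (- (w * of_nat d * x)))"
            by (simp only: norm_mult norm_power norm_minus_cancel norm_one power_one mult_1_left)
          also have "\<dots> \<le> exp (2 * pi * R * real (Suc N))"
            by (rule e) (simp only: norm_minus_cancel nw)
          finally show "norm ((-1) ^ k * exp (- (w * of_nat d * x))) \<le> exp (2 * pi * R * real (Suc N))" .
        qed
        then have "norm (w ^ k * of_nat d ^ k * (exp (w * of_nat d * x) + (-1) ^ k * exp (- (w * of_nat d * x))))
          \<le> (2 * pi) ^ k * real (Suc N) ^ k * (exp (2 * pi * R * real (Suc N)) + exp (2 * pi * R * real (Suc N)))"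
          unfolding norm_mult[of "w ^ k * _"] norm_mult[of "w ^ k"] norm_power norm_of_nat using d1
          by (intro mult_mono power_mono) (auto simp: w_def norm_mult)
        moreover have "norm (if k = 0 then 2 else 0 :: complex) \<le> 2 * ((2 * pi) ^ k * real (Suc N) ^ k * exp (2 * pi * R * real (Suc N)))"
          using R by (auto intro!: mult_nonneg_nonneg)
        ultimately have "norm (t k d x) \<le> 4 * (2 * pi) ^ k * (real (Suc N) ^ k * exp (2 * pi * R * real (Suc N)))"
          unfolding t_def by (intro order_trans[OF norm_triangle_ineq4]) (simp add: algebra_simps)
        moreover have "norm (t k d x / of_nat d) \<le> norm (t k d x) / 1"
          unfolding norm_divide norm_of_nat using d1 by (intro divide_left_mono) auto
        ultimately show ?thesis by simp
      qed
      have "norm (\<Sum>d | d dvd Suc N. t k d x / of_nat d) \<le> (\<Sum>d | d dvd Suc N. 4 * (2 * pi) ^ k * (real (Suc N) ^ k * exp (2 * pi * R * real (Suc N))))"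
        by (intro order_trans[OF norm_sum] sum_mono) (use tb in auto)
      also have "\<dots> = real (card {d. d dvd Suc N}) * (4 * (2 * pi) ^ k * (real (Suc N) ^ k * exp (2 * pi * R * real (Suc N))))"
        by simp
      also have "\<dots> \<le> real (Suc N) * (4 * (2 * pi) ^ k * (real (Suc N) ^ k * exp (2 * pi * R * real (Suc N))))"
      proof (intro mult_right_mono)
        have "card {d. d dvd Suc N} \<le> card {1..Suc N}"
          by (intro card_mono) (auto simp: dvd_imp_le Suc_le_eq intro!: Nat.gr0I)
        then show "real (card {d. d dvd Suc N}) \<le> real (Suc N)" by simp
      qed auto
      finally have "norm (F k N x) \<le> norm (q ^ Suc N / 2) * (real (Suc N) * (4 * (2 * pi) ^ k * (real (Suc N) ^ k * exp (2 * pi * R * real (Suc N)))))"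
        unfolding F_def norm_mult[of "q ^ Suc N / 2"] by (intro mult_left_mono) auto
      also have "norm (q ^ Suc N / 2) = exp (- 2 * pi * y * real (Suc N)) / 2"
        unfolding norm_divide norm_power nq by (simp add: exp_of_nat2_mult[symmetric] del: power_Suc of_nat_Suc)
      also have "exp (- 2 * pi * y * real (Suc N)) / 2 * (real (Suc N) * (4 * (2 * pi) ^ k * (real (Suc N) ^ k * exp (2 * pi * R * real (Suc N)))))
         = 2 * (2 * pi) ^ k * (real (Suc N) ^ Suc k * (exp (- 2 * pi * y * real (Suc N)) * exp (2 * pi * R * real (Suc N))))"
        by (simp add: mult_ac del: of_nat_Suc)
      also have "\<dots> = h N"
        unfolding h_def mult_exp_exp by (simp add: algebra_simps)
      finally show ?thesis .
    qed
    ultimately show ?thesis using R by (intro exI[of _ "R - norm z"] exI[of _ h]) auto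
  qed
  have exp: "(\<lambda>z. \<Sum>n. F 0 n z) has_fps_expansion Abs_fps (\<lambda>k. (\<Sum>n. F k n 0) / fact k)"
    by (rule termwise_fps_expansion[where f = F and S = "ball 0 y"]) (use der bd y in auto)
  have F0: "F k n 0 = (if even k \<and> k \<ge> 1 then w ^ k * (of_nat (divisor_sigma (k - 1) (Suc n)) * q ^ Suc n) else 0)" for k n
  proof (cases "even k \<and> k \<ge> 1")
    case True
    then obtain m where m: "k = Suc m" by (cases k) auto
    have "t k d 0 / of_nat d = 2 * w ^ k * of_nat (d ^ m)" if "d dvd Suc n" for d
    proof -
      have "d \<noteq> 0" using that by (auto intro!: Nat.gr0I)
      then show ?thesis using True m by (simp add: t_def)
    qed
    then have "(\<Sum>d | d dvd Suc n. t k d 0 / of_nat d) = (\<Sum>d | d dvd Suc n. 2 * w ^ k * of_nat (d ^ m))"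
      by (intro sum.cong) auto
    also have "\<dots> = 2 * w ^ k * of_nat (divisor_sigma m (Suc n))"
      by (simp add: divisor_sigma_def sum_distrib_left)
    finally show ?thesis
      unfolding F_def using True by (simp add: m mult_ac)
  next
    case False
    then have "t k d 0 = 0" for d by (auto simp: t_def)
    then show ?thesis using False by (auto simp: F_def)
  qed
  define D where "D = (\<lambda>k. if even k \<and> k \<ge> 1 then (\<Sum>n. of_nat (divisor_sigma (k - 1) (Suc n)) * q ^ Suc n) else 0)"
  have "(\<Sum>n. F k n 0) = w ^ k * D k" for k
  proof (cases "even k \<and> k \<ge> 1")
    case True
    have "summable (\<lambda>n. F k n 0)"
      by (rule sums_summable[OF termwise_deriv(1)[where f = F and S = "ball 0 y"]]) (use der bd y in auto)
    then have "summable (\<lambda>n. 1 / w ^ k * F k n 0)" by (rule summable_mult)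
    then have "summable (\<lambda>n. of_nat (divisor_sigma (k - 1) (Suc n)) * q ^ Suc n)"
      unfolding F0 using True by (simp add: w_def)
    then show ?thesis unfolding F0 using True by (simp add: D_def suminf_mult del: power_Suc)
  qed (auto simp: F0 D_def)
  then have fpseq: "Abs_fps (\<lambda>k. (\<Sum>n. F k n 0) / fact k) = ser D"
    by (simp add: ser_def w_def mult.commute)
  have "qP q (ee z) = (qinf q q)\<^sup>2 * exp (- 2 * (\<Sum>n. F 0 n z))" if z: "z \<in> ball 0 y" for z
  proof -
    have "\<bar>Im z\<bar> < y" using z abs_Im_le_cmod[of z] by simp
    then have "pi * (y + Im z) > 0" "pi * (y - Im z) > 0" by (auto intro!: mult_pos_pos)
    then have n: "norm (ee z * q) < 1" "norm (q / ee z) < 1"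
      by (auto simp: norm_mult norm_divide norm_ee nq exp_diff[symmetric] mult_exp_exp algebra_simps)
    obtain S where S: "(\<lambda>N. q ^ Suc N * (\<Sum>d | d dvd Suc N. (ee z ^ d + inverse (ee z) ^ d - 2) / of_nat d)) sums S"
      "qP q (ee z) = (qinf q q)\<^sup>2 * exp (- S)"
      using qP_log_series[OF q1 _ n] by auto
    have "t 0 d z = ee z ^ d + inverse (ee z) ^ d - 2" for d
      by (simp add: t_def w_def exp_power_ee[symmetric] exp_minus power_inverse[symmetric])
    then have F0z: "F 0 N z = 1 / 2 * (q ^ Suc N * (\<Sum>d | d dvd Suc N. (ee z ^ d + inverse (ee z) ^ d - 2) / of_nat d))" for N
      by (simp add: F_def)
    have "(\<Sum>n. F 0 n z) = 1 / 2 * S"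
      unfolding F0z by (rule sums_unique[OF sums_mult[OF S(1)], symmetric])
    then have "- 2 * (\<Sum>n. F 0 n z) = - S" by (simp add: mult.commute)
    then show ?thesis using S(2) by (simp only:)
  qed
  then have "\<forall>\<^sub>F z in nhds 0. qP q (ee z) = (qinf q q)\<^sup>2 * exp (- 2 * (\<Sum>n. F 0 n z))"
    using y by (intro eventually_mono[OF eventually_nhds_in_open[of "ball 0 y"]]) auto
  then show ?thesis using that exp unfolding fpseq D_def q_def by blast
qed

lemma ser_add: "ser a + ser b = ser (\<lambda>k. a k + b k)"
  by (simp add: ser_def fps_eq_iff add_divide_distrib distrib_right)

text \<open>The sine factor contributes the Bernoulli constants and the product the divisor sums;
  together they are the complete Eisenstein series.\<close>

theorem qP_expansion:
  assumes \<tau>: "\<tau> \<in> \<H>"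
  obtains f where "f has_fps_expansion ser (\<lambda>k. if k = 0 then 0 else eisenstein k \<tau>)"
    "\<forall>\<^sub>F z in nhds 0. sinc_pi z * qP (ee \<tau>) (ee z) = (qinf (ee \<tau>) (ee \<tau>))\<^sup>2 * exp (- 2 * f z)"
proof -
  obtain f1 where f1: "f1 has_fps_expansion ser (\<lambda>k. if even k \<and> k \<ge> 1 then - bernoulli_number k / (2 * of_nat k) else 0)"
    "\<forall>\<^sub>F z in nhds 0. sinc_pi z = exp (- 2 * f1 z)"
    using sinc_pi_expansion by blast
  obtain f2 where f2: "f2 has_fps_expansion ser (\<lambda>k. if even k \<and> k \<ge> 1 then (\<Sum>n. of_nat (divisor_sigma (k - 1) (Suc n)) * ee \<tau> ^ Suc n) else 0)"
    "\<forall>\<^sub>F z in nhds 0. qP (ee \<tau>) (ee z) = (qinf (ee \<tau>) (ee \<tau>))\<^sup>2 * exp (- 2 * f2 z)"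
    using qP_product_expansion[OF \<tau>] by blast
  show ?thesis
  proof
    have "(\<lambda>z. f1 z + f2 z) has_fps_expansion (ser (\<lambda>k. if even k \<and> k \<ge> 1 then - bernoulli_number k / (2 * of_nat k) else 0)
      + ser (\<lambda>k. if even k \<and> k \<ge> 1 then (\<Sum>n. of_nat (divisor_sigma (k - 1) (Suc n)) * ee \<tau> ^ Suc n) else 0))"
      by (intro has_fps_expansion_add f1 f2)
    also have "\<dots> = ser (\<lambda>k. if k = 0 then 0 else eisenstein k \<tau>)"
      unfolding ser_add by (rule arg_cong[of _ _ ser]) (auto simp: eisenstein_def)
    finally show "(\<lambda>z. f1 z + f2 z) has_fps_expansion ser (\<lambda>k. if k = 0 then 0 else eisenstein k \<tau>)" .
    show "\<forall>\<^sub>F z in nhds 0. sinc_pi z * qP (ee \<tau>) (ee z) = (qinf (ee \<tau>) (ee \<tau>))\<^sup>2 * exp (- 2 * (f1 z + f2 z))"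
      using f1(2) f2(2) by eventually_elim (simp add: exp_add[symmetric] algebra_simps)
  qed
qed

section \<open>Series satisfying a heat equation\<close>

lemma open_\<H>: "open \<H>"
  unfolding upper_half_plane_def by (rule open_halfspace_Im_gt)

context
  fixes a b \<kappa> :: real
  assumes a: "a > 0" and b: "b \<ge> 0" and \<kappa>: "\<kappa> > 0"
begin

text \<open>The k-th z-derivative of (-1)^n zeta^u q^(kappa u^2) at u = a n + b. Every such term,
  and hence the series, solves the same heat equation.\<close>

definition Jterm :: "nat \<Rightarrow> nat \<Rightarrow> complex \<Rightarrow> complex \<Rightarrow> complex" where
  "Jterm k n z \<tau> = (-1) ^ n * (2 * of_real pi * \<i> * of_real (a * real n + b)) ^ k *
     ee (of_real (a * real n + b) * z + of_real (\<kappa> * (a * real n + b)\<^sup>2) * \<tau>)"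

definition J :: "nat \<Rightarrow> complex \<Rightarrow> complex \<Rightarrow> complex" where
  "J k z \<tau> = (\<Sum>n. Jterm k n z \<tau>)"

text \<open>The growth in z is exponential in u and the decay in \<open>\<tau>\<close> is Gaussian
  in u, so completing the square gives a bound uniform in bounded z and in \<open>\<tau>\<close>
  with imaginary part at least y.\<close>

lemma Jterm_bound:
  assumes y: "y > 0"
  obtains h where "summable h" "\<And>n z \<tau>. norm z \<le> R \<Longrightarrow> Im \<tau> \<ge> y \<Longrightarrow> norm (Jterm k n z \<tau>) \<le> h n"
proof -
  define p where "p = 2 * pi * \<kappa> * y"
  have p: "p > 0" using y \<kappa> by (simp add: p_def)
  \<comment> \<open>The additional 1 leaves a factor exp (- u) after the square has been completed,
    and this factor makes the majorant summable.\<close>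
  define s where "s = 2 * pi * R + 1"
  define h where "h = (\<lambda>n. (2 * pi) ^ k * exp (s\<^sup>2 / (4 * p)) * ((a * real n + b) ^ k * exp (- 1 * (a * real n + b))))"
  show ?thesis
  proof
    show "summable h" unfolding h_def using a b by (intro summable_mult summable_power_exp) auto
    fix n and z \<tau> :: complex assume z: "norm z \<le> R" and \<tau>: "Im \<tau> \<ge> y"
    define u where "u = a * real n + b"
    have u: "u \<ge> 0" using a b by (simp add: u_def)
    have "norm (Jterm k n z \<tau>) = (2 * pi) ^ k * u ^ k * exp (- 2 * pi * (u * Im z + \<kappa> * u\<^sup>2 * Im \<tau>))"
      unfolding Jterm_def u_def[symmetric] norm_mult norm_power norm_ee using u
      by (simp add: norm_mult power_mult_distrib)
    also have "\<dots> \<le> (2 * pi) ^ k * u ^ k * exp (s\<^sup>2 / (4 * p) - u)"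
    proof -
      have "- (u * Im z) \<le> u * R"
        using mult_left_mono[OF order_trans[OF abs_Im_le_cmod z] u] u
        by (metis abs_ge_minus_self abs_mult abs_of_nonneg order_trans)
      moreover have "\<kappa> * u\<^sup>2 * Im \<tau> \<ge> \<kappa> * u\<^sup>2 * y" using \<tau> \<kappa> by (intro mult_left_mono) auto
      ultimately have "- (u * Im z + \<kappa> * u\<^sup>2 * Im \<tau>) \<le> u * R - \<kappa> * u\<^sup>2 * y" by linarith
      then have "2 * pi * - (u * Im z + \<kappa> * u\<^sup>2 * Im \<tau>) \<le> 2 * pi * (u * R - \<kappa> * u\<^sup>2 * y)"
        by (intro mult_left_mono) auto
      also have "\<dots> = s * u - p * u\<^sup>2 - u" by (simp add: s_def p_def algebra_simps)
      also have "s * u - p * u\<^sup>2 \<le> s\<^sup>2 / (4 * p)"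
      proof -
        have "s\<^sup>2 / (4 * p) - (s * u - p * u\<^sup>2) = (s - 2 * p * u)\<^sup>2 / (4 * p)"
          using p by (simp add: field_simps power2_eq_square)
        moreover have "\<dots> \<ge> 0" using p by simp
        ultimately show ?thesis by linarith
      qed
      finally have "- 2 * pi * (u * Im z + \<kappa> * u\<^sup>2 * Im \<tau>) \<le> s\<^sup>2 / (4 * p) - u"
        by (simp only: mult_minus_left mult_minus_right)
      then show ?thesis using u by (intro mult_left_mono) auto
    qed
    also have "\<dots> = h n" unfolding h_def u_def[symmetric] by (simp add: exp_diff exp_minus field_simps)
    finally show "norm (Jterm k n z \<tau>) \<le> h n" .
  qed
qed

lemma Jterm_deriv_z: "((\<lambda>z. Jterm k n z \<tau>) has_field_derivative Jterm (Suc k) n z \<tau>) (at z)"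
  unfolding Jterm_def ee_def by (auto intro!: derivative_eq_intros simp: algebra_simps)

text \<open>Differentiation in \<open>\<tau>\<close> produces 2 pi i kappa u^2, which is kappa / (2
  pi i) times the factor (2 pi i u)^2 of two z-derivatives.\<close>

lemma Jterm_deriv_\<tau>:
  "((\<lambda>\<tau>. Jterm k n z \<tau>) has_field_derivative of_real \<kappa> / (2 * of_real pi * \<i>) * Jterm (Suc (Suc k)) n z \<tau>) (at \<tau>)"
  unfolding Jterm_def ee_def
  by (auto intro!: derivative_eq_intros simp: power2_eq_square)

lemma Jterm_sums: assumes "\<tau> \<in> \<H>" shows "(\<lambda>n. Jterm k n z \<tau>) sums J k z \<tau>"
proof -
  have "Im \<tau> > 0" using assms by (simp add: upper_half_plane_def)
  then obtain h where h: "summable h" "\<And>n z' \<tau>'. norm z' \<le> norm z \<Longrightarrow> Im \<tau>' \<ge> Im \<tau> \<Longrightarrow> norm (Jterm k n z' \<tau>') \<le> h n"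
    using Jterm_bound by blast
  then have "summable (\<lambda>n. Jterm k n z \<tau>)" by (intro summable_comparison_test'[OF h(1)]) auto
  then show ?thesis unfolding J_def by (rule summable_sums)
qed

lemma J_has_fps_expansion:
  assumes "\<tau> \<in> \<H>"
  shows "(\<lambda>z. J 0 z \<tau>) has_fps_expansion Abs_fps (\<lambda>k. J k 0 \<tau> / fact k)"
  unfolding J_def
proof (rule termwise_fps_expansion[where f = "\<lambda>k n z. Jterm k n z \<tau>" and S = UNIV])
  fix k and z :: complex
  have "Im \<tau> > 0" using assms by (simp add: upper_half_plane_def)
  then obtain h where h: "summable h" "\<And>n z' \<tau>'. norm z' \<le> norm z + 1 \<Longrightarrow> Im \<tau>' \<ge> Im \<tau> \<Longrightarrow> norm (Jterm k n z' \<tau>') \<le> h n"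
    using Jterm_bound by blast
  have "norm y \<le> norm z + 1" if "y \<in> ball z 1" for y
    using that norm_triangle_sub[of y z] by (simp add: dist_norm norm_minus_commute)
  then show "\<exists>d h. 0 < d \<and> summable h \<and> (\<forall>n. \<forall>y\<in>ball z d \<inter> UNIV. norm (Jterm k n y \<tau>) \<le> h n)"
    using h by (intro exI[of _ 1] exI[of _ h]) auto
qed (auto intro: Jterm_deriv_z)

lemma J_deriv:
  assumes "\<tau> \<in> \<H>"
  shows "((\<lambda>\<tau>. J k z \<tau>) has_field_derivative of_real \<kappa> / (2 * of_real pi * \<i>) * J (Suc (Suc k)) z \<tau>) (at \<tau>)"
proof -
  define c where "c = of_real \<kappa> / (2 * of_real pi * \<i>)"
  \<comment> \<open>Differentiating in \<open>\<tau>\<close> once raises the z-order by two, so this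
    is the tower of all \<open>\<tau>\<close>-derivatives in the form expected by
    \<open>termwise_deriv\<close>.\<close>
  define f where "f = (\<lambda>j n \<tau>. c ^ j * Jterm (k + 2 * j) n z \<tau>)"
  have "((\<lambda>\<tau>. \<Sum>n. f 0 n \<tau>) has_field_derivative (\<Sum>n. f (Suc 0) n \<tau>)) (at \<tau>)"
  proof (rule termwise_deriv(2)[OF open_\<H> _ _ assms])
    show "(f j n has_field_derivative f (Suc j) n \<tau>) (at \<tau>)" for j n \<tau>
      unfolding f_def using DERIV_cmult[OF Jterm_deriv_\<tau>, of "c ^ j" "k + 2 * j" n z \<tau>]
      by (simp add: c_def mult_ac)
    show "\<exists>d h. 0 < d \<and> summable h \<and> (\<forall>n. \<forall>y\<in>ball \<tau> d \<inter> \<H>. norm (f j n y) \<le> h n)" if "\<tau> \<in> \<H>" for j \<tau>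
    proof -
      have y: "Im \<tau> / 2 > 0" using that by (simp add: upper_half_plane_def)
      then obtain h where h: "summable h" "\<And>n z' \<tau>'. norm z' \<le> norm z \<Longrightarrow> Im \<tau>' \<ge> Im \<tau> / 2 \<Longrightarrow> norm (Jterm (k + 2 * j) n z' \<tau>') \<le> h n"
        using Jterm_bound by blast
      have "Im x \<ge> Im \<tau> / 2" if "x \<in> ball \<tau> (Im \<tau> / 2)" for x
        using that abs_Im_le_cmod[of "\<tau> - x"] by (simp add: dist_norm)
      then have "\<forall>n. \<forall>y\<in>ball \<tau> (Im \<tau> / 2) \<inter> \<H>. norm (f j n y) \<le> norm (c ^ j) * h n"
        using h(2)[of z] by (auto simp: f_def norm_mult intro!: mult_left_mono)
      then show ?thesis using y summable_mult[OF h(1), of "norm (c ^ j)"] by blast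
    qed
  qed
  moreover have "(\<Sum>n. f (Suc 0) n \<tau>) = c * J (Suc (Suc k)) z \<tau>"
    using sums_unique[OF sums_mult[OF Jterm_sums[OF assms, of "Suc (Suc k)" z], of c]] by (simp add: f_def)
  ultimately show ?thesis by (simp add: f_def J_def[abs_def] c_def)
qed

end

section \<open>The functions T, h and eta as heat series\<close>

definition TJ :: "nat \<Rightarrow> complex \<Rightarrow> complex \<Rightarrow> complex" where
  "TJ k z \<tau> = 2 * \<i> * J 1 (1/2) (1/2) k z \<tau>"

text \<open>\<open>SJ 0\<close> arises from \<open>\<zeta> ^ (1/2) * q ^ (1/24) * h / (1 - \<zeta>)\<close> by completing the squares in the exponents
  of \<open>q\<close>.\<close>

definition SJ :: "nat \<Rightarrow> complex \<Rightarrow> complex \<Rightarrow> complex" where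
  "SJ k z \<tau> = J 3 (1/2) (1/6) k z \<tau> - J 3 (5/2) (1/6) k z \<tau>"

lemma J_params: "(3::real) > 0" "(1/2::real) \<ge> 0" "(5/2::real) \<ge> 0" "(1/6::real) > 0" "(1::real) > 0" "(1/2::real) > 0"
  by auto

lemma T_fun_eq_TJ: "T_fun z \<tau> = TJ 0 z \<tau>"
  unfolding T_fun_def TJ_def J_def[OF J_params(5,2,6)] Jterm_def[OF J_params(5,2,6)]
  by (simp add: ee_add mult.assoc)

lemma of_nat_tri: "of_nat (n * (n + 1) div 2) = (of_nat n * (of_nat n + 1) / 2 :: complex)"
proof -
  have "(2::complex) * of_nat (tri n) = of_nat n * of_nat n + of_nat n"
    using arg_cong[OF tri_double[of n], of "of_nat :: nat \<Rightarrow> complex"] by simp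
  then show ?thesis by (simp add: tri_def field_simps)
qed

lemma T_fun_double: assumes "\<tau> \<in> \<H>"
  shows "T_fun (2 * z) \<tau> = 2 * \<i> * ee (\<tau> / 8) * qC (ee \<tau>) (ee z)"
proof -
  have "(-1) ^ n * ee ((of_nat n + 1/2) * (2 * z)) * ee (1/2 * (of_nat n + 1/2)\<^sup>2 * \<tau>)
     = ee (\<tau> / 8) * ((-1) ^ n * ee z ^ (2 * n + 1) * ee \<tau> ^ (n * (n + 1) div 2))" for n
  proof -
    have 1: "(of_nat n + 1/2) * (2 * z) = of_nat (2 * n + 1) * z" by (simp add: algebra_simps)
    have 2: "1/2 * (of_nat n + 1/2)\<^sup>2 * \<tau> = \<tau> / 8 + of_nat (n * (n + 1) div 2) * \<tau>"
      unfolding of_nat_tri by (simp add: power2_eq_square field_simps)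
    show ?thesis unfolding 1 2 ee_add ee_power by simp
  qed
  then have "T_fun (2 * z) \<tau> = 2 * \<i> * (\<Sum>n. ee (\<tau> / 8) * ((-1) ^ n * ee z ^ (2 * n + 1) * ee \<tau> ^ (n * (n + 1) div 2)))"
    unfolding T_fun_def by (simp only:)
  then show ?thesis
    unfolding sums_unique[OF sums_mult[OF qC_sums[OF norm_ee_less_1[OF assms], of "ee z"], of "ee (\<tau> / 8)"], symmetric]
    by (simp only: mult.assoc)
qed

lemma of_nat_pent: "of_nat (n * (3 * n + 1) div 2) = (of_nat n * (3 * of_nat n + 1) / 2 :: complex)"
proof -
  have "even (n * (3 * n + 1))" by auto
  then have "2 * (n * (3 * n + 1) div 2) = n * (3 * n + 1)" by simp
  then have "(2::complex) * of_nat (n * (3 * n + 1) div 2) = of_nat (n * (3 * n + 1))"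
    by (metis of_nat_mult of_nat_numeral)
  then show ?thesis by (simp add: field_simps)
qed

lemma one_minus_ee: "1 - ee z = - 2 * \<i> * sin (of_real pi * z) * ee (z / 2)"
proof -
  have "ee (z / 2) = exp (\<i> * (of_real pi * z))" by (simp add: ee_def mult_ac)
  moreover have "ee z = exp (\<i> * (of_real pi * z)) * exp (\<i> * (of_real pi * z))"
    by (simp add: ee_def exp_add[symmetric] mult_ac)
  moreover have "exp (\<i> * (of_real pi * z)) * exp (- (\<i> * (of_real pi * z))) = 1"
    by (simp add: exp_add[symmetric])
  moreover have "- 2 * \<i> * sin (of_real pi * z) = exp (- (\<i> * (of_real pi * z))) - exp (\<i> * (of_real pi * z))"
    by (simp add: sin_exp_eq field_simps)
  ultimately show ?thesis by (simp add: algebra_simps)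
qed

text \<open>The squares are (3 n + 1/2)^2 / 6 = n (3 n + 1) / 2 + 1/24 and (3 n + 5/2)^2 / 6 = n (3
  n + 1) / 2 + (2 n + 1) + 1/24.\<close>

lemma SJ_eq_qH: assumes "\<tau> \<in> \<H>"
  shows "SJ 0 z \<tau> = ee (z / 2) * ee (\<tau> / 24) * qH (ee \<tau>) (ee z)"
proof -
  have "Jterm 3 (1/2) (1/6) 0 n z \<tau> - Jterm 3 (5/2) (1/6) 0 n z \<tau>
    = ee (z / 2) * ee (\<tau> / 24) * ((-1) ^ n * ee z ^ (3 * n) * ee \<tau> ^ (n * (3 * n + 1) div 2) * (1 - (ee z)\<^sup>2 * ee \<tau> ^ (2 * n + 1)))" for n
  proof -
    have 1: "of_real (3 * real n + 1/2) * z + of_real (1/6 * (3 * real n + 1/2)\<^sup>2) * \<tau>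
      = z / 2 + \<tau> / 24 + of_nat (3 * n) * z + of_nat (n * (3 * n + 1) div 2) * \<tau>"
      unfolding of_nat_pent by (simp add: power2_eq_square field_simps)
    have 2: "of_real (3 * real n + 5/2) * z + of_real (1/6 * (3 * real n + 5/2)\<^sup>2) * \<tau>
      = z / 2 + \<tau> / 24 + of_nat (3 * n) * z + of_nat (n * (3 * n + 1) div 2) * \<tau> + of_nat 2 * z + of_nat (2 * n + 1) * \<tau>"
      unfolding of_nat_pent by (simp add: power2_eq_square field_simps)
    show ?thesis
      unfolding Jterm_def[OF J_params(1,2,4)] Jterm_def[OF J_params(1,3,4)] 1 2 ee_add ee_power by (simp add: algebra_simps)
  qed
  moreover have "(\<lambda>n. Jterm 3 (1/2) (1/6) 0 n z \<tau> - Jterm 3 (5/2) (1/6) 0 n z \<tau>) sums SJ 0 z \<tau>"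
    unfolding SJ_def by (intro sums_diff Jterm_sums J_params assms)
  ultimately show ?thesis
    using sums_unique2 sums_mult[OF qH_sums[OF norm_ee_less_1[OF assms], of "ee z"], of "ee (z / 2) * ee (\<tau> / 24)"]
    by simp
qed

lemma h_fun_eq_SJ: assumes "\<tau> \<in> \<H>"
  shows "h_fun (ee z) (ee \<tau>) = - 2 * \<i> * sin (of_real pi * z) * ee (- \<tau> / 24) * SJ 0 z \<tau>"
proof -
  have "h_fun (ee z) (ee \<tau>) = (1 - ee z) * qH (ee \<tau>) (ee z)"
    unfolding h_fun_def qH_def[OF norm_ee_less_1[OF assms]] ..
  moreover have "ee (- \<tau> / 24) * ee (\<tau> / 24) = 1"
    by (simp add: ee_add[symmetric]) (simp add: ee_def)
  ultimately show ?thesis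
    unfolding one_minus_ee[of z] SJ_eq_qH[OF assms] by simp
qed

lemma eta_eq: "eta \<tau> = ee (\<tau> / 24) * qinf (ee \<tau>) (ee \<tau>)"
  by (simp add: eta_def qinf_def)

text \<open>At z = 0 the series is the pentagonal one. This is why the prefactor in the definition
  of the h_k is the right normalisation.\<close>

lemma SJ_0_eq_eta: assumes "\<tau> \<in> \<H>" shows "SJ 0 0 \<tau> = eta \<tau>"
  using pentagonal[OF norm_ee_less_1[OF assms]] by (simp add: SJ_eq_qH[OF assms] eta_eq) (simp add: ee_def)

lemma eta_nonzero: assumes "\<tau> \<in> \<H>" shows "eta \<tau> \<noteq> 0"
  using qinf_q_nonzero[OF norm_ee_less_1[OF assms]] by (simp add: eta_eq)

text \<open>Adjoining the negative exponents completes the partial theta series to a full theta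
  series. Once zeta^(-1/2) is pulled out, its terms are those of the triple product at a =
  zeta.\<close>

lemma T_fun_odd_part: assumes \<tau>: "\<tau> \<in> \<H>"
  shows "T_fun z \<tau> - T_fun (- z) \<tau> =
    - 4 * ee (\<tau> / 8) * qinf (ee \<tau>) (ee \<tau>) * sin (of_real pi * z) * qP (ee \<tau>) (ee z)"
proof -
  note q = norm_ee_less_1[OF \<tau>]
  have E: "ee (z / 2) * ee (- z / 2) = 1" by (simp add: ee_add[symmetric]) (simp add: ee_def)
  have s: "(\<lambda>n. 2 * \<i> * Jterm 1 (1/2) (1/2) 0 n z \<tau> - 2 * \<i> * Jterm 1 (1/2) (1/2) 0 n (- z) \<tau>) sums (TJ 0 z \<tau> - TJ 0 (- z) \<tau>)"
    unfolding TJ_def by (intro sums_diff sums_mult Jterm_sums J_params \<tau>)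
  have e: "2 * \<i> * Jterm 1 (1/2) (1/2) 0 n z \<tau> - 2 * \<i> * Jterm 1 (1/2) (1/2) 0 n (- z) \<tau>
    = - 2 * \<i> * ee (\<tau> / 8) * ee (- z / 2) * ((-1) ^ n * ee \<tau> ^ (n * (n + 1) div 2) * (inverse (ee z) ^ n - ee z ^ Suc n))" for n
  proof -
    have 1: "of_real (1 * real n + 1/2) * z + of_real (1/2 * (1 * real n + 1/2)\<^sup>2) * \<tau>
      = \<tau> / 8 + (- z / 2) + of_nat (Suc n) * z + of_nat (n * (n + 1) div 2) * \<tau>"
      unfolding of_nat_tri by (simp add: power2_eq_square field_simps)
    have 2: "of_real (1 * real n + 1/2) * - z + of_real (1/2 * (1 * real n + 1/2)\<^sup>2) * \<tau>
      = \<tau> / 8 + (- z / 2) + of_nat n * (- z) + of_nat (n * (n + 1) div 2) * \<tau>"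
      unfolding of_nat_tri by (simp add: power2_eq_square field_simps)
    show ?thesis
      unfolding Jterm_def[OF J_params(5,2,6)] 1 2 ee_add ee_power ee_minus by (simp add: algebra_simps)
  qed
  have "TJ 0 z \<tau> - TJ 0 (- z) \<tau> = - 2 * \<i> * ee (\<tau> / 8) * ee (- z / 2) * (qinf (ee \<tau>) (ee \<tau>) * qtheta (ee \<tau>) (ee z))"
    using s unfolding e
    by (rule sums_unique2[OF _ sums_mult[OF jacobi_triple_product[OF q ee_nonzero ee_nonzero]]])
  also have "qtheta (ee \<tau>) (ee z) = - 2 * \<i> * sin (of_real pi * z) * ee (z / 2) * qP (ee \<tau>) (ee z)"
    unfolding qtheta_eq_qP[OF q] one_minus_ee ..
  also have "- 2 * \<i> * ee (\<tau> / 8) * ee (- z / 2) * (qinf (ee \<tau>) (ee \<tau>) * (- 2 * \<i> * sin (of_real pi * z) * ee (z / 2) * qP (ee \<tau>) (ee z)))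
     = - 4 * ee (\<tau> / 8) * qinf (ee \<tau>) (ee \<tau>) * sin (of_real pi * z) * qP (ee \<tau>) (ee z) * (ee (z / 2) * ee (- z / 2))"
    by (simp add: algebra_simps)
  finally show ?thesis unfolding T_fun_eq_TJ E by simp
qed

lemma TJ_has_fps_expansion:
  assumes "\<tau> \<in> \<H>"
  shows "(\<lambda>z. TJ 0 z \<tau>) has_fps_expansion Abs_fps (\<lambda>k. TJ k 0 \<tau> / fact k)"
proof -
  have "Abs_fps (\<lambda>k. TJ k 0 \<tau> / fact k) = fps_const (2 * \<i>) * Abs_fps (\<lambda>k. J 1 (1/2) (1/2) k 0 \<tau> / fact k)"
    by (simp add: fps_eq_iff TJ_def)
  then show ?thesis
    unfolding TJ_def[of 0] using has_fps_expansion_cmult_left[OF J_has_fps_expansion[OF J_params(5,2,6) assms], of "2 * \<i>"]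
    by simp
qed

lemma SJ_has_fps_expansion: "\<tau> \<in> \<H> \<Longrightarrow> (\<lambda>z. SJ 0 z \<tau>) has_fps_expansion Abs_fps (\<lambda>k. SJ k 0 \<tau> / fact k)"
proof -
  assume \<tau>: "\<tau> \<in> \<H>"
  have "Abs_fps (\<lambda>k. SJ k 0 \<tau> / fact k) = Abs_fps (\<lambda>k. J 3 (1/2) (1/6) k 0 \<tau> / fact k) - Abs_fps (\<lambda>k. J 3 (5/2) (1/6) k 0 \<tau> / fact k)"
    by (simp add: fps_eq_iff SJ_def diff_divide_distrib)
  then show ?thesis
    unfolding SJ_def[of 0] by (auto intro!: has_fps_expansion_diff J_has_fps_expansion J_params \<tau>)
qed

lemma TJ_deriv: assumes "\<tau> \<in> \<H>"
  shows "((\<lambda>\<tau>. TJ k z \<tau>) has_field_derivative (1/2) / (2 * of_real pi * \<i>) * TJ (Suc (Suc k)) z \<tau>) (at \<tau>)"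
  using DERIV_cmult[OF J_deriv[OF J_params(5,2,6) assms, of k z], of "2 * \<i>"] by (simp add: TJ_def mult_ac)

lemma SJ_deriv: assumes "\<tau> \<in> \<H>"
  shows "((\<lambda>\<tau>. SJ k z \<tau>) has_field_derivative (1/6) / (2 * of_real pi * \<i>) * SJ (Suc (Suc k)) z \<tau>) (at \<tau>)"
  using DERIV_diff[OF J_deriv[OF J_params(1,2,4) assms, of k z] J_deriv[OF J_params(1,3,4) assms, of k z]]
  by (simp add: SJ_def right_diff_distrib)

section \<open>Algebras of meromorphic functions\<close>

lemma mero_eqI:
  assumes "\<And>\<tau>. \<tau> \<in> \<H> \<Longrightarrow> f \<tau> = g \<tau>" shows "f \<simeq> g"
  unfolding mero_eq_def eventually_cosparse_open_eq[OF open_\<H>] using assms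
  by (auto intro!: eventually_mono[OF eventually_at_in_open'[OF open_\<H>]])

lemma mero_eq_sym: "f \<simeq> g \<Longrightarrow> g \<simeq> f"
  by (simp add: mero_eq_def eq_commute)

text \<open>Exceptional points do not accumulate in \<open>\<H>\<close>, so around almost every
  point the property holds on a whole neighbourhood. This is the form in which derivatives can be
  compared.\<close>

lemma eventually_cosparse_nhds:
  assumes "\<forall>\<^sub>\<approx>\<tau>\<in>\<H>. P \<tau>"
  shows "\<forall>\<^sub>\<approx>\<tau>\<in>\<H>. eventually P (nhds \<tau>)"
proof -
  have "\<forall>x\<in>\<H>. eventually (\<lambda>\<tau>. eventually P (nhds \<tau>)) (at x)"
  proof
    fix x assume "x \<in> \<H>"
    then have "eventually P (at x)"
      using assms by (simp add: eventually_cosparse_open_eq[OF open_\<H>])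
    then obtain S where S: "open S" "x \<in> S" "\<And>y. y \<in> S \<Longrightarrow> y \<noteq> x \<Longrightarrow> P y"
      by (auto simp: eventually_at_topological)
    show "eventually (\<lambda>\<tau>. eventually P (nhds \<tau>)) (at x)"
      unfolding eventually_at_topological
    proof (intro exI[of _ S] conjI S ballI impI)
      fix \<tau> assume "\<tau> \<in> S" "\<tau> \<noteq> x"
      then have "\<forall>\<^sub>F y in nhds \<tau>. y \<in> S - {x}"
        using S by (intro eventually_nhds_in_open) auto
      then show "eventually P (nhds \<tau>)"
        by (rule eventually_mono) (use S in auto)
    qed
  qed
  then show ?thesis by (simp add: eventually_cosparse_open_eq[OF open_\<H>])
qed

lemma q_deriv_cong:
  assumes "f \<simeq> g" shows "q_deriv f \<simeq> q_deriv g"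
  unfolding mero_eq_def
  using eventually_cosparse_nhds[OF assms[unfolded mero_eq_def]]
  by eventually_elim (auto simp: q_deriv_def intro!: arg_cong2[of _ _ _ _ "(/)"] deriv_cong_ev)

text \<open>Analyticity almost everywhere is included because \<open>deriv\<close> obeys the sum and
  product rules only for differentiable functions. With it the set is again an algebra, and closure
  under D needs to be checked on generators only.\<close>

definition diff_closed :: "(complex \<Rightarrow> complex) set \<Rightarrow> (complex \<Rightarrow> complex) set" where
  "diff_closed A = {f \<in> A. q_deriv f \<in> A \<and> (\<forall>\<^sub>\<approx>\<tau>\<in>\<H>. f analytic_on {\<tau>})}"

text \<open>Abstracts the closure rules of \<open>mero_algebra\<close>, so that the lemmas below
  also apply to \<open>diff_closed A\<close>.\<close>

definition function_algebra :: "(complex \<Rightarrow> complex) set \<Rightarrow> bool" where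
  "function_algebra A \<longleftrightarrow> (\<forall>c. (\<lambda>_. c) \<in> A) \<and> (\<forall>f\<in>A. \<forall>g\<in>A. (\<lambda>\<tau>. f \<tau> + g \<tau>) \<in> A \<and> (\<lambda>\<tau>. f \<tau> * g \<tau>) \<in> A)
     \<and> (\<forall>f\<in>A. \<forall>g. f \<simeq> g \<longrightarrow> g \<in> A)"

lemma function_algebra_mero_algebra: "function_algebra (mero_algebra S)"
  unfolding function_algebra_def by (auto intro: mero_algebra.intros)

context
  fixes A assumes A: "function_algebra A"
begin

lemma fa_const: "(\<lambda>_. c) \<in> A" and fa_add: "f \<in> A \<Longrightarrow> g \<in> A \<Longrightarrow> (\<lambda>\<tau>. f \<tau> + g \<tau>) \<in> A"
  and fa_mult: "f \<in> A \<Longrightarrow> g \<in> A \<Longrightarrow> (\<lambda>\<tau>. f \<tau> * g \<tau>) \<in> A" and fa_cong: "f \<in> A \<Longrightarrow> f \<simeq> g \<Longrightarrow> g \<in> A"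
  using A by (auto simp: function_algebra_def)

lemma fa_cmult: "f \<in> A \<Longrightarrow> (\<lambda>\<tau>. c * f \<tau>) \<in> A"
  using fa_mult[OF fa_const] .

lemma fa_diff: "f \<in> A \<Longrightarrow> g \<in> A \<Longrightarrow> (\<lambda>\<tau>. f \<tau> - g \<tau>) \<in> A"
  using fa_add[of f "\<lambda>\<tau>. - 1 * g \<tau>"] fa_cmult[of g "- 1"] by simp

lemma fa_sum: "(\<And>i. i \<in> I \<Longrightarrow> f i \<in> A) \<Longrightarrow> (\<lambda>\<tau>. \<Sum>i\<in>I. f i \<tau>) \<in> A"
  by (induction I rule: infinite_finite_induct) (auto intro: fa_const fa_add)

lemma fa_power: "f \<in> A \<Longrightarrow> (\<lambda>\<tau>. f \<tau> ^ n) \<in> A"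
  by (induction n) (auto intro: fa_const fa_mult)

lemma fa_prod: "(\<And>i. i \<in> I \<Longrightarrow> f i \<in> A) \<Longrightarrow> (\<lambda>\<tau>. \<Prod>i\<in>I. f i \<tau>) \<in> A"
  by (induction I rule: infinite_finite_induct) (auto intro: fa_const fa_mult)

lemma fa_pweight:
  assumes "0 \<notin># lam" "\<And>j. j \<in># lam \<Longrightarrow> f j \<in> A"
  shows "(\<lambda>\<tau>. pweight (\<lambda>j. c * f j \<tau> / fact j) lam) \<in> A"
proof -
  have "(\<lambda>\<tau>. \<Prod>j\<in>set_mset lam. 1 / fact (count lam j) * (c / fact j * f j \<tau>) ^ count lam j) \<in> A"
    using assms(2) by (intro fa_prod fa_cmult fa_power) auto
  then show ?thesis
    using pweight_eq[OF assms(1), of "set_mset lam"] by simp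
qed

lemma fa_pexp:
  assumes "\<And>j. j \<in> {1..n} \<Longrightarrow> f j \<in> A"
  shows "(\<lambda>\<tau>. pexp c (\<lambda>j. f j \<tau>) n) \<in> A"
  unfolding pexp_def using assms partitions_le
  by (intro fa_sum fa_pweight) (auto simp: partitions_def)

lemma fa_pexp_less:
  assumes "\<And>j. j \<in> {1..<n} \<Longrightarrow> f j \<in> A"
  shows "(\<lambda>\<tau>. \<Sum>lam\<in>partitions n - {{#n#}}. pweight (\<lambda>j. c * f j \<tau> / fact j) lam) \<in> A"
  using assms partitions_less
  by (intro fa_sum fa_pweight) (auto simp: partitions_def)

text \<open>By \<open>pexp_split\<close> the n-th coefficient can be solved for \<open>f n\<close>.
  All later memberships, including those of derivatives, come from this inversion.\<close>

lemma fa_pexp_invert: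
  assumes "n \<ge> 1" "c \<noteq> 0" "\<And>j. j \<in> {1..<n} \<Longrightarrow> f j \<in> A" "(\<lambda>\<tau>. pexp c (\<lambda>j. f j \<tau>) n) \<in> A"
  shows "f n \<in> A"
proof -
  have "(\<lambda>\<tau>. fact n / c * (pexp c (\<lambda>j. f j \<tau>) n - (\<Sum>lam\<in>partitions n - {{#n#}}. pweight (\<lambda>j. c * f j \<tau> / fact j) lam))) \<in> A"
    using assms by (intro fa_cmult fa_diff fa_pexp_less)
  also have "(\<lambda>\<tau>. fact n / c * (pexp c (\<lambda>j. f j \<tau>) n - (\<Sum>lam\<in>partitions n - {{#n#}}. pweight (\<lambda>j. c * f j \<tau> / fact j) lam))) = f n"
    using assms(1,2) by (simp add: pexp_split)
  finally show ?thesis .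
qed

lemma function_algebra_diff_closed: "function_algebra (diff_closed A)"
  unfolding function_algebra_def
proof safe
  fix c :: complex
  have "q_deriv (\<lambda>_. c) = (\<lambda>_. 0)" by (simp add: q_deriv_def[abs_def])
  then show "(\<lambda>_. c) \<in> diff_closed A"
    by (simp add: diff_closed_def fa_const)
next
  fix f g assume fg: "f \<in> diff_closed A" "g \<in> diff_closed A"
  have an: "\<forall>\<^sub>\<approx>\<tau>\<in>\<H>. f analytic_on {\<tau>}" "\<forall>\<^sub>\<approx>\<tau>\<in>\<H>. g analytic_on {\<tau>}"
    using fg by (auto simp: diff_closed_def)
  have "\<forall>\<^sub>\<approx>\<tau>\<in>\<H>. q_deriv f \<tau> + q_deriv g \<tau> = q_deriv (\<lambda>\<tau>. f \<tau> + g \<tau>) \<tau>"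
    using an by eventually_elim
      (auto simp: q_deriv_def add_divide_distrib[symmetric] deriv_add analytic_on_imp_differentiable_at)
  moreover have "(\<lambda>\<tau>. q_deriv f \<tau> + q_deriv g \<tau>) \<in> A"
    using fg by (auto simp: diff_closed_def intro: fa_add)
  ultimately have 1: "q_deriv (\<lambda>\<tau>. f \<tau> + g \<tau>) \<in> A"
    using fa_cong by (auto simp: mero_eq_def)
  have "\<forall>\<^sub>\<approx>\<tau>\<in>\<H>. f \<tau> * q_deriv g \<tau> + q_deriv f \<tau> * g \<tau> = q_deriv (\<lambda>\<tau>. f \<tau> * g \<tau>) \<tau>"
    using an by eventually_elim
      (auto simp: q_deriv_def add_divide_distrib deriv_mult analytic_on_imp_differentiable_at)
  moreover have "(\<lambda>\<tau>. f \<tau> * q_deriv g \<tau> + q_deriv f \<tau> * g \<tau>) \<in> A"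
    using fg by (auto simp: diff_closed_def intro!: fa_add fa_mult)
  ultimately have 2: "q_deriv (\<lambda>\<tau>. f \<tau> * g \<tau>) \<in> A"
    using fa_cong by (auto simp: mero_eq_def)
  have "\<forall>\<^sub>\<approx>\<tau>\<in>\<H>. (\<lambda>\<tau>. f \<tau> + g \<tau>) analytic_on {\<tau>} \<and> (\<lambda>\<tau>. f \<tau> * g \<tau>) analytic_on {\<tau>}"
    using an by eventually_elim (intro conjI analytic_intros)
  then have "\<forall>\<^sub>\<approx>\<tau>\<in>\<H>. (\<lambda>\<tau>. f \<tau> + g \<tau>) analytic_on {\<tau>}" "\<forall>\<^sub>\<approx>\<tau>\<in>\<H>. (\<lambda>\<tau>. f \<tau> * g \<tau>) analytic_on {\<tau>}"
    by (auto elim: eventually_mono)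
  then show "(\<lambda>\<tau>. f \<tau> + g \<tau>) \<in> diff_closed A" "(\<lambda>\<tau>. f \<tau> * g \<tau>) \<in> diff_closed A"
    using 1 2 fg by (auto simp: diff_closed_def intro: fa_add fa_mult)
next
  fix f g assume f: "f \<in> diff_closed A" and fg: "f \<simeq> g"
  have "\<forall>\<^sub>\<approx>\<tau>\<in>\<H>. f analytic_on {\<tau>}" using f by (simp add: diff_closed_def)
  then have "\<forall>\<^sub>\<approx>\<tau>\<in>\<H>. g analytic_on {\<tau>}"
    using eventually_cosparse_nhds[OF fg[unfolded mero_eq_def]]
    by eventually_elim (metis analytic_at_cong)
  then show "g \<in> diff_closed A"
    using f q_deriv_cong[OF fg] fa_cong[OF _ fg] fa_cong by (auto simp: diff_closed_def)
qed

end

lemma mero_algebra_subset: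
  assumes "function_algebra A" "S \<subseteq> A" shows "mero_algebra S \<subseteq> A"
proof
  fix f assume "f \<in> mero_algebra S"
  then show "f \<in> A"
    by induction (use assms in \<open>auto intro: fa_const fa_add fa_mult fa_cong\<close>)
qed

lemma mero_algebra_diff_closed:
  assumes "S \<subseteq> diff_closed (mero_algebra S)"
  shows "mero_algebra S \<subseteq> diff_closed (mero_algebra S)"
  by (intro mero_algebra_subset function_algebra_diff_closed function_algebra_mero_algebra assms)

section \<open>Relations between the expansion coefficients\<close>

lemma pexp_cong: "(\<And>j. j \<in> {1..n} \<Longrightarrow> a j = b j) \<Longrightarrow> pexp c a n = pexp c b n"
  unfolding pexp_def pweight_def partitions_def by (intro sum.cong prod.cong) auto

lemma pexp_1: "pexp c a (Suc 0) = c * a (Suc 0)"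
  using pexp_rec[of 1 c a] by (simp add: pexp_0)

lemma has_fps_expansion_scale:
  fixes f :: "complex \<Rightarrow> complex"
  assumes "f has_fps_expansion F"
  shows "(\<lambda>z. f (c * z)) has_fps_expansion Abs_fps (\<lambda>k. c ^ k * fps_nth F k)"
proof -
  have "(f \<circ> (\<lambda>z. c * z)) has_fps_expansion (F oo (fps_const c * fps_X))"
    using assms by (intro has_fps_expansion_compose fps_expansion_intros) auto
  then show ?thesis by (simp add: fps_compose_linear o_def)
qed

lemma has_fps_expansion_uminus_arg:
  fixes f :: "complex \<Rightarrow> complex"
  assumes "f has_fps_expansion F"
  shows "(\<lambda>z. f (- z)) has_fps_expansion Abs_fps (\<lambda>k. (-1) ^ k * fps_nth F k)"
  using has_fps_expansion_scale[OF assms, of "- 1"] by simp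

lemma ser_expansion_at_0: "f has_fps_expansion ser a \<Longrightarrow> a 0 = 0 \<Longrightarrow> f 0 = 0"
  using has_fps_expansion_imp_0_eq_fps_nth_0 by (fastforce simp: ser_def)

lemma eventually_nhds_0_scale:
  fixes P :: "complex \<Rightarrow> bool"
  assumes "eventually P (nhds 0)"
  shows "\<forall>\<^sub>F z in nhds 0. P (c * z)"
proof -
  have "((\<lambda>z::complex. c * z) \<longlongrightarrow> c * 0) (nhds 0)" by (intro tendsto_intros) (simp add: filterlim_ident)
  then show ?thesis using assms by (simp add: filterlim_iff)
qed

lemma has_fps_expansion_eq:
  fixes f g :: "complex \<Rightarrow> complex"
  assumes "f has_fps_expansion F" "g has_fps_expansion G" "\<forall>\<^sub>F z in nhds 0. f z = g z"
  shows "F = G"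
  using has_fps_expansion_cong[OF assms(3) refl, of F] assms(1,2) fps_expansion_unique_complex by blast

lemma sin_pi_eq: "sin (of_real pi * z) = of_real pi * z * sinc_pi z"
  by (simp add: sinc_pi_def)

lemma eventually_at_0_of_nhds: "eventually P (nhds (0::complex)) \<Longrightarrow> \<forall>\<^sub>F z in at 0. P z \<and> z \<noteq> 0"
  by (auto simp: eventually_at_filter elim: eventually_mono)

text \<open>Removes the prefactor \<open>A\<close>, which may vanish or be singular at 0. What
  remains is an equation on a full neighbourhood, because both sides have the value 1 at the
  centre.\<close>

lemma expansion_coeffs_exp:
  assumes G: "G analytic_on {0}" "G 0 = 1" and F: "\<forall>\<^sub>F z in at 0. F z = A z * G z"
    and c: "c \<noteq> 0" and A: "\<forall>\<^sub>F z in at 0. A z \<noteq> 0"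
  obtains f where "f has_fps_expansion ser (expansion_coeffs F A c)" "expansion_coeffs F A c 0 = 0"
    "\<forall>\<^sub>F z in nhds 0. G z = exp (c * f z)"
proof -
  obtain f where f: "f has_fps_expansion ser (expansion_coeffs F A c)" "expansion_coeffs F A c 0 = 0"
    "\<forall>\<^sub>F z in at 0. F z = A z * exp (c * f z)"
    using is_expansionD[OF is_expansion_expansion_coeffs[OF G F c A]] by blast
  have "f 0 = 0" using ser_expansion_at_0 f by blast
  moreover have "\<forall>\<^sub>F z in at 0. G z = exp (c * f z)"
    using f(3) F A by eventually_elim auto
  ultimately have "\<forall>\<^sub>F z in nhds 0. G z = exp (c * f z)"
    using G(2) by (simp add: eventually_nhds_conv_at)
  with f show ?thesis using that by blast
qed

section \<open>Coefficient identities at a fixed point of the upper half-plane\<close>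

context
  fixes \<tau> assumes \<tau>: "\<tau> \<in> \<H>"
begin

lemma h_expansion:
  obtains f where "f has_fps_expansion ser (\<lambda>k. h_coeff k \<tau>)" "h_coeff 0 \<tau> = 0"
    "\<forall>\<^sub>F z in nhds 0. SJ 0 z \<tau> = eta \<tau> * exp (- 1 * f z)"
proof -
  define A where "A = (\<lambda>z. - 2 * \<i> * sin (of_real pi * z) * ee (- \<tau> / 24) * eta \<tau>)"
  have h: "(\<lambda>k. h_coeff k \<tau>) = expansion_coeffs (\<lambda>z. h_fun (ee z) (ee \<tau>)) A (-1)"
    by (simp add: h_coeff_def A_def fun_eq_iff)
  obtain f where "f has_fps_expansion ser (\<lambda>k. h_coeff k \<tau>)" "h_coeff 0 \<tau> = 0"
    "\<forall>\<^sub>F z in nhds 0. SJ 0 z \<tau> / eta \<tau> = exp (- 1 * f z)"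
  proof (rule expansion_coeffs_exp[of "\<lambda>z. SJ 0 z \<tau> / eta \<tau>" "\<lambda>z. h_fun (ee z) (ee \<tau>)" A "-1"])
    show "(\<lambda>z. SJ 0 z \<tau> / eta \<tau>) analytic_on {0}"
      using has_fps_expansion_imp_analytic_0[OF SJ_has_fps_expansion[OF \<tau>]] eta_nonzero[OF \<tau>]
      by (intro analytic_intros) auto
    show "SJ 0 0 \<tau> / eta \<tau> = 1" using eta_nonzero[OF \<tau>] by (simp add: SJ_0_eq_eta[OF \<tau>])
    show "\<forall>\<^sub>F z in at 0. h_fun (ee z) (ee \<tau>) = A z * (SJ 0 z \<tau> / eta \<tau>)"
      using eta_nonzero[OF \<tau>] by (simp add: h_fun_eq_SJ[OF \<tau>] A_def)
    show "\<forall>\<^sub>F z in at 0. A z \<noteq> 0"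
      using eventually_at_0_of_nhds[OF eventually_sinc_pi_nonzero] eta_nonzero[OF \<tau>]
      by (auto simp: A_def sin_pi_eq elim!: eventually_mono)
  qed (auto simp: h[symmetric] fun_cong[OF h, symmetric])
  then show ?thesis using that eta_nonzero[OF \<tau>] by (auto simp: field_simps elim!: eventually_mono)
qed

lemma SJ_coeff: "SJ n 0 \<tau> = fact n * eta \<tau> * (2 * of_real pi * \<i>) ^ n * pexp (- 1) (\<lambda>k. h_coeff k \<tau>) n"
proof -
  obtain f where f: "f has_fps_expansion ser (\<lambda>k. h_coeff k \<tau>)" "h_coeff 0 \<tau> = 0"
    "\<forall>\<^sub>F z in nhds 0. SJ 0 z \<tau> = eta \<tau> * exp (- 1 * f z)" using h_expansion by blast
  have "Abs_fps (\<lambda>k. SJ k 0 \<tau> / fact k) = fps_const (eta \<tau>) * pser (- 1) (\<lambda>k. h_coeff k \<tau>)"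
    by (intro has_fps_expansion_eq[OF SJ_has_fps_expansion[OF \<tau>] _ f(3)] has_fps_expansion_cmult_left
        has_fps_expansion_exp_ser f)
  from arg_cong[OF this, of "\<lambda>F. fps_nth F n"] show ?thesis by (simp add: pser_def field_simps)
qed

lemma TJ_0_eq: "TJ 0 0 \<tau> = T_fun 0 \<tau>" by (simp add: T_fun_eq_TJ)

lemma g_expansion:
  assumes T0: "T_fun 0 \<tau> \<noteq> 0"
  obtains f where "f has_fps_expansion ser (\<lambda>k. g_coeff k \<tau>)" "g_coeff 0 \<tau> = 0"
    "\<forall>\<^sub>F z in nhds 0. T_fun z \<tau> = T_fun 0 \<tau> * exp (- 1 * f z)"
proof -
  have g: "(\<lambda>k. g_coeff k \<tau>) = expansion_coeffs (\<lambda>z. T_fun z \<tau>) (\<lambda>z. T_fun 0 \<tau>) (-1)"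
    by (simp add: g_coeff_def fun_eq_iff)
  obtain f where "f has_fps_expansion ser (\<lambda>k. g_coeff k \<tau>)" "g_coeff 0 \<tau> = 0"
    "\<forall>\<^sub>F z in nhds 0. T_fun z \<tau> / T_fun 0 \<tau> = exp (- 1 * f z)"
  proof (rule expansion_coeffs_exp[of "\<lambda>z. T_fun z \<tau> / T_fun 0 \<tau>" "\<lambda>z. T_fun z \<tau>" "\<lambda>z. T_fun 0 \<tau>" "-1"])
    show "(\<lambda>z. T_fun z \<tau> / T_fun 0 \<tau>) analytic_on {0}"
      using has_fps_expansion_imp_analytic_0[OF TJ_has_fps_expansion[OF \<tau>]] T0
      unfolding T_fun_eq_TJ by (intro analytic_intros) auto
  qed (use T0 in \<open>auto simp: g[symmetric] fun_cong[OF g, symmetric]\<close>)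
  then show ?thesis using that T0 by (auto simp: field_simps elim!: eventually_mono)
qed

lemma TJ_coeff:
  assumes T0: "T_fun 0 \<tau> \<noteq> 0"
  shows "TJ n 0 \<tau> = fact n * T_fun 0 \<tau> * (2 * of_real pi * \<i>) ^ n * pexp (- 1) (\<lambda>k. g_coeff k \<tau>) n"
proof -
  obtain f where f: "f has_fps_expansion ser (\<lambda>k. g_coeff k \<tau>)" "g_coeff 0 \<tau> = 0"
    "\<forall>\<^sub>F z in nhds 0. T_fun z \<tau> = T_fun 0 \<tau> * exp (- 1 * f z)" using g_expansion[OF T0] by blast
  have "Abs_fps (\<lambda>k. TJ k 0 \<tau> / fact k) = fps_const (T_fun 0 \<tau>) * pser (- 1) (\<lambda>k. g_coeff k \<tau>)"
    by (intro has_fps_expansion_eq[OF TJ_has_fps_expansion[OF \<tau>] _ f(3)[unfolded T_fun_eq_TJ[of _ \<tau>], folded TJ_0_eq, unfolded TJ_0_eq]]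
        has_fps_expansion_cmult_left has_fps_expansion_exp_ser f)
  from arg_cong[OF this, of "\<lambda>F. fps_nth F n"] show ?thesis by (simp add: pser_def field_simps)
qed

text \<open>Index 0 is reset because an expansion has no constant term, whereas
  \<open>eisenstein 0\<close> evaluates to the divisor-counting series.\<close>

definition Gc :: "nat \<Rightarrow> complex" where "Gc k = (if k = 0 then 0 else eisenstein k \<tau>)"

abbreviation (input) "q_inf \<equiv> qinf (ee \<tau>) (ee \<tau>)"

lemma q_inf_nonzero: "q_inf \<noteq> 0"
  by (rule qinf_q_nonzero[OF norm_ee_less_1[OF \<tau>]])

lemma G_expansion:
  obtains f where "f has_fps_expansion ser Gc"
    "\<forall>\<^sub>F z in nhds 0. sinc_pi z * qP (ee \<tau>) (ee z) = q_inf\<^sup>2 * exp (- 2 * f z)"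
  using qP_expansion[OF \<tau>] unfolding Gc_def[abs_def] by blast

lemma Gc_0: "Gc 0 = 0" by (simp add: Gc_def)

text \<open>The odd part of T is z times the exponential of the Eisenstein series up to a constant,
  so all odd coefficients are known once that constant is.\<close>

lemma g_odd_coeff:
  assumes T0: "T_fun 0 \<tau> \<noteq> 0" and n: "odd n"
  shows "pexp (- 1) (\<lambda>k. g_coeff k \<tau>) n = - g_coeff 1 \<tau> * pexp (- 2) Gc (n - 1)"
proof -
  obtain f where f: "f has_fps_expansion ser Gc"
    "\<forall>\<^sub>F z in nhds 0. sinc_pi z * qP (ee \<tau>) (ee z) = q_inf\<^sup>2 * exp (- 2 * f z)" using G_expansion by blast
  obtain gf where g: "gf has_fps_expansion ser (\<lambda>k. g_coeff k \<tau>)" "g_coeff 0 \<tau> = 0"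
    "\<forall>\<^sub>F z in nhds 0. T_fun z \<tau> = T_fun 0 \<tau> * exp (- 1 * gf z)" using g_expansion[OF T0] by blast
  define w where "w = 2 * of_real pi * \<i>"
  define c where "c = - 4 * of_real pi * ee (\<tau> / 8) * q_inf ^ 3"
  have ev: "\<forall>\<^sub>F z in nhds 0. T_fun 0 \<tau> * (exp (- 1 * gf z) - exp (- 1 * gf (- z))) = c * (z * exp (- 2 * f z))"
    using f(2) g(3) eventually_nhds_0_scale[OF g(3), of "-1"]
  proof eventually_elim
    case (elim z)
    have "T_fun 0 \<tau> * (exp (- 1 * gf z) - exp (- 1 * gf (- z))) = T_fun z \<tau> - T_fun (- z) \<tau>"
      using elim by (simp add: right_diff_distrib)
    also have "\<dots> = - 4 * of_real pi * ee (\<tau> / 8) * q_inf * z * (sinc_pi z * qP (ee \<tau>) (ee z))"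
      unfolding T_fun_odd_part[OF \<tau>] sin_pi_eq by (simp add: mult_ac)
    also have "\<dots> = c * (z * exp (- 2 * f z))"
      unfolding elim(1) c_def by (simp add: power2_eq_square power3_eq_cube mult_ac)
    finally show ?case .
  qed
  let ?E = "pser (- 1) (\<lambda>k. g_coeff k \<tau>)"
  have E: "(\<lambda>z. exp (- 1 * gf z)) has_fps_expansion ?E"
    by (rule has_fps_expansion_exp_ser[OF g(1,2)])
  have "fps_const (T_fun 0 \<tau>) * (?E - Abs_fps (\<lambda>k. (-1) ^ k * fps_nth ?E k)) = fps_const c * (fps_X * pser (- 2) Gc)"
    by (intro has_fps_expansion_eq[OF _ _ ev] has_fps_expansion_cmult_left has_fps_expansion_diff
        has_fps_expansion_mult has_fps_expansion_fps_X E has_fps_expansion_uminus_arg[OF E]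
        has_fps_expansion_exp_ser[OF f(1) Gc_0])
  from arg_cong[OF this, of "\<lambda>F. fps_nth F (Suc m)" for m]
  have co: "T_fun 0 \<tau> * (w ^ Suc m * pexp (- 1) (\<lambda>k. g_coeff k \<tau>) (Suc m) - (-1) ^ Suc m * (w ^ Suc m * pexp (- 1) (\<lambda>k. g_coeff k \<tau>) (Suc m)))
    = c * (w ^ m * pexp (- 2) Gc m)" for m
    by (simp only: pser_def fps_mult_left_const_nth fps_sub_nth fps_nth_Abs_fps fps_X_mult_nth w_def[symmetric]) simp
  have w: "w \<noteq> 0" by (simp add: w_def)
  \<comment> \<open>The case m = 0 of the relation itself identifies the constant.\<close>
  have "c = - (2 * T_fun 0 \<tau> * w * g_coeff 1 \<tau>)"
    using co[of 0, symmetric] by (simp add: pexp_0 pexp_1 mult_ac)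
  moreover obtain m where m: "n = Suc m" "even m" using n by (cases n) auto
  ultimately have "(T_fun 0 \<tau> * 2 * w ^ Suc m) * pexp (- 1) (\<lambda>k. g_coeff k \<tau>) (Suc m)
      = (T_fun 0 \<tau> * 2 * w ^ Suc m) * (- g_coeff 1 \<tau> * pexp (- 2) Gc m)"
    using co[of m] by (simp add: mult_ac)
  then have "pexp (- 1) (\<lambda>k. g_coeff k \<tau>) (Suc m) = - g_coeff 1 \<tau> * pexp (- 2) Gc m"
    by (rule mult_left_cancel[THEN iffD1, rotated]) (use T0 w in simp)
  then show ?thesis using m by simp
qed

lemma qP_nonzero_near: "\<forall>\<^sub>F z in nhds 0. qP (ee \<tau>) (ee z) \<noteq> 0"
proof -
  obtain f where f: "f has_fps_expansion ser Gc"
    "\<forall>\<^sub>F z in nhds 0. sinc_pi z * qP (ee \<tau>) (ee z) = q_inf\<^sup>2 * exp (- 2 * f z)" using G_expansion by blast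
  from f(2) show ?thesis
    by eventually_elim (use q_inf_nonzero in \<open>metis exp_not_eq_zero mult_eq_0_iff power_eq_0_iff\<close>)
qed

lemma U_eq:
  assumes "qP (ee \<tau>) (ee z) \<noteq> 0"
  shows "U_fun (ee z) (ee \<tau>) = - 2 * \<i> * sin (of_real pi * z) * ee (- \<tau> / 24) * SJ 0 z \<tau>
    + T_fun (2 * z) \<tau> / (2 * \<i> * ee (\<tau> / 8) * qP (ee \<tau>) (ee z))"
proof -
  have "(1 - ee z) * qH (ee \<tau>) (ee z) = h_fun (ee z) (ee \<tau>)"
    unfolding h_fun_def qH_def[OF norm_ee_less_1[OF \<tau>]] ..
  then show ?thesis
    using U_fun_eq[OF norm_ee_less_1[OF \<tau>] ee_nonzero ee_nonzero assms]
    by (simp add: h_fun_eq_SJ[OF \<tau>] T_fun_double[OF \<tau>])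
qed

lemma U_fun_minus: "U_fun (ee (- z)) (ee \<tau>) = U_fun (ee z) (ee \<tau>)"
  unfolding U_fun_def ee_minus by (simp add: mult.commute)

text \<open>In U(zeta) - U(1 / zeta) = 0 the odd sine turns the h-part into a sum over z and - z,
  and the other part is the odd part of T at 2 z. The quotient of theta products at 2 z and z
  contributes - 2 G(2 x) + 2 G(x), whence the weights 2 - 2^(k+1).\<close>

lemma h_even_coeff:
  assumes n: "even n"
  shows "pexp (- 1) (\<lambda>k. h_coeff k \<tau>) n = pexp 1 (\<lambda>k. (2 - 2 ^ Suc k) * Gc k) n"
proof -
  obtain f where f: "f has_fps_expansion ser Gc"
    "\<forall>\<^sub>F z in nhds 0. sinc_pi z * qP (ee \<tau>) (ee z) = q_inf\<^sup>2 * exp (- 2 * f z)" using G_expansion by blast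
  obtain hf where h: "hf has_fps_expansion ser (\<lambda>k. h_coeff k \<tau>)" "h_coeff 0 \<tau> = 0"
    "\<forall>\<^sub>F z in nhds 0. SJ 0 z \<tau> = eta \<tau> * exp (- 1 * hf z)" using h_expansion by blast
  have "\<forall>\<^sub>F z in at 0. exp (- 1 * hf z) + exp (- 1 * hf (- z)) = 2 * exp (1 * (2 * f z + - 2 * f (2 * z)))"
  proof -
    have "\<forall>\<^sub>F z in at 0. (qP (ee \<tau>) (ee z) \<noteq> 0 \<and> qP (ee \<tau>) (ee (- 1 * z)) \<noteq> 0 \<and> SJ 0 z \<tau> = eta \<tau> * exp (- 1 * hf z) \<and>
        SJ 0 (- 1 * z) \<tau> = eta \<tau> * exp (- 1 * hf (- 1 * z)) \<and> sinc_pi z * qP (ee \<tau>) (ee z) = q_inf\<^sup>2 * exp (- 2 * f z) \<and>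
        sinc_pi (2 * z) * qP (ee \<tau>) (ee (2 * z)) = q_inf\<^sup>2 * exp (- 2 * f (2 * z)) \<and> sinc_pi z \<noteq> 0) \<and> z \<noteq> 0"
      by (intro eventually_at_0_of_nhds eventually_conj qP_nonzero_near eventually_nhds_0_scale[OF qP_nonzero_near]
          h(3) eventually_nhds_0_scale[OF h(3)] f(2) eventually_nhds_0_scale[OF f(2)] eventually_sinc_pi_nonzero)
    then show ?thesis
    proof eventually_elim
      case (elim z)
      define P where "P = qP (ee \<tau>) (ee z)"
      define P2 where "P2 = qP (ee \<tau>) (ee (2 * z))"
      define e8 where "e8 = ee (\<tau> / 8)"
      define e24 where "e24 = ee (- \<tau> / 24)"
      have nz: "P \<noteq> 0" "sinc_pi z \<noteq> 0" "z \<noteq> 0" "e8 \<noteq> 0" using elim by (auto simp: P_def e8_def)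
      have Pm: "qP (ee \<tau>) (ee (- z)) = P"
        unfolding ee_minus P_def by (rule qP_inverse[OF norm_ee_less_1[OF \<tau>]])
      have e24: "e24 * eta \<tau> = q_inf"
        unfolding e24_def eta_eq by (simp add: mult.assoc[symmetric] ee_add[symmetric]) (simp add: ee_def)
      have "U_fun (ee z) (ee \<tau>) - U_fun (ee (- z)) (ee \<tau>) = - 2 * \<i> * sin (of_real pi * z) * e24 * (SJ 0 z \<tau> + SJ 0 (- z) \<tau>)
        + (T_fun (2 * z) \<tau> - T_fun (- (2 * z)) \<tau>) / (2 * \<i> * e8 * P)"
        using U_eq[of z, folded P_def e8_def e24_def, OF nz(1)] U_eq[of "- z", unfolded Pm, folded e8_def e24_def, OF nz(1)]
        by (simp add: algebra_simps diff_divide_distrib)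
      also have "T_fun (2 * z) \<tau> - T_fun (- (2 * z)) \<tau> = - 4 * e8 * q_inf * sin (of_real pi * (2 * z)) * P2"
        unfolding T_fun_odd_part[OF \<tau>] P2_def e8_def ..
      also have "SJ 0 z \<tau> + SJ 0 (- z) \<tau> = eta \<tau> * (exp (- hf z) + exp (- hf (- z)))"
        using elim by (simp add: distrib_left)
      finally have "0 = - 2 * \<i> * sin (of_real pi * z) * (e24 * eta \<tau>) * (exp (- hf z) + exp (- hf (- z)))
         + - 4 * e8 * q_inf * sin (of_real pi * (2 * z)) * P2 / (2 * \<i> * e8 * P)"
        by (simp add: U_fun_minus mult_ac)
      then have "2 * \<i> * (of_real pi * z * sinc_pi z) * q_inf * (exp (- hf z) + exp (- hf (- z))) =
         - 4 * e8 * q_inf * (of_real pi * (2 * z) * sinc_pi (2 * z)) * P2 / (2 * \<i> * e8 * P)"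
        unfolding sin_pi_eq e24 by (simp add: algebra_simps eq_neg_iff_add_eq_0)
      also have "\<dots> = 2 * \<i> * (of_real pi * z) * q_inf * (2 * (sinc_pi (2 * z) * P2) / P)"
        using nz by (simp add: field_simps)
      finally have "(2 * \<i> * (of_real pi * z) * q_inf) * (sinc_pi z * (exp (- hf z) + exp (- hf (- z))))
        = (2 * \<i> * (of_real pi * z) * q_inf) * (2 * (sinc_pi (2 * z) * P2) / P)"
        by (simp only: mult_ac)
      then have "sinc_pi z * (exp (- hf z) + exp (- hf (- z))) = 2 * (sinc_pi (2 * z) * P2) / P"
        by (rule mult_left_cancel[THEN iffD1, rotated]) (use nz q_inf_nonzero in simp)
      then have "(sinc_pi z * P) * (exp (- hf z) + exp (- hf (- z))) = 2 * (sinc_pi (2 * z) * P2)"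
        using nz by (simp add: field_simps)
      then have "q_inf\<^sup>2 * exp (- 2 * f z) * (exp (- hf z) + exp (- hf (- z))) = 2 * (q_inf\<^sup>2 * exp (- 2 * f (2 * z)))"
        using elim unfolding P_def P2_def by simp
      then have "exp (- 2 * f z) * (exp (- hf z) + exp (- hf (- z))) = 2 * exp (- 2 * f (2 * z))"
        using q_inf_nonzero by simp
      then have "(exp (2 * f z) * exp (- 2 * f z)) * (exp (- hf z) + exp (- hf (- z))) = 2 * (exp (2 * f z) * exp (- 2 * f (2 * z)))"
        by (simp only: mult_ac)
      then show ?case by (simp add: mult_exp_exp)
    qed
  qed
  moreover have "hf 0 = 0" "f 0 = 0" using ser_expansion_at_0[OF h(1,2)] ser_expansion_at_0[OF f(1) Gc_0] by auto
  ultimately have ev: "\<forall>\<^sub>F z in nhds 0. exp (- 1 * hf z) + exp (- 1 * hf (- z)) = 2 * exp (1 * (2 * f z + - 2 * f (2 * z)))"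
    by (simp add: eventually_nhds_conv_at)
  let ?E = "pser (- 1) (\<lambda>k. h_coeff k \<tau>)"
  have E: "(\<lambda>z. exp (- 1 * hf z)) has_fps_expansion ?E"
    by (rule has_fps_expansion_exp_ser[OF h(1,2)])
  have "fps_const 2 * ser Gc + fps_const (- 2) * Abs_fps (\<lambda>k. 2 ^ k * fps_nth (ser Gc) k) = ser (\<lambda>k. (2 - 2 ^ Suc k) * Gc k)"
    by (simp add: fps_eq_iff ser_def diff_divide_distrib left_diff_distrib mult.assoc)
  moreover have "(\<lambda>z. 2 * f z + - 2 * f (2 * z)) has_fps_expansion (fps_const 2 * ser Gc + fps_const (- 2) * Abs_fps (\<lambda>k. 2 ^ k * fps_nth (ser Gc) k))"
    by (intro has_fps_expansion_add has_fps_expansion_cmult_left f(1) has_fps_expansion_scale)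
  ultimately have F: "(\<lambda>z. 2 * f z + - 2 * f (2 * z)) has_fps_expansion ser (\<lambda>k. (2 - 2 ^ Suc k) * Gc k)"
    by (simp only:)
  have "?E + Abs_fps (\<lambda>k. (-1) ^ k * fps_nth ?E k) = fps_const 2 * pser 1 (\<lambda>k. (2 - 2 ^ Suc k) * Gc k)"
    by (intro has_fps_expansion_eq[OF _ _ ev] has_fps_expansion_add has_fps_expansion_cmult_left E
      has_fps_expansion_uminus_arg[OF E] has_fps_expansion_exp_ser[OF F]) (simp add: Gc_0)
  from arg_cong[OF this, of "\<lambda>F. fps_nth F n"]
  have "2 * ((2 * of_real pi * \<i>) ^ n * pexp (- 1) (\<lambda>k. h_coeff k \<tau>) n) = 2 * ((2 * of_real pi * \<i>) ^ n * pexp 1 (\<lambda>k. (2 - 2 ^ Suc k) * Gc k) n)"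
    using n by (simp add: pser_def)
  then show ?thesis by simp
qed


theorem u_coeff_relation:
  assumes T0: "T_fun 0 \<tau> \<noteq> 0" and n: "n \<ge> 1"
  shows "pexp 2 (\<lambda>k. u_coeff k \<tau>) n = pexp 2 (\<lambda>k. gamma_coeff k \<tau>) n
    + 2 * g_coeff 1 \<tau> * pexp (- 1) (\<lambda>k. h_coeff k \<tau>) (n - 1)"
proof -
  obtain f where f: "f has_fps_expansion ser Gc"
    "\<forall>\<^sub>F z in nhds 0. sinc_pi z * qP (ee \<tau>) (ee z) = q_inf\<^sup>2 * exp (- 2 * f z)" using G_expansion by blast
  obtain gf where g: "gf has_fps_expansion ser (\<lambda>k. g_coeff k \<tau>)" "g_coeff 0 \<tau> = 0"
    "\<forall>\<^sub>F z in nhds 0. T_fun z \<tau> = T_fun 0 \<tau> * exp (- 1 * gf z)" using g_expansion[OF T0] by blast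
  obtain hf where h: "hf has_fps_expansion ser (\<lambda>k. h_coeff k \<tau>)" "h_coeff 0 \<tau> = 0"
    "\<forall>\<^sub>F z in nhds 0. SJ 0 z \<tau> = eta \<tau> * exp (- 1 * hf z)" using h_expansion by blast
  define w where "w = 2 * of_real pi * \<i>"
  have w: "w \<noteq> 0" by (simp add: w_def)
  define e8 where "e8 = ee (\<tau> / 8)"
  define e24 where "e24 = ee (- \<tau> / 24)"
  have e8: "e8 \<noteq> 0" by (simp add: e8_def)
  have e24: "e24 * eta \<tau> = q_inf"
    unfolding e24_def eta_eq by (simp add: mult.assoc[symmetric] ee_add[symmetric]) (simp add: ee_def)
  \<comment> \<open>The value U(1; q), where the h-part drops out because of the sine. It vanishes
    exactly with \<open>T_fun 0 \<tau>\<close>.\<close>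
  define U1 where "U1 = T_fun 0 \<tau> / (2 * \<i> * e8 * q_inf\<^sup>2)"
  have U1: "U1 \<noteq> 0" using T0 e8 q_inf_nonzero by (simp add: U1_def)
  have ee0: "ee 0 = 1" by (simp add: ee_def)
  have qP1: "qP (ee \<tau>) 1 = q_inf\<^sup>2"
    by (simp add: qP_def[OF norm_ee_less_1[OF \<tau>]] power2_eq_square)
  have U_1: "U_fun 1 (ee \<tau>) = U1"
    using U_eq[of 0] q_inf_nonzero by (simp add: ee0 qP1 U1_def e8_def)
  define K where "K = q_inf / U1"
  \<comment> \<open>Agrees with \<open>gamma_coeff\<close> for k >= 1; written with 2^k / 2 and
    \<open>Gc\<close> so that it vanishes at k = 0 as an exponent must.\<close>
  define \<gamma> where "\<gamma> = (\<lambda>k. Gc k + (- 1 / 2) * (2 ^ k * g_coeff k \<tau>))"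
  have \<gamma>0: "\<gamma> 0 = 0" by (simp add: \<gamma>_def Gc_0 g(2))
  define v where "v = (\<lambda>z. f z + (- 1 / 2) * gf (2 * z))"
  have "(\<lambda>z. f z + (- 1 / 2) * gf (2 * z)) has_fps_expansion
     (ser Gc + fps_const (- 1 / 2) * Abs_fps (\<lambda>k. 2 ^ k * fps_nth (ser (\<lambda>k. g_coeff k \<tau>)) k))"
    by (intro has_fps_expansion_add has_fps_expansion_cmult_left f(1) g(1) has_fps_expansion_scale)
  also have "ser Gc + fps_const (- 1 / 2) * Abs_fps (\<lambda>k. 2 ^ k * fps_nth (ser (\<lambda>k. g_coeff k \<tau>)) k) = ser \<gamma>"
    by (simp add: fps_eq_iff ser_def \<gamma>_def diff_divide_distrib left_diff_distrib)
  finally have v: "v has_fps_expansion ser \<gamma>" by (simp only: v_def)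
  define G where "G = (\<lambda>z. exp (2 * v z) - K * (w * z) * exp (- 1 * hf z))"
  have G: "G has_fps_expansion (pser 2 \<gamma> - fps_const K * (fps_const w * fps_X) * pser (- 1) (\<lambda>k. h_coeff k \<tau>))"
    unfolding G_def by (intro fps_expansion_intros has_fps_expansion_exp_ser v \<gamma>0 h)
  have v0: "v 0 = 0" by (rule ser_expansion_at_0[OF v \<gamma>0])
  define A where "A = (\<lambda>z. sin (of_real pi * z) / (of_real pi * z) * U_fun 1 (ee \<tau>))"
  have A: "A z = sinc_pi z * U1" if "z \<noteq> 0" for z
    using that by (simp add: A_def sinc_pi_def U_1)
  have UG: "\<forall>\<^sub>F z in at 0. U_fun (ee z) (ee \<tau>) = A z * G z"
  proof -
    have "\<forall>\<^sub>F z in at 0. (qP (ee \<tau>) (ee z) \<noteq> 0 \<and> SJ 0 z \<tau> = eta \<tau> * exp (- 1 * hf z) \<and>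
        T_fun (2 * z) \<tau> = T_fun 0 \<tau> * exp (- 1 * gf (2 * z)) \<and> sinc_pi z * qP (ee \<tau>) (ee z) = q_inf\<^sup>2 * exp (- 2 * f z) \<and>
        sinc_pi z \<noteq> 0) \<and> z \<noteq> 0"
      by (intro eventually_at_0_of_nhds eventually_conj qP_nonzero_near h(3) f(2)
          eventually_nhds_0_scale[OF g(3)] eventually_sinc_pi_nonzero)
    then show ?thesis
    proof eventually_elim
      case (elim z)
      define P where "P = qP (ee \<tau>) (ee z)"
      have nz: "P \<noteq> 0" "sinc_pi z \<noteq> 0" "z \<noteq> 0" using elim by (auto simp: P_def)
      have invP: "1 / P = sinc_pi z * exp (2 * f z) / q_inf\<^sup>2"
      proof -
        have "sinc_pi z * P * exp (2 * f z) = q_inf\<^sup>2 * (exp (- 2 * f z) * exp (2 * f z))"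
          using elim by (simp add: P_def)
        then have "sinc_pi z * P * exp (2 * f z) = q_inf\<^sup>2" by (simp add: mult_exp_exp)
        then show ?thesis using nz q_inf_nonzero by (simp add: field_simps)
      qed
      have "U_fun (ee z) (ee \<tau>) = - 2 * \<i> * sin (of_real pi * z) * e24 * SJ 0 z \<tau> + T_fun (2 * z) \<tau> / (2 * \<i> * e8 * P)"
        by (rule U_eq[of z, folded P_def e8_def e24_def, OF nz(1)])
      also have "- 2 * \<i> * sin (of_real pi * z) * e24 * SJ 0 z \<tau> = - (w * z * sinc_pi z * (e24 * eta \<tau>) * exp (- 1 * hf z))"
        unfolding sin_pi_eq w_def using elim by simp
      also have "\<dots> = - (sinc_pi z * U1 * (K * (w * z) * exp (- 1 * hf z)))"
        unfolding e24 K_def using U1 by simp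
      also have "T_fun (2 * z) \<tau> / (2 * \<i> * e8 * P) = T_fun 0 \<tau> * exp (- 1 * gf (2 * z)) / (2 * \<i> * e8) * (1 / P)"
        using elim by simp
      also have "\<dots> = sinc_pi z * U1 * (exp (2 * f z) * exp (- 1 * gf (2 * z)))"
        unfolding invP U1_def by simp
      also have "exp (2 * f z) * exp (- 1 * gf (2 * z)) = exp (2 * v z)"
        unfolding mult_exp_exp v_def by (simp add: algebra_simps)
      finally show ?case using A[OF nz(3)] by (simp add: G_def algebra_simps)
    qed
  qed
  have u: "(\<lambda>k. u_coeff k \<tau>) = expansion_coeffs (\<lambda>z. U_fun (ee z) (ee \<tau>)) A 2"
    by (simp add: u_coeff_def A_def fun_eq_iff)
  obtain uf where uf: "uf has_fps_expansion ser (\<lambda>k. u_coeff k \<tau>)" "u_coeff 0 \<tau> = 0"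
    "\<forall>\<^sub>F z in nhds 0. G z = exp (2 * uf z)"
  proof (rule expansion_coeffs_exp[of G "\<lambda>z. U_fun (ee z) (ee \<tau>)" A 2])
    show "G analytic_on {0}" by (rule has_fps_expansion_imp_analytic_0[OF G])
    show "G 0 = 1" by (simp add: G_def v0)
    show "\<forall>\<^sub>F z in at 0. A z \<noteq> 0"
      using eventually_at_0_of_nhds[OF eventually_sinc_pi_nonzero] U1
      by (auto simp: A elim!: eventually_mono)
  qed (use UG in \<open>auto simp: u[symmetric] fun_cong[OF u, symmetric]\<close>)
  have "fps_const K * (fps_const w * fps_X) * pser (- 1) (\<lambda>k. h_coeff k \<tau>) = fps_const (K * w) * (fps_X * pser (- 1) (\<lambda>k. h_coeff k \<tau>))"
    by (simp only: fps_const_mult[symmetric] mult.assoc)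
  moreover have "pser 2 \<gamma> - fps_const K * (fps_const w * fps_X) * pser (- 1) (\<lambda>k. h_coeff k \<tau>) = pser 2 (\<lambda>k. u_coeff k \<tau>)"
    by (rule has_fps_expansion_eq[OF G has_fps_expansion_exp_ser[OF uf(1,2)] uf(3)])
  ultimately have "pser 2 \<gamma> - fps_const (K * w) * (fps_X * pser (- 1) (\<lambda>k. h_coeff k \<tau>)) = pser 2 (\<lambda>k. u_coeff k \<tau>)"
    by (simp only:)
  from arg_cong[OF this, of "\<lambda>F. fps_nth F (Suc m)" for m]
  have "w ^ Suc m * pexp 2 \<gamma> (Suc m) - K * w * (w ^ m * pexp (- 1) (\<lambda>k. h_coeff k \<tau>) m) = w ^ Suc m * pexp 2 (\<lambda>k. u_coeff k \<tau>) (Suc m)" for m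
    by (simp only: pser_def fps_mult_left_const_nth fps_sub_nth fps_nth_Abs_fps fps_X_mult_nth w_def[symmetric]) simp
  then have "w ^ Suc m * (pexp 2 \<gamma> (Suc m) - K * pexp (- 1) (\<lambda>k. h_coeff k \<tau>) m) = w ^ Suc m * pexp 2 (\<lambda>k. u_coeff k \<tau>) (Suc m)" for m
    by (simp add: algebra_simps)
  then have rel: "pexp 2 \<gamma> (Suc m) - K * pexp (- 1) (\<lambda>k. h_coeff k \<tau>) m = pexp 2 (\<lambda>k. u_coeff k \<tau>) (Suc m)" for m
    using w by simp
  have "\<forall>\<^sub>F z in at 0. G (- z) = G z"
  proof -
    have "\<forall>\<^sub>F z in at 0. U_fun (ee (- z)) (ee \<tau>) = A (- z) * G (- z)"
    proof -
      have "filtermap uminus (at (0::complex)) = at 0"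
        using filtermap_at_minus[of "0::complex"] by simp
      then have "eventually (\<lambda>z. U_fun (ee z) (ee \<tau>) = A z * G z) (filtermap uminus (at 0))"
        using UG by (simp only:)
      then show ?thesis by (simp only: eventually_filtermap)
    qed
    moreover have "\<forall>\<^sub>F z in at 0. sinc_pi z \<noteq> 0 \<and> z \<noteq> 0"
      using eventually_at_0_of_nhds[OF eventually_sinc_pi_nonzero] .
    ultimately show ?thesis using UG
    proof eventually_elim
      case (elim z)
      then have "sinc_pi z * U1 * G (- z) = sinc_pi z * U1 * G z"
        using A[of z] A[of "- z"] by (auto simp: U_fun_minus sinc_pi_minus)
      then show ?case using elim U1 by simp
    qed
  qed
  then have "\<forall>\<^sub>F z in nhds 0. G (- z) = G z" by (simp add: eventually_nhds_conv_at)
  then have "\<forall>\<^sub>F z in nhds 0. exp (2 * uf (- z)) = exp (2 * uf z)"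
    using uf(3) eventually_nhds_0_scale[OF uf(3), of "- 1"] by eventually_elim simp
  from has_fps_expansion_eq[OF has_fps_expansion_uminus_arg[OF has_fps_expansion_exp_ser[OF uf(1,2)]] has_fps_expansion_exp_ser[OF uf(1,2)] this]
  have "fps_nth (Abs_fps (\<lambda>k. (-1) ^ k * fps_nth (pser 2 (\<lambda>k. u_coeff k \<tau>)) k)) 1 = fps_nth (pser 2 (\<lambda>k. u_coeff k \<tau>)) 1"
    by simp
  then have "pexp 2 (\<lambda>k. u_coeff k \<tau>) (Suc 0) = 0" by (simp add: pser_def)
  then have "2 * \<gamma> 1 - K = 0" using rel[of 0] by (simp add: pexp_0 pexp_1)
  \<comment> \<open>Here the convention that \<open>eisenstein\<close> is 0 at odd index
    enters.\<close>
  moreover have "\<gamma> 1 = - g_coeff 1 \<tau>" by (simp add: \<gamma>_def Gc_def eisenstein_def)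
  ultimately have K: "K = - 2 * g_coeff 1 \<tau>" by simp
  obtain m where m: "n = Suc m" using n by (cases n) auto
  have "pexp 2 \<gamma> n = pexp 2 (\<lambda>k. gamma_coeff k \<tau>) n"
  proof (rule pexp_cong)
    fix j assume "j \<in> {1..n}"
    then obtain i where "j = Suc i" by (cases j) auto
    then show "\<gamma> j = gamma_coeff j \<tau>" by (simp add: \<gamma>_def gamma_coeff_def Gc_def)
  qed
  then show ?thesis using rel[of m] unfolding K m by simp
qed

end

section \<open>Membership and closure under differentiation\<close>

text \<open>By the identity theorem on the connected set \<open>\<H>\<close> one nonzero value
  suffices. At \<open>\<i>\<close> one has |q| = exp (- 2 pi) < 1/2, so the terms after the leading
  1 sum to less than 1 in norm.\<close>

lemma T_fun_0_nonzero: "\<forall>\<^sub>\<approx>\<tau>\<in>\<H>. T_fun 0 \<tau> \<noteq> 0"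
proof -
  have i: "\<i> \<in> \<H>" by (simp add: upper_half_plane_def)
  define q where "q = ee \<i>"
  have nq: "norm q < 1 / 2"
  proof -
    have "2 < exp (2 * pi)"
      using exp_ge_add_one_self[of "2 * pi"] pi_gt3 by linarith
    then show ?thesis by (simp add: q_def norm_ee exp_minus field_simps)
  qed
  then have q1: "norm q < 1" by simp
  have s: "(\<lambda>n. (-1) ^ n * 1 ^ (2 * n + 1) * q ^ (n * (n + 1) div 2)) sums qC q 1"
    by (rule qC_sums[OF q1])
  then have s': "(\<lambda>n. (-1) ^ Suc n * q ^ tri (Suc n)) sums (qC q 1 - 1)"
    by (subst sums_Suc_iff) (simp add: tri_def)
  have "norm (qC q 1 - 1) \<le> (\<Sum>n. norm q ^ Suc n)"
    unfolding sums_unique[OF s']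
  proof (rule norm_suminf_le)
    show "norm ((-1) ^ Suc n * q ^ tri (Suc n)) \<le> norm q ^ Suc n" for n
      using q1 tri_double[of "Suc n"] unfolding norm_mult norm_power by (simp del: power_Suc) (intro power_decreasing, auto)
    show "summable (\<lambda>n. norm q ^ Suc n)" using q1 by (intro summable_Suc_iff[THEN iffD2] summable_geometric) simp
  qed
  also have "\<dots> = norm q / (1 - norm q)"
    using q1 by (simp add: suminf_mult summable_geometric suminf_geometric)
  also have "\<dots> < 1" using nq by (simp add: field_simps)
  finally have "qC q 1 \<noteq> 0" by auto
  then have "T_fun 0 \<i> \<noteq> 0"
    using T_fun_double[OF i, of 0] by (simp add: q_def) (simp add: ee_def)
  moreover have "(\<lambda>\<tau>. T_fun 0 \<tau>) holomorphic_on \<H>"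
    unfolding T_fun_eq_TJ using TJ_deriv by (auto simp: holomorphic_on_open[OF open_\<H>])
  moreover have "connected \<H>"
    unfolding upper_half_plane_def by (intro convex_connected convex_halfspace_Im_gt)
  ultimately have "\<forall>\<^sub>F y in at x. T_fun 0 y \<noteq> 0 \<and> y \<in> \<H>" if "x \<in> \<H>" for x
    using non_zero_neighbour_alt[OF _ open_\<H> _ that i] by blast
  then show ?thesis
    unfolding eventually_cosparse_open_eq[OF open_\<H>] by (metis (mono_tags, lifting) eventually_mono)
qed

lemma eventually_in_\<H>: "\<forall>\<^sub>\<approx>\<tau>\<in>\<H>. \<tau> \<in> \<H>"
  unfolding eventually_cosparse_open_eq[OF open_\<H>] using eventually_at_in_open'[OF open_\<H>] by auto

lemma mero_eqI_T_fun_nonzero: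
  assumes "\<And>\<tau>. \<tau> \<in> \<H> \<Longrightarrow> T_fun 0 \<tau> \<noteq> 0 \<Longrightarrow> f \<tau> = g \<tau>"
  shows "f \<simeq> g"
  unfolding mero_eq_def using T_fun_0_nonzero eventually_in_\<H>
  by eventually_elim (use assms in auto)

text \<open>If \<open>F 0 * exp (- \<Sum>a k * x ^ k / k!)\<close> solves a heat equation, then its Taylor coefficients,
  normalised by \<open>F 0\<close>, are polynomials in the \<open>a k\<close> and their derivatives are again such
  polynomials. As conversely each \<open>a k\<close> is a polynomial in the normalised coefficients, the algebra
  containing the \<open>a k\<close> contains their derivatives.\<close>

lemma heat_diff_closed:
  fixes F a :: "nat \<Rightarrow> complex \<Rightarrow> complex"
  assumes A: "function_algebra A" and a: "\<And>k. k \<ge> 1 \<Longrightarrow> a k \<in> A"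
    and der: "\<And>k \<tau>. \<tau> \<in> \<H> \<Longrightarrow> (F k has_field_derivative \<kappa> / (2 * of_real pi * \<i>) * F (Suc (Suc k)) \<tau>) (at \<tau>)"
    and nz: "\<forall>\<^sub>\<approx>\<tau>\<in>\<H>. F 0 \<tau> \<noteq> 0"
    and co: "\<forall>\<^sub>\<approx>\<tau>\<in>\<H>. \<forall>n. F n \<tau> = fact n * F 0 \<tau> * (2 * of_real pi * \<i>) ^ n * pexp (- 1) (\<lambda>k. a k \<tau>) n"
    and "k \<ge> 1"
  shows "a k \<in> diff_closed A"
proof -
  define w where "w = 2 * of_real pi * \<i>"
  have w: "w \<noteq> 0" by (simp add: w_def)
  define e where "e = (\<lambda>n \<tau>. pexp (- 1) (\<lambda>k. a k \<tau>) n)"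
  \<comment> \<open>\<open>e\<close> is visibly in \<open>A\<close>, and \<open>E\<close> is visibly
    analytic with a computable derivative. They agree only almost everywhere, so membership in
    \<open>diff_closed A\<close> is shown for \<open>E\<close> and carried over to \<open>e\<close>
    along \<open>\<simeq>\<close>.\<close>
  define E where "E = (\<lambda>n \<tau>. F n \<tau> / F 0 \<tau> / (fact n * w ^ n))"
  have eA: "e n \<in> A" for n
    unfolding e_def using a by (intro fa_pexp[OF A]) auto
  have Ee: "\<forall>\<^sub>\<approx>\<tau>\<in>\<H>. E n \<tau> = e n \<tau>" for n
    using nz co
  proof eventually_elim
    case (elim \<tau>)
    have Fn: "F n \<tau> = fact n * F 0 \<tau> * w ^ n * e n \<tau>"
      using elim(2) unfolding w_def e_def by blast
    show ?case unfolding E_def Fn using elim(1) w by simp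
  qed
  then have Ee': "E n \<simeq> e n" for n by (simp add: mero_eq_def)
  have an: "F n analytic_on {\<tau>}" if "\<tau> \<in> \<H>" for n \<tau>
  proof -
    have "F n holomorphic_on \<H>" using der by (auto simp: holomorphic_on_open[OF open_\<H>])
    then show ?thesis using that analytic_on_holomorphic open_\<H> by blast
  qed
  have "\<forall>\<^sub>\<approx>\<tau>\<in>\<H>. E n analytic_on {\<tau>}" for n
    using nz eventually_in_\<H>
  proof eventually_elim
    case (elim \<tau>)
    then show ?case unfolding E_def using w by (intro analytic_intros an) auto
  qed
  moreover have "q_deriv (E n) \<in> A" for n
  proof -
    \<comment> \<open>Quotient rule with both derivatives replaced by means of the heat equation.
      The factors (n + 2) (n + 1) and 2 are the quotients of the factorials that normalise
      \<open>E\<close>.\<close>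
    have "\<forall>\<^sub>\<approx>\<tau>\<in>\<H>. \<kappa> * (of_nat (Suc (Suc n) * Suc n) * e (Suc (Suc n)) \<tau> - 2 * (e n \<tau> * e 2 \<tau>)) = q_deriv (E n) \<tau>"
      using nz eventually_in_\<H> Ee[of n] Ee[of 2] Ee[of "Suc (Suc n)"]
    proof eventually_elim
      case (elim \<tau>)
      have "((\<lambda>\<tau>. F n \<tau> / F 0 \<tau>) has_field_derivative
         (\<kappa> / w * F (Suc (Suc n)) \<tau> * F 0 \<tau> - F n \<tau> * (\<kappa> / w * F (Suc (Suc 0)) \<tau>)) / (F 0 \<tau> * F 0 \<tau>)) (at \<tau>)"
        using elim by (intro DERIV_divide der[folded w_def]) auto
      then have "(E n has_field_derivative
         (\<kappa> / w * F (Suc (Suc n)) \<tau> * F 0 \<tau> - F n \<tau> * (\<kappa> / w * F (Suc (Suc 0)) \<tau>)) / (F 0 \<tau> * F 0 \<tau>) / (fact n * w ^ n)) (at \<tau>)"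
        unfolding E_def by (rule DERIV_cdivide)
      then have "q_deriv (E n) \<tau> = (\<kappa> / w * F (Suc (Suc n)) \<tau> * F 0 \<tau> - F n \<tau> * (\<kappa> / w * F 2 \<tau>)) / (F 0 \<tau> * F 0 \<tau>) / (fact n * w ^ n) / w"
        unfolding q_deriv_def w_def by (simp add: DERIV_imp_deriv numeral_2_eq_2)
      also have "\<dots> = \<kappa> * (of_nat (Suc (Suc n) * Suc n) * E (Suc (Suc n)) \<tau> - 2 * (E n \<tau> * E 2 \<tau>))"
      proof -
        have X: "of_nat (Suc (Suc n) * Suc n) * E (Suc (Suc n)) \<tau> = F (Suc (Suc n)) \<tau> / F 0 \<tau> / (fact n * w ^ n) / w\<^sup>2"
        proof -
          have "fact (Suc (Suc n)) = of_nat (Suc (Suc n) * Suc n) * (fact n :: complex)"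
            by (simp add: algebra_simps)
          moreover have "(of_nat (Suc (Suc n) * Suc n) :: complex) \<noteq> 0"
            unfolding of_nat_eq_0_iff by simp
          ultimately show ?thesis
            unfolding E_def by (simp add: power2_eq_square field_simps del: of_nat_mult of_nat_Suc fact_Suc)
        qed
        have Y: "2 * E 2 \<tau> = F 2 \<tau> / F 0 \<tau> / w\<^sup>2" by (simp add: E_def fact_2)
        have "\<kappa> * (of_nat (Suc (Suc n) * Suc n) * E (Suc (Suc n)) \<tau> - 2 * (E n \<tau> * E 2 \<tau>))
          = \<kappa> * (of_nat (Suc (Suc n) * Suc n) * E (Suc (Suc n)) \<tau> - E n \<tau> * (2 * E 2 \<tau>))" by simp
        also have "\<dots> = \<kappa> * (F (Suc (Suc n)) \<tau> / F 0 \<tau> / (fact n * w ^ n) / w\<^sup>2 - F n \<tau> / F 0 \<tau> / (fact n * w ^ n) * (F 2 \<tau> / F 0 \<tau> / w\<^sup>2))"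
          unfolding X Y by (simp add: E_def)
        also have "\<dots> = (\<kappa> / w * F (Suc (Suc n)) \<tau> * F 0 \<tau> - F n \<tau> * (\<kappa> / w * F 2 \<tau>)) / (F 0 \<tau> * F 0 \<tau>) / (fact n * w ^ n) / w"
          using elim w by (simp add: field_simps power2_eq_square)
        finally show ?thesis ..
      qed
      finally show ?case using elim by simp
    qed
    moreover have "(\<lambda>\<tau>. \<kappa> * (of_nat (Suc (Suc n) * Suc n) * e (Suc (Suc n)) \<tau> - 2 * (e n \<tau> * e 2 \<tau>))) \<in> A"
      by (intro fa_cmult[OF A] fa_diff[OF A] fa_mult[OF A] eA)
    ultimately show ?thesis using fa_cong[OF A] by (simp add: mero_eq_def)
  qed
  moreover have "E n \<in> A" for n using fa_cong[OF A eA mero_eq_sym[OF Ee']] .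
  ultimately have "E n \<in> diff_closed A" for n by (simp add: diff_closed_def)
  then have e_closed: "e n \<in> diff_closed A" for n
    using fa_cong[OF function_algebra_diff_closed[OF A] _ Ee'] by blast
  show ?thesis using \<open>k \<ge> 1\<close>
  proof (induction k rule: less_induct)
    case (less k)
    show ?case
      by (rule fa_pexp_invert[OF function_algebra_diff_closed[OF A], of k "-1"])
        (use less e_closed[unfolded e_def] in auto)
  qed
qed

section \<open>Generators, Eisenstein series and odd coefficients inside the two algebras\<close>

lemma function_algebra_H_algebra: "function_algebra H_algebra"
  unfolding H_algebra_def by (rule function_algebra_mero_algebra)

lemma function_algebra_U_algebra: "function_algebra U_algebra"
  unfolding U_algebra_def by (rule function_algebra_mero_algebra)

lemma h_coeff_in_H_algebra: "k \<ge> 1 \<Longrightarrow> h_coeff k \<in> H_algebra"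
  unfolding H_algebra_def by (rule mero_algebra.gen) auto

lemma H_algebra_subset_U_algebra: "H_algebra \<subseteq> U_algebra"
  unfolding U_algebra_def by (auto intro: mero_algebra.gen)

text \<open>The value of the heat solution at z = 0 is \<open>eta\<close>, which has no zeros, and
  its heat equation involves the h_k alone; hence \<open>H_algebra\<close> is closed under D by
  itself.\<close>

lemma h_coeff_diff_closed: "k \<ge> 1 \<Longrightarrow> h_coeff k \<in> diff_closed H_algebra"
proof (rule heat_diff_closed[where F = "\<lambda>k. SJ k 0" and \<kappa> = "1/6"])
  have *: "\<forall>\<^sub>\<approx>\<tau>\<in>\<H>. P \<tau>" if "\<And>\<tau>. \<tau> \<in> \<H> \<Longrightarrow> P \<tau>" for P
    using eventually_in_\<H> by eventually_elim (rule that)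
  show "\<forall>\<^sub>\<approx>\<tau>\<in>\<H>. SJ 0 0 \<tau> \<noteq> 0"
    by (rule *) (simp add: SJ_0_eq_eta eta_nonzero)
  show "\<forall>\<^sub>\<approx>\<tau>\<in>\<H>. \<forall>n. SJ n 0 \<tau> = fact n * SJ 0 0 \<tau> * (2 * of_real pi * \<i>) ^ n * pexp (- 1) (\<lambda>k. h_coeff k \<tau>) n"
    by (rule *) (simp only: SJ_0_eq_eta SJ_coeff[symmetric] simp_thms)
qed (rule function_algebra_H_algebra h_coeff_in_H_algebra SJ_deriv | assumption)+

lemma H_algebra_diff_closed: "H_algebra \<subseteq> diff_closed H_algebra"
  unfolding H_algebra_def
  by (rule mero_algebra_diff_closed) (use h_coeff_diff_closed in \<open>auto simp: H_algebra_def\<close>)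

lemma Gc_eq: "\<tau> \<in> \<H> \<Longrightarrow> pexp c (\<lambda>k. f k * Gc \<tau> k) n = pexp c (\<lambda>k. f k * eisenstein k \<tau>) n"
  by (rule pexp_cong) (simp add: Gc_def)

text \<open>Only relations of even index are available, which is enough since the odd Eisenstein
  series are 0. The weight 2 - 2^(n+1) of the top term is nonzero for n >= 1.\<close>

lemma eisenstein_in_H_algebra: "n \<ge> 1 \<Longrightarrow> eisenstein n \<in> H_algebra"
proof (induction n rule: less_induct)
  case (less n)
  note A = function_algebra_H_algebra
  show ?case
  proof (cases "even n")
    case False
    then have "eisenstein n = (\<lambda>_. 0)" by (simp add: eisenstein_def fun_eq_iff)
    then show ?thesis using fa_const[OF A] by simp
  next
    case True
    have "(\<lambda>\<tau>. pexp (- 1) (\<lambda>k. h_coeff k \<tau>) n) \<in> H_algebra"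
      by (intro fa_pexp[OF A] h_coeff_in_H_algebra) auto
    moreover have "(\<lambda>\<tau>. pexp (- 1) (\<lambda>k. h_coeff k \<tau>) n) \<simeq> (\<lambda>\<tau>. pexp 1 (\<lambda>k. (2 - 2 ^ Suc k) * eisenstein k \<tau>) n)"
      by (rule mero_eqI) (simp only: h_even_coeff[OF _ True] Gc_eq)
    ultimately have p: "(\<lambda>\<tau>. pexp 1 (\<lambda>k. (2 - 2 ^ Suc k) * eisenstein k \<tau>) n) \<in> H_algebra"
      by (rule fa_cong[OF A])
    have "(\<lambda>\<tau>. (2 - 2 ^ Suc n) * eisenstein n \<tau>) \<in> H_algebra"
      using p less by (intro fa_pexp_invert[OF A, of n 1 "\<lambda>k \<tau>. (2 - 2 ^ Suc k) * eisenstein k \<tau>"] fa_cmult[OF A]) auto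
    then have "(\<lambda>\<tau>. 1 / (2 - 2 ^ Suc n) * ((2 - 2 ^ Suc n) * eisenstein n \<tau>)) \<in> H_algebra"
      by (rule fa_cmult[OF A])
    moreover have "(2 - 2 ^ Suc n :: complex) \<noteq> 0"
    proof
      assume "(2 - 2 ^ Suc n :: complex) = 0"
      then have "(2::complex) ^ n = 1" by simp
      then have "norm ((2::complex) ^ n) = 1" by simp
      then have "(2::real) ^ n = 1" by (simp add: norm_power)
      moreover have "(2::real) ^ 1 \<le> 2 ^ n" using less.prems by (intro power_increasing) auto
      ultimately show False by simp
    qed
    ultimately show ?thesis by (simp del: power_Suc)
  qed
qed

text \<open>For odd n the coefficient of exp (- g) is g_1 times a polynomial in Eisenstein series,
  and these lie in \<open>H_algebra\<close>. Solving for g_n uses lower g_j of both parities, hence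
  strong induction.\<close>

lemma g_coeff_in_U_algebra: "n \<ge> 1 \<Longrightarrow> g_coeff n \<in> U_algebra"
proof (induction n rule: less_induct)
  case (less n)
  note A = function_algebra_U_algebra
  have gen: "g_coeff k \<in> U_algebra" if "k = 1 \<or> k \<ge> 1 \<and> even k" for k
    unfolding U_algebra_def using that by (intro mero_algebra.gen) auto
  show ?case
  proof (cases "even n")
    case True
    then show ?thesis using less.prems gen by blast
  next
    case False
    have "(\<lambda>\<tau>. - 1 * g_coeff 1 \<tau> * pexp (- 2) (\<lambda>k. 1 * eisenstein k \<tau>) (n - 1)) \<in> U_algebra"
      using eisenstein_in_H_algebra H_algebra_subset_U_algebra
      by (intro fa_mult[OF A] fa_cmult[OF A] fa_pexp[OF A] fa_const[OF A] gen) auto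
    moreover have "(\<lambda>\<tau>. - 1 * g_coeff 1 \<tau> * pexp (- 2) (\<lambda>k. 1 * eisenstein k \<tau>) (n - 1)) \<simeq> (\<lambda>\<tau>. pexp (- 1) (\<lambda>k. g_coeff k \<tau>) n)"
    proof (rule mero_eqI_T_fun_nonzero)
      fix \<tau> assume \<tau>: "\<tau> \<in> \<H>" "T_fun 0 \<tau> \<noteq> 0"
      show "- 1 * g_coeff 1 \<tau> * pexp (- 2) (\<lambda>k. 1 * eisenstein k \<tau>) (n - 1) = pexp (- 1) (\<lambda>k. g_coeff k \<tau>) n"
        using g_odd_coeff[OF \<tau> False] Gc_eq[OF \<tau>(1), of "- 2" "\<lambda>_. 1" "n - 1"] by simp
    qed
    ultimately have "(\<lambda>\<tau>. pexp (- 1) (\<lambda>k. g_coeff k \<tau>) n) \<in> U_algebra"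
      by (rule fa_cong[OF A])
    then show ?thesis
      using less by (intro fa_pexp_invert[OF A, of n "-1" g_coeff]) auto
  qed
qed

lemma g_coeff_diff_closed: "k \<ge> 1 \<Longrightarrow> g_coeff k \<in> diff_closed U_algebra"
proof (rule heat_diff_closed[where F = "\<lambda>k. TJ k 0" and \<kappa> = "1/2"])
  show "\<forall>\<^sub>\<approx>\<tau>\<in>\<H>. TJ 0 0 \<tau> \<noteq> 0"
    using T_fun_0_nonzero by (simp add: T_fun_eq_TJ)
  show "\<forall>\<^sub>\<approx>\<tau>\<in>\<H>. \<forall>n. TJ n 0 \<tau> = fact n * TJ 0 0 \<tau> * (2 * of_real pi * \<i>) ^ n * pexp (- 1) (\<lambda>k. g_coeff k \<tau>) n"
    using T_fun_0_nonzero eventually_in_\<H>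
  proof eventually_elim
    case (elim \<tau>)
    from TJ_coeff[OF elim(2,1)] show ?case unfolding T_fun_eq_TJ by blast
  qed
qed (rule function_algebra_U_algebra g_coeff_in_U_algebra TJ_deriv | assumption)+

lemma U_algebra_diff_closed: "U_algebra \<subseteq> diff_closed U_algebra"
proof -
  have "diff_closed H_algebra \<subseteq> diff_closed U_algebra"
    using H_algebra_subset_U_algebra by (auto simp: diff_closed_def)
  then have "H_algebra \<union> {g_coeff 1} \<union> {g_coeff k |k. k \<ge> 1 \<and> even k} \<subseteq> diff_closed U_algebra"
    using H_algebra_diff_closed g_coeff_diff_closed by auto
  then show ?thesis unfolding U_algebra_def by (rule mero_algebra_diff_closed)
qed

lemma u_coeff_in_U_algebra: "n \<ge> 1 \<Longrightarrow> u_coeff n \<in> U_algebra"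
proof (induction n rule: less_induct)
  case (less n)
  note A = function_algebra_U_algebra
  have "gamma_coeff j \<in> U_algebra" if "j \<ge> 1" for j
    unfolding gamma_coeff_def[abs_def]
    using eisenstein_in_H_algebra[OF that] H_algebra_subset_U_algebra g_coeff_in_U_algebra[OF that]
    by (intro fa_diff[OF A] fa_cmult[OF A]) auto
  moreover have "h_coeff j \<in> U_algebra" if "j \<ge> 1" for j
    using h_coeff_in_H_algebra[OF that] H_algebra_subset_U_algebra by blast
  ultimately have "(\<lambda>\<tau>. pexp 2 (\<lambda>k. gamma_coeff k \<tau>) n + 2 * g_coeff 1 \<tau> * pexp (- 1) (\<lambda>k. h_coeff k \<tau>) (n - 1)) \<in> U_algebra"
    by (intro fa_add[OF A] fa_mult[OF A] fa_const[OF A] fa_pexp[OF A] g_coeff_in_U_algebra) auto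
  then have "(\<lambda>\<tau>. pexp 2 (\<lambda>k. u_coeff k \<tau>) n) \<in> U_algebra"
    by (rule fa_cong[OF A]) (rule mero_eqI_T_fun_nonzero, rule u_coeff_relation[symmetric], use less.prems in auto)
  then show ?case
    using less by (intro fa_pexp_invert[OF A, of n 2 u_coeff]) auto
qed

theorem theorem1p7:
  shows "(\<forall>k\<ge>1. u_coeff k \<in> U_algebra)
    \<and> (\<forall>k\<ge>1. u_coeff k \<simeq>
         (\<lambda>\<tau>. - (fact k / 2) * (\<Sum>lam\<in>partitions k - {{#k#}}. phi lam * partition_prod u_coeff lam \<tau>)
              + fact k / 2 * partition_trace k phi gamma_coeff \<tau>
              + fact k * g_coeff 1 \<tau> * partition_trace (k - 1) psi h_coeff \<tau>))
    \<and> (\<forall>f\<in>U_algebra. q_deriv f \<in> U_algebra)"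
proof (intro conjI allI impI ballI)
  fix k :: nat assume k: "k \<ge> 1"
  show "u_coeff k \<in> U_algebra" using k by (rule u_coeff_in_U_algebra)
  show "u_coeff k \<simeq>
         (\<lambda>\<tau>. - (fact k / 2) * (\<Sum>lam\<in>partitions k - {{#k#}}. phi lam * partition_prod u_coeff lam \<tau>)
              + fact k / 2 * partition_trace k phi gamma_coeff \<tau>
              + fact k * g_coeff 1 \<tau> * partition_trace (k - 1) psi h_coeff \<tau>)"
    unfolding partition_trace_phi partition_trace_psi phi_partition_prod
  \<comment> \<open>Off the zeros of \<open>T_fun 0\<close> the formula holds pointwise: it is the
    top coefficient of the relation of exponentials, with the one-part partition isolated.\<close>
  proof (rule mero_eqI_T_fun_nonzero)
    fix \<tau> assume "\<tau> \<in> \<H>" "T_fun 0 \<tau> \<noteq> 0"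
    from u_coeff_relation[OF this k] pexp_split[OF k, of 2 "\<lambda>k. u_coeff k \<tau>"]
    have "2 * u_coeff k \<tau> / fact k + (\<Sum>lam\<in>partitions k - {{#k#}}. pweight (\<lambda>j. 2 * u_coeff j \<tau> / fact j) lam)
      = pexp 2 (\<lambda>k. gamma_coeff k \<tau>) k + 2 * g_coeff 1 \<tau> * pexp (- 1) (\<lambda>k. h_coeff k \<tau>) (k - 1)"
      by simp
    then have "2 * u_coeff k \<tau> / fact k = pexp 2 (\<lambda>k. gamma_coeff k \<tau>) k + 2 * g_coeff 1 \<tau> * pexp (- 1) (\<lambda>k. h_coeff k \<tau>) (k - 1)
       - (\<Sum>lam\<in>partitions k - {{#k#}}. pweight (\<lambda>j. 2 * u_coeff j \<tau> / fact j) lam)"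
      by (simp add: algebra_simps)
    then show "u_coeff k \<tau> = - (fact k / 2) * (\<Sum>lam\<in>partitions k - {{#k#}}. pweight (\<lambda>j. 2 * u_coeff j \<tau> / fact j) lam)
              + fact k / 2 * pexp 2 (\<lambda>k. gamma_coeff k \<tau>) k
              + fact k * g_coeff 1 \<tau> * pexp (- 1) (\<lambda>k. h_coeff k \<tau>) (k - 1)"
      by (simp add: field_simps)
  qed
next
  fix f assume "f \<in> U_algebra"
  then show "q_deriv f \<in> U_algebra" using U_algebra_diff_closed by (auto simp: diff_closed_def)
qed

end
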